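(* Let $T>0$, $s>0$, $d\ge 1$ and $p\ge 0$. Consider the Cauchy problem $$i u_t(t,x)+(-\Delta)^s u(t,x)+p(x)u(t,x)=0,\quad (t,x)\in(0,T)\times\mathbb{R}^d,\qquad u(0,x)=u_0(x).\qquad ( * )$$ Assume that the regularisations $(p_\varepsilon)_{\varepsilon\in(0,1]}$ of the coefficient $p$ (where $p\ge 0$ means that $p_\varepsilon\ge 0$ for all $\varepsilon\in(0,1]$) and $(u_{0,\varepsilon})_{\varepsilon\in(0,1]}$ of the Cauchy data $u_0$ satisfy the following: there exist $N,N_0\in\mathbb{N}_0$ and constants $C,C_0>0$ such that for all $\varepsilon\in(0,1]$ $$\|p_\varepsilon\|_{L^\infty(\mathbb{R}^d)}\le C\varepsilon^{-N}\quad\text{and}\quad \|u_{0,\varepsilon}\|_{H^s(\mathbb{R}^d)}\le C_0\varepsilon^{-N_0}.$$ Then the Cauchy problem $( * )$ has a very weak solution of order $s$.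
   Context: $(-\Delta)^s$ is the fractional Laplacian on $\mathbb{R}^d$, i.e. the Fourier multiplier with symbol $|\xi|^{2s}$; $H^s(\mathbb{R}^d)=\{u\in L^2(\mathbb{R}^d):\|u\|_{H^s}:=\|u\|_{L^2}+\|(-\Delta)^{s/2}u\|_{L^2}<\infty\}$. Functions $u$ are complex-valued. Equations are understood in the sense of distributions on $(0,T)\times\mathbb{R}^d$. Regularisations. The coefficient $p$ and the data $u_0$ may be singular and enter only through nets $(p_\varepsilon)_{\varepsilon\in(0,1]}$ and $(u_{0,\varepsilon})_{\varepsilon\in(0,1]}$ of functions on $\mathbb{R}^d$ regularising them. When $p$ and $u_0$ are distributions, one takes $p_\varepsilon=p*\psi_\varepsilon$, $u_{0,\varepsilon}=u_0*\psi_\varepsilon$, where $\psi_\varepsilon(x)=\varepsilon^{-d}\psi(x/\varepsilon)$ and $\psi\in C_0^\infty(\mathbb{R}^d)$, $\psi\ge 0$, $\int\psi=1$ (a Friedrichs mollifier). For more generality, the assumptions are placed on the nets instead of on $p$ and $u_0$. The condition $p\ge0$ is understood as: $p_\varepsilon\ge 0$ for all $\varepsilon\in(0,1]$. Moderateness. A net $(f_\varepsilon)$ of functions in $H^s(\mathbb{R}^d)$ is $H^s$-moderate if there are $N\in\mathbb{N}_0$, $c>0$ with $\|f_\varepsilon\|_{H^s}\le c\varepsilon^{-N}$ for all $\varepsilon\in(0,1]$. A net $(g_\varepsilon)$ is $L^\infty$-moderate if there are $N\in\mathbb{N}_0$, $c>0$ with $\|g_\varepsilon\|_{L^\infty}\le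 c\varepsilon^{-N}$ for all $\varepsilon\in(0,1]$. A net $(u_\varepsilon)$ in $C([0,T];H^s)$ is moderate if there are $N\in\mathbb{N}_0$, $c>0$ with $\|u_\varepsilon(t,\cdot)\|_{H^s}\le c\varepsilon^{-N}$ for all $t\in[0,T]$ and all $\varepsilon\in(0,1]$. Very weak solution. A net $(u_\varepsilon)_{\varepsilon\in(0,1]}$ in $C([0,T];H^s)$ is a very weak solution of order $s$ to the Cauchy problem $( * )$ if there exist an $L^\infty$-moderate regularisation $(p_\varepsilon)$ of $p$ and an $H^s$-moderate regularisation $(u_{0,\varepsilon})$ of $u_0$ such that, for every $\varepsilon\in(0,1]$, $u_\varepsilon$ solves $$i\partial_t u_\varepsilon+(-\Delta)^s u_\varepsilon+p_\varepsilon(x)u_\varepsilon=0,\qquad u_\varepsilon(0,x)=u_{0,\varepsilon}(x),$$ on $[0,T]\times\mathbb{R}^d$, and the net $(u_\varepsilon)$ is moderate as a net in $C([0,T];H^s)$, i.e. there are $N\in\mathbb{N}_0$, $c>0$ with $\|u_\varepsilon(t,\cdot)\|_{H^s}\le c\varepsilon^{-N}$ for all $t\in[0,T]$ and all $\varepsilon\in(0,1]$. *)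

theory Defs
  imports "HOL-Analysis.Analysis" "HOL-Probability.Essential_Supremum"
begin

text \<open>
  Elements of \<open>L\<^sup>2\<close>, \<open>L\<^sup>\<infinity>\<close> and \<open>H\<^sup>s\<close> are represented by Lebesgue measurable functions; nothing below
  depends on the choice of a representative modulo null sets.
\<close>

subsection \<open>Lebesgue spaces\<close>

definition L2 :: "('a::euclidean_space \<Rightarrow> complex) \<Rightarrow> bool" where
  "L2 f \<longleftrightarrow> f \<in> borel_measurable lebesgue \<and> integrable lebesgue (\<lambda>x. (norm (f x))\<^sup>2)"

definition L2_norm :: "('a::euclidean_space \<Rightarrow> complex) \<Rightarrow> real" where
  "L2_norm f = sqrt (LINT x|lebesgue. (norm (f x))\<^sup>2)"

definition Linf_norm :: "('a::euclidean_space \<Rightarrow> real) \<Rightarrow> ereal" where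
  "Linf_norm f = esssup lebesgue (\<lambda>x. ereal \<bar>f x\<bar>)"

text \<open>Measurability of \<open>f\<close> is required separately, since \<^const>\<open>Linf_norm\<close> only sees \<open>\<bar>f\<bar>\<close>.\<close>

definition Linf :: "('a::euclidean_space \<Rightarrow> real) \<Rightarrow> bool" where
  "Linf f \<longleftrightarrow> f \<in> borel_measurable lebesgue \<and> Linf_norm f < \<infinity>"


subsection \<open>Fourier transform\<close>

text \<open>The unitary normalisation with kernel \<open>exp (- i x \<cdot> \<xi>)\<close>, for which \<open>-\<Delta>\<close> has symbol \<open>|\<xi>|\<^sup>2\<close>.
  The two integrals are meant for (Lebesgue) integrable \<open>f\<close>.\<close>

definition fourier_L1 :: "('a::euclidean_space \<Rightarrow> complex) \<Rightarrow> 'a \<Rightarrow> complex" where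
  "fourier_L1 f \<xi> =
     complex_of_real ((2 * pi) powr (- real DIM('a) / 2)) *
       (LINT x|lebesgue. exp (- \<i> * complex_of_real (x \<bullet> \<xi>)) * f x)"

definition inv_fourier_L1 :: "('a::euclidean_space \<Rightarrow> complex) \<Rightarrow> 'a \<Rightarrow> complex" where
  "inv_fourier_L1 f x =
     complex_of_real ((2 * pi) powr (- real DIM('a) / 2)) *
       (LINT \<xi>|lebesgue. exp (\<i> * complex_of_real (x \<bullet> \<xi>)) * f \<xi>)"

text \<open>On \<open>L\<^sup>2\<close> the Fourier transform is the \<open>L\<^sup>2\<close>-limit of the transforms of the truncations of \<open>f\<close>
  to balls (Plancherel); it is determined almost everywhere.\<close>

definition is_fourier_L2 :: "('a::euclidean_space \<Rightarrow> complex) \<Rightarrow> ('a \<Rightarrow> complex) \<Rightarrow> bool" where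
  "is_fourier_L2 f g \<longleftrightarrow> L2 f \<and> L2 g \<and>
     (\<forall>n. L2 (fourier_L1 (\<lambda>x. indicator (cball 0 (real n)) x * f x))) \<and>
     (\<lambda>n. L2_norm (\<lambda>\<xi>. fourier_L1 (\<lambda>x. indicator (cball 0 (real n)) x * f x) \<xi> - g \<xi>))
       \<longlonglongrightarrow> 0"

definition fourier_L2 :: "('a::euclidean_space \<Rightarrow> complex) \<Rightarrow> 'a \<Rightarrow> complex" where
  "fourier_L2 f = (SOME g. is_fourier_L2 f g)"


subsection \<open>Fractional Laplacian and Sobolev spaces\<close>

text \<open>\<open>is_frac_laplacian a u g\<close>: \<open>g \<in> L\<^sup>2\<close> equals \<open>(-\<Delta>)\<^sup>a u\<close>, the Fourier multiplier with symbol
  \<open>|\<xi>|\<^sup>2\<^sup>a\<close> applied to \<open>u \<in> L\<^sup>2\<close>.\<close>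

definition is_frac_laplacian ::
    "real \<Rightarrow> ('a::euclidean_space \<Rightarrow> complex) \<Rightarrow> ('a \<Rightarrow> complex) \<Rightarrow> bool" where
  "is_frac_laplacian a u g \<longleftrightarrow> L2 u \<and> L2 g \<and>
     (AE \<xi> in lebesgue. fourier_L2 g \<xi> = complex_of_real (norm \<xi> powr (2 * a)) * fourier_L2 u \<xi>)"

definition frac_laplacian :: "real \<Rightarrow> ('a::euclidean_space \<Rightarrow> complex) \<Rightarrow> 'a \<Rightarrow> complex" where
  "frac_laplacian a u = (SOME g. is_frac_laplacian a u g)"

definition Hs :: "real \<Rightarrow> ('a::euclidean_space \<Rightarrow> complex) \<Rightarrow> bool" where
  "Hs s u \<longleftrightarrow> L2 u \<and> (\<exists>g. is_frac_laplacian (s / 2) u g)"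

definition Hs_norm :: "real \<Rightarrow> ('a::euclidean_space \<Rightarrow> complex) \<Rightarrow> real" where
  "Hs_norm s u = L2_norm u + L2_norm (frac_laplacian (s / 2) u)"

text \<open>\<open>C([0,T]; H\<^sup>s)\<close>; values of \<open>u\<close> at times outside \<open>[0,T]\<close> are irrelevant.\<close>

definition C_Hs :: "real \<Rightarrow> real \<Rightarrow> (real \<Rightarrow> 'a::euclidean_space \<Rightarrow> complex) \<Rightarrow> bool" where
  "C_Hs T s u \<longleftrightarrow> (\<forall>t\<in>{0..T}. Hs s (u t)) \<and>
     (\<forall>t\<in>{0..T}. ((\<lambda>\<tau>. Hs_norm s (\<lambda>x. u \<tau> x - u t x)) \<longlongrightarrow> 0) (at t within {0..T}))"


subsection \<open>Distributions on \<open>(0,T) \<times> \<real>\<^sup>d\<close>\<close>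

text \<open>On a finite-dimensional space, \<open>C_k k f\<close> says that \<open>f\<close> is of class \<open>C\<^sup>k\<close>: \<open>f\<close> is differentiable and
  all its directional derivatives are of class \<open>C\<^sup>k\<^sup>-\<^sup>1\<close>.\<close>

primrec C_k :: "nat \<Rightarrow> ('v::euclidean_space \<Rightarrow> complex) \<Rightarrow> bool" where
  "C_k 0 f \<longleftrightarrow> continuous_on UNIV f"
| "C_k (Suc k) f \<longleftrightarrow> (\<forall>x. f differentiable (at x)) \<and>
     (\<forall>v. C_k k (\<lambda>x. frechet_derivative f (at x) v))"

definition test_fun :: "real \<Rightarrow> (real \<times> 'a::euclidean_space \<Rightarrow> complex) \<Rightarrow> bool" where
  "test_fun T \<phi> \<longleftrightarrow> (\<forall>k. C_k k \<phi>) \<and>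
     compact (closure {z. \<phi> z \<noteq> 0}) \<and> closure {z. \<phi> z \<noteq> 0} \<subseteq> {0<..<T} \<times> UNIV"

text \<open>Distributions appear as functionals on test functions. Pairings are bilinear (no complex
  conjugation). For \<open>u \<in> C([0,T]; H\<^sup>s)\<close> all the integrals below converge absolutely.\<close>

definition dist_of ::
    "real \<Rightarrow> (real \<Rightarrow> 'a::euclidean_space \<Rightarrow> complex) \<Rightarrow> (real \<times> 'a \<Rightarrow> complex) \<Rightarrow> complex" where
  "dist_of T u \<phi> = (LINT t:{0<..<T}|lebesgue. (LINT x|lebesgue. u t x * \<phi> (t, x)))"

definition dist_dt ::
    "((real \<times> 'a::euclidean_space \<Rightarrow> complex) \<Rightarrow> complex) \<Rightarrow> (real \<times> 'a \<Rightarrow> complex) \<Rightarrow> complex" where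
  "dist_dt \<Lambda> \<phi> = - \<Lambda> (\<lambda>(t, x). vector_derivative (\<lambda>\<tau>. \<phi> (\<tau>, x)) (at t))"

text \<open>For \<open>u(t) \<in> H\<^sup>s\<close>, \<open>(-\<Delta>)\<^sup>s u(t)\<close> is in general only a tempered distribution, namely the one with
  Fourier transform \<open>|\<xi>|\<^sup>2\<^sup>s \<F>u(t)\<close>. Its pairing with a test function is therefore the pairing of
  \<open>|\<xi>|\<^sup>2\<^sup>s \<F>u(t)\<close> with the inverse Fourier transform of the test function.\<close>

definition dist_frac_laplacian ::
    "real \<Rightarrow> real \<Rightarrow> (real \<Rightarrow> 'a::euclidean_space \<Rightarrow> complex) \<Rightarrow> (real \<times> 'a \<Rightarrow> complex) \<Rightarrow> complex" where
  "dist_frac_laplacian T s u \<phi> =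
     (LINT t:{0<..<T}|lebesgue. (LINT \<xi>|lebesgue.
        complex_of_real (norm \<xi> powr (2 * s)) * fourier_L2 (u t) \<xi> *
        inv_fourier_L1 (\<lambda>x. \<phi> (t, x)) \<xi>))"


subsection \<open>The Cauchy problem and its very weak solutions\<close>

definition solves_cauchy ::
    "real \<Rightarrow> real \<Rightarrow> ('a::euclidean_space \<Rightarrow> real) \<Rightarrow> ('a \<Rightarrow> complex) \<Rightarrow>
     (real \<Rightarrow> 'a \<Rightarrow> complex) \<Rightarrow> bool" where
  "solves_cauchy T s p u0 u \<longleftrightarrow> C_Hs T s u \<and>
     (\<forall>\<phi>. test_fun T \<phi> \<longrightarrow>
        \<i> * dist_dt (dist_of T u) \<phi> + dist_frac_laplacian T s u \<phi>
          + dist_of T (\<lambda>t x. complex_of_real (p x) * u t x) \<phi> = 0) \<and>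
     (AE x in lebesgue. u 0 x = u0 x)"

text \<open>Nets are functions of \<open>\<epsilon> :: real\<close> of which only the values on \<open>(0,1]\<close> matter.\<close>

definition Linf_moderate :: "(real \<Rightarrow> 'a::euclidean_space \<Rightarrow> real) \<Rightarrow> bool" where
  "Linf_moderate g \<longleftrightarrow> (\<forall>\<epsilon>\<in>{0<..1}. Linf (g \<epsilon>)) \<and>
     (\<exists>(N::nat) c. c > 0 \<and> (\<forall>\<epsilon>\<in>{0<..1}. Linf_norm (g \<epsilon>) \<le> ereal (c / \<epsilon> ^ N)))"

definition Hs_moderate :: "real \<Rightarrow> (real \<Rightarrow> 'a::euclidean_space \<Rightarrow> complex) \<Rightarrow> bool" where
  "Hs_moderate s f \<longleftrightarrow> (\<forall>\<epsilon>\<in>{0<..1}. Hs s (f \<epsilon>)) \<and>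
     (\<exists>(N::nat) c. c > 0 \<and> (\<forall>\<epsilon>\<in>{0<..1}. Hs_norm s (f \<epsilon>) \<le> c / \<epsilon> ^ N))"

definition C_Hs_moderate ::
    "real \<Rightarrow> real \<Rightarrow> (real \<Rightarrow> real \<Rightarrow> 'a::euclidean_space \<Rightarrow> complex) \<Rightarrow> bool" where
  "C_Hs_moderate T s u \<longleftrightarrow> (\<forall>\<epsilon>\<in>{0<..1}. C_Hs T s (u \<epsilon>)) \<and>
     (\<exists>(N::nat) c. c > 0 \<and> (\<forall>t\<in>{0..T}. \<forall>\<epsilon>\<in>{0<..1}. Hs_norm s (u \<epsilon> t) \<le> c / \<epsilon> ^ N))"

text \<open>
  The singular data \<open>p\<close> and \<open>u0\<close> need not be functions, nor even distributions, and enter only through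
  the nets regularising them. They are therefore of arbitrary types, and \<open>reg_p p pe\<close> and
  \<open>reg_u0 u0 u0e\<close> express that the nets \<open>pe\<close> and \<open>u0e\<close> are regularisations of \<open>p\<close> and \<open>u0\<close>. For
  distributions, for example, these relations can be taken to be convolution with a Friedrichs
  mollifier.
\<close>

definition very_weak_solution ::
    "('p \<Rightarrow> (real \<Rightarrow> 'a::euclidean_space \<Rightarrow> real) \<Rightarrow> bool) \<Rightarrow>
     ('q \<Rightarrow> (real \<Rightarrow> 'a \<Rightarrow> complex) \<Rightarrow> bool) \<Rightarrow>
     real \<Rightarrow> real \<Rightarrow> 'p \<Rightarrow> 'q \<Rightarrow> (real \<Rightarrow> real \<Rightarrow> 'a \<Rightarrow> complex) \<Rightarrow> bool" where
  "very_weak_solution reg_p reg_u0 T s p u0 u \<longleftrightarrow>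
     (\<exists>pe u0e. reg_p p pe \<and> Linf_moderate pe \<and> reg_u0 u0 u0e \<and> Hs_moderate s u0e \<and>
        (\<forall>\<epsilon>\<in>{0<..1}. solves_cauchy T s (pe \<epsilon>) (u0e \<epsilon>) (u \<epsilon>))) \<and>
     C_Hs_moderate T s u"

end

theory Submission
  imports Defs "HOL-Probability.Characteristic_Functions"
begin

text \<open>
  Fix \<open>\<epsilon>\<close> and write \<open>A = (-\<Delta>)\<^sup>s\<close>. The regularised equation \<open>i u' + (A + p) u = 0\<close> has a bounded potential
  \<open>p \<ge> 0\<close>, and its formal solution \<open>exp (i t (A + p)) u\<^sub>0\<close> conserves the \<open>L\<^sup>2\<close> norm and the energy
  \<open>\<parallel>A\<^sup>1\<^sup>/\<^sup>2 u\<parallel>\<^sup>2 + \<integral> p |u|\<^sup>2\<close>. Because \<open>p \<ge> 0\<close>, the energy dominates \<open>\<parallel>A\<^sup>1\<^sup>/\<^sup>2 u\<parallel>\<^sup>2\<close>, and initially it is at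
  most \<open>(1 + \<parallel>p\<parallel>\<^sub>\<infinity>) \<parallel>u\<^sub>0\<parallel>\<^sup>2\<close> in the \<open>H\<^sup>s\<close> norm. Hence \<open>\<parallel>u(t)\<parallel> \<le> (2 + \<parallel>p\<parallel>\<^sub>\<infinity>) \<parallel>u\<^sub>0\<parallel>\<close> in \<open>H\<^sup>s\<close>, and moderate
  coefficients and data give a moderate net of solutions. The work lies in constructing the flow
  on \<open>H\<^sup>s\<close>, proving its strong continuity there, and verifying the equation against test functions.

  The construction is a Galerkin scheme in frequency space, carried out abstractly in the locale
  \<open>galerkin\<close>. Let \<open>P\<^sub>n\<close> be a frequency cutoff. The bounded self-adjoint operator \<open>A P\<^sub>n + P\<^sub>n p P\<^sub>n\<close>
  generates an exponential series, whose orbits \<open>u\<^sub>n\<close> conserve their own energy. In the derivative of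
  \<open>\<parallel>u\<^sub>n - u\<^sub>k\<parallel>\<^sup>2\<close> everything cancels by skew-symmetry except \<open>\<langle>p u\<^sub>k, i (P\<^sub>n - P\<^sub>k) u\<^sub>n\<rangle>\<close>, and the energy
  bound makes the high frequencies \<open>(P\<^sub>n - P\<^sub>k) u\<^sub>n\<close> small at a rate depending on \<open>k\<close> only
  (\<open>flow_cauchy\<close>). So the approximations converge uniformly on bounded time intervals, although \<open>p\<close>
  is merely bounded and need not preserve \<open>H\<^sup>s\<close>. The limit satisfies an energy inequality; being a group,
  it can be run backwards, and the inequality becomes an equality (\<open>energy_conservation\<close>). Thus
  \<open>t \<mapsto> \<parallel>A\<^sup>1\<^sup>/\<^sup>2 u(t)\<parallel>\<close> is continuous, which improves continuity in \<open>L\<^sup>2\<close> to continuity in \<open>H\<^sup>s\<close>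
  (\<open>U_continuous_kin\<close>). Test functions lie in the domain of \<open>A\<close>, so the weak equation passes to the
  limit (\<open>U_weak\<close>).

  To apply this, \<open>L\<^sup>2\<close> is made into a Hilbert space type \<open>l2\<close>, and the Fourier transform is shown to be
  unitary on it. Plancherel's identity is proved for continuous functions of compact support by
  Gaussian regularisation (\<open>Plancherel_Cc\<close>) and extended by density
  (\<open>Plancherel_bounded_support\<close>). Surjectivity follows from the multiplication formula
  \<open>\<integral> \<F>f g = \<integral> f \<F>g\<close> (\<open>inner_FT_cconj\<close>): it says that the adjoint of the isometry \<open>\<F>\<close> is again an
  isometry. Derivatives of test functions become multiplication by coordinates, which places
  \<open>|\<xi>|\<^sup>2\<^sup>s\<close> times the transform of a test function in \<open>L\<^sup>2\<close> uniformly in time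
  (\<open>weighted_fourier_test_bound\<close>).
\<close>

section \<open>Linear evolution equations with a bounded generator\<close>

text \<open>
  The orbit \<open>exp (t K) x\<close>, as a series of vectors and not of operators, so that only the norm of the
  state space occurs.
\<close>

definition exp_orbit :: "('h::banach \<Rightarrow> 'h) \<Rightarrow> real \<Rightarrow> 'h \<Rightarrow> 'h" where
  "exp_orbit K t x = (\<Sum>k. (t ^ k / fact k) *\<^sub>R (K ^^ k) x)"

lemma norm_funpow_le:
  fixes K :: "'h::real_normed_vector \<Rightarrow> 'h"
  assumes "\<And>x. norm (K x) \<le> L * norm x" "L \<ge> 0"
  shows "norm ((K ^^ k) x) \<le> L ^ k * norm x"
proof (induction k)
  case (Suc k)
  have "norm ((K ^^ Suc k) x) \<le> L * norm ((K ^^ k) x)" using assms(1) by simp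
  also have "\<dots> \<le> L * (L ^ k * norm x)" by (intro mult_left_mono Suc assms)
  finally show ?case by (simp add: mult.assoc)
qed auto

lemma exp_orbit_0 [simp]: "exp_orbit K 0 x = x"
proof -
  have "(\<lambda>k. (0 ^ k / fact k) *\<^sub>R (K ^^ k) x) = (\<lambda>k. if k = 0 then x else 0)"
    by (auto simp: fun_eq_iff power_0_left)
  then show ?thesis unfolding exp_orbit_def using suminf_finite[of "{0}" "\<lambda>k::nat. if k = 0 then x else 0"] by simp
qed

lemma exp_orbit_summable:
  fixes K :: "'h::banach \<Rightarrow> 'h"
  assumes "\<And>x. norm (K x) \<le> L * norm x" "L \<ge> 0"
  shows "summable (\<lambda>k. (t ^ k / fact k) *\<^sub>R (K ^^ k) x)"
proof (rule summable_comparison_test')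
  show "summable (\<lambda>k. (inverse (fact k) * (\<bar>t\<bar> * L) ^ k) * norm x)"
    by (intro summable_mult2 summable_exp)
  show "norm ((t ^ k / fact k) *\<^sub>R (K ^^ k) x) \<le> (inverse (fact k) * (\<bar>t\<bar> * L) ^ k) * norm x"
    for k
    using mult_left_mono[OF norm_funpow_le[OF assms, where k=k and x=x], of "\<bar>t\<bar> ^ k / fact k"]
    by (simp add: power_abs power_mult_distrib field_simps)
qed

text \<open>
  The differentiated series is \<open>K\<close> applied to the series shifted by one term, and on bounded time
  intervals both converge uniformly by comparison with a real exponential series.
\<close>

lemma exp_orbit_has_vector_derivative:
  fixes K :: "'h::banach \<Rightarrow> 'h"
  assumes K: "bounded_linear K"
  shows "((\<lambda>t. exp_orbit K t x) has_vector_derivative K (exp_orbit K t x)) (at t)"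
proof -
  interpret bounded_linear K by fact
  obtain L where L: "\<And>x. norm (K x) \<le> L * norm x" "L \<ge> 0"
    using nonneg_bounded by (metis mult.commute)
  define R where "R = \<bar>t\<bar> + 1"
  have R: "R > 0" "t \<in> ball 0 R" by (auto simp: R_def)
  define c where "c k t = (t ^ k / fact k) *\<^sub>R (K ^^ k) x" for k and t :: real
  define c' where "c' k t h = (h * (real k * t ^ (k - 1) / fact k)) *\<^sub>R (K ^^ k) x" for k and t h :: real
  have c'_Suc: "c' (Suc k) t h = h *\<^sub>R K (c k t)" for k t h
    by (simp add: c'_def c_def scaleR del: of_nat_Suc)
  have c'_0: "c' 0 t h = 0" for t h by (simp add: c'_def)
  have sumc': "sum (\<lambda>i. c' i t h) {..<Suc n} = h *\<^sub>R K (sum (\<lambda>i. c i t) {..<n})" for n t h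
    by (simp add: sum.lessThan_Suc_shift c'_0 c'_Suc sum scaleR_sum_right del: sum.lessThan_Suc)
  have ul: "uniform_limit (ball 0 R) (\<lambda>n t. \<Sum>i<n. c i t) (\<lambda>t. exp_orbit K t x) sequentially"
    unfolding exp_orbit_def c_def
  proof (rule Weierstrass_m_test)
    show "summable (\<lambda>k. (inverse (fact k) * (R * L) ^ k) * norm x)"
      by (intro summable_mult2 summable_exp)
    fix k and s :: real assume s: "s \<in> ball 0 R"
    have "norm ((s ^ k / fact k) *\<^sub>R (K ^^ k) x) \<le> (\<bar>s\<bar> ^ k / fact k) * (L ^ k * norm x)"
      using mult_left_mono[OF norm_funpow_le[OF L, where k=k and x=x], of "\<bar>s\<bar> ^ k / fact k"]
      by (simp add: power_abs)
    also have "\<dots> \<le> (R ^ k / fact k) * (L ^ k * norm x)"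
      using s L by (intro mult_right_mono divide_right_mono power_mono) auto
    finally show "norm ((s ^ k / fact k) *\<^sub>R (K ^^ k) x) \<le> (inverse (fact k) * (R * L) ^ k) * norm x"
      by (simp add: power_mult_distrib divide_inverse mult_ac)
  qed
  have "\<exists>g. \<forall>s\<in>ball 0 R. (\<lambda>n. c n s) sums (g s) \<and>
          (g has_derivative (\<lambda>h. h *\<^sub>R K (exp_orbit K s x))) (at s within ball 0 R)"
  proof (rule has_derivative_series[where f'=c'])
    show "(c n has_derivative c' n s) (at s within ball 0 R)" for n s
    proof -
      have "((\<lambda>t. t ^ n / fact n) has_derivative (\<lambda>h. h * (real n * s ^ (n - 1) / fact n))) (at s within ball 0 R)"
        by (rule derivative_eq_intros refl | simp add: fun_eq_iff)+
      from has_derivative_scaleR_left[OF this, of "(K ^^ n) x"] show ?thesis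
        by (simp add: c_def[abs_def] c'_def[abs_def])
    qed
    show "(\<lambda>n. c n t) sums exp_orbit K t x"
      unfolding c_def exp_orbit_def by (intro summable_sums exp_orbit_summable[OF L])
    show "t \<in> ball 0 R" by (fact R)
    fix e :: real assume "e > 0"
    then have "e / (L + 1) > 0" using L by simp
    from uniform_limitD[OF ul this]
    have "\<forall>\<^sub>F n in sequentially. \<forall>s\<in>ball 0 R. dist (\<Sum>i<n. c i s) (exp_orbit K s x) < e / (L + 1)" .
    then have "\<forall>\<^sub>F n in sequentially. \<forall>s\<in>ball 0 R. \<forall>h.
        norm (sum (\<lambda>i. c' i s h) {..<Suc n} - h *\<^sub>R K (exp_orbit K s x)) \<le> e * norm h"
    proof (eventually_elim, intro ballI allI)
      fix n and s h :: real
      assume n: "\<forall>s\<in>ball 0 R. dist (\<Sum>i<n. c i s) (exp_orbit K s x) < e / (L + 1)" and s: "s \<in> ball 0 R"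
      have "norm (sum (\<lambda>i. c' i s h) {..<Suc n} - h *\<^sub>R K (exp_orbit K s x))
          = \<bar>h\<bar> * norm (K ((\<Sum>i<n. c i s) - exp_orbit K s x))"
        unfolding sumc' by (simp add: diff flip: scaleR_diff_right)
      also have "\<dots> \<le> \<bar>h\<bar> * (L * (e / (L + 1)))"
        using n s L by (intro mult_left_mono order_trans[OF L(1)]) (auto simp: dist_norm intro: less_imp_le)
      also have "\<dots> \<le> \<bar>h\<bar> * e"
        using L \<open>e > 0\<close> by (intro mult_left_mono) (auto simp: field_simps)
      finally show "norm (sum (\<lambda>i. c' i s h) {..<Suc n} - h *\<^sub>R K (exp_orbit K s x)) \<le> e * norm h"
        by (simp add: mult.commute)
    qed
    then show "\<forall>\<^sub>F n in sequentially. \<forall>s\<in>ball 0 R. \<forall>h.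
        norm (sum (\<lambda>i. c' i s h) {..<n} - h *\<^sub>R K (exp_orbit K s x)) \<le> e * norm h"
      by (rule eventually_sequentially_Suc[THEN iffD1])
  qed auto
  then obtain g where g: "\<And>s. s \<in> ball 0 R \<Longrightarrow> (\<lambda>n. c n s) sums g s"
     "\<And>s. s \<in> ball 0 R \<Longrightarrow> (g has_derivative (\<lambda>h. h *\<^sub>R K (exp_orbit K s x))) (at s within ball 0 R)"
    by blast
  have "g s = exp_orbit K s x" if "s \<in> ball 0 R" for s
    using g(1)[OF that] unfolding exp_orbit_def c_def by (simp add: sums_iff)
  note g_eq = this
  have "(g has_derivative (\<lambda>h. h *\<^sub>R K (exp_orbit K t x))) (at t)"
    using g(2)[OF R(2)] R(2) by (simp add: at_within_open[OF _ open_ball])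
  then have "((\<lambda>s. exp_orbit K s x) has_derivative (\<lambda>h. h *\<^sub>R K (exp_orbit K t x))) (at t)"
    by (rule has_derivative_transform_within_open[OF _ open_ball R(2)]) (rule g_eq)
  then show ?thesis unfolding has_vector_derivative_def .
qed

lemma has_vector_derivative_inner:
  fixes f g :: "real \<Rightarrow> 'h::real_inner"
  assumes "(f has_vector_derivative f') (at t)" "(g has_vector_derivative g') (at t)"
  shows "((\<lambda>t. inner (f t) (g t)) has_real_derivative inner (f t) g' + inner f' (g t)) (at t)"
  using has_derivative_inner[OF assms[unfolded has_vector_derivative_def]]
  unfolding has_field_derivative_def
  by (rule has_derivative_eq_rhs) (simp add: fun_eq_iff algebra_simps)

text \<open>
  Conservation of the norm: \<open>(\<parallel>f\<parallel>\<^sup>2)' = 2 \<langle>K f, f\<rangle> = 0\<close>. Applied to differences, it yields uniqueness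
  and stability of orbits.
\<close>

lemma skew_orbit_norm:
  fixes f :: "real \<Rightarrow> 'h::real_inner"
  assumes "\<And>t. (f has_vector_derivative K (f t)) (at t)" "\<And>x. inner (K x) x = 0"
  shows "norm (f t) = norm (f r)"
proof -
  have "((\<lambda>t. inner (f t) (f t)) has_real_derivative 0) (at t)" for t
    using has_vector_derivative_inner[OF assms(1)[of t] assms(1)[of t]] assms(2)
    by (simp add: inner_commute)
  then have "inner (f t) (f t) = inner (f r) (f r)" by (rule DERIV_isconst_all[rule_format])
  then show ?thesis by (simp add: norm_eq_sqrt_inner)
qed

lemma skew_orbit_unique:
  fixes f g :: "real \<Rightarrow> 'h::real_inner"
  assumes K: "bounded_linear K"
    and "\<And>t. (f has_vector_derivative K (f t)) (at t)" "\<And>t. (g has_vector_derivative K (g t)) (at t)"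
    and "\<And>x. inner (K x) x = 0"
  shows "norm (f t - g t) = norm (f r - g r)"
proof -
  interpret bounded_linear K by fact
  have "((\<lambda>t. f t - g t) has_vector_derivative K (f t - g t)) (at t)" for t
    unfolding diff by (intro has_vector_derivative_diff assms)
  from skew_orbit_norm[of "\<lambda>t. f t - g t", OF this assms(4)] show ?thesis .
qed

section \<open>Galerkin approximation of an abstract Schroedinger equation\<close>

text \<open>
  A real Hilbert space serves as the state space; the complex structure enters only through
  multiplication by \<open>i\<close>, the operator \<open>J\<close>. \<open>W\<close> is the potential, \<open>P n\<close> the cutoff to low frequencies and
  \<open>A n\<close> the unbounded operator \<open>A\<close> composed with that cutoff. The domain and the form domain of \<open>A\<close> are
  thus described by bounded operators only: \<open>x\<close> has finite kinetic energy when \<open>\<langle>A n x, x\<rangle>\<close> is bounded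
  in \<open>n\<close>. The assumption \<open>P_tail\<close> says that a finite kinetic energy makes high frequencies small.
\<close>

locale galerkin =
  fixes J W :: "'h::{real_inner,banach} \<Rightarrow> 'h" and P A :: "nat \<Rightarrow> 'h \<Rightarrow> 'h"
    and M :: real and \<delta> :: "nat \<Rightarrow> real"
  assumes J_linear: "bounded_linear J" and W_linear: "bounded_linear W"
    and P_linear: "bounded_linear (P n)" and A_linear: "bounded_linear (A n)"
    and J_skew: "inner (J x) y = - inner x (J y)" and norm_J: "norm (J x) = norm x"
    and W_sym: "inner (W x) y = inner x (W y)" and W_nonneg: "0 \<le> inner (W x) x"
    and W_le: "norm (W x) \<le> M * norm x" and W_J: "W (J x) = J (W x)" and M_nonneg: "0 \<le> M"
    and P_sym: "inner (P n x) y = inner x (P n y)" and P_P: "P k (P n x) = P (min k n) x"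
    and P_J: "P n (J x) = J (P n x)"
    and A_sym: "inner (A n x) y = inner x (A n y)" and A_nonneg: "0 \<le> inner (A n x) x"
    and A_J: "A n (J x) = J (A n x)" and A_P: "A k (P n x) = A (min k n) x"
    and P_A: "P k (A n x) = A (min k n) x"
    and P_tail: "k \<le> n \<Longrightarrow> (norm (P n x - P k x))\<^sup>2 \<le> \<delta> k * inner (A n x) x"
    and \<delta>_tendsto: "\<delta> \<longlonglongrightarrow> 0" and \<delta>_nonneg: "0 \<le> \<delta> n"
    and P_tendsto: "(\<lambda>n. P n x) \<longlonglongrightarrow> x"
begin

sublocale J: bounded_linear J by (fact J_linear)
sublocale W: bounded_linear W by (fact W_linear)
sublocale P: bounded_linear "P n" for n by (fact P_linear)
sublocale A: bounded_linear "A n" for n by (fact A_linear)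

lemma J_skew_sym:
  assumes "\<And>x y. inner (S x) y = inner x (S y)" "\<And>x. S (J x) = J (S x)"
  shows "inner (J (S x)) x = 0"
proof -
  have "inner (J (S x)) x = - inner x (J (S x))"
    by (metis assms J_skew)
  then show ?thesis by (simp add: inner_commute)
qed

lemma norm_P_le: "norm (P n x) \<le> norm x"
proof (cases "P n x = 0")
  case False
  have "(norm (P n x))\<^sup>2 = inner x (P n x)"
    by (simp add: power2_norm_eq_inner P_sym P_P)
  also have "\<dots> \<le> norm x * norm (P n x)" by (rule norm_cauchy_schwarz)
  finally show ?thesis using False by (simp add: power2_eq_square)
qed auto

lemma inner_W_le: "inner (W x) x \<le> M * (norm x)\<^sup>2"
proof -
  have "inner (W x) x \<le> norm (W x) * norm x" by (rule norm_cauchy_schwarz)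
  also have "\<dots> \<le> (M * norm x) * norm x" by (intro mult_right_mono W_le) auto
  finally show ?thesis by (simp add: power2_eq_square mult.assoc)
qed

subsection \<open>The kinetic energy\<close>

abbreviation kin :: "nat \<Rightarrow> 'h \<Rightarrow> real" where "kin n x \<equiv> inner (A n x) x"

text \<open>
  The kinetic energy is additive over frequency bands, because \<open>A n\<close> commutes with the projections.
\<close>

lemma kin_high:
  assumes "k \<le> n"
  shows "kin n (x - P k x) = kin n x - kin k x"
proof -
  have "inner (A k x) (P k x) = kin k x"
    using P_sym[of k "A k x" x] by (simp add: P_A)
  moreover have "inner (A n x) (P k x) = kin k x"
    using assms P_sym[of k "A n x" x] by (simp add: P_A min_absorb1)
  ultimately show ?thesis
    using assms by (simp add: A.diff A_P min_absorb2 inner_diff_left inner_diff_right inner_commute)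
qed

lemma kin_mono: "k \<le> n \<Longrightarrow> kin k x \<le> kin n x"
  using kin_high[of k n x] A_nonneg[of n "x - P k x"] by simp

lemma kin_diff_le: "kin n (x - y) \<le> 2 * kin n x + 2 * kin n y"
proof -
  have "kin n (x - y) + kin n (x + y) = 2 * kin n x + 2 * kin n y"
    by (simp add: A.diff A.add inner_diff_left inner_diff_right inner_add_left inner_add_right)
  then show ?thesis using A_nonneg[of n "x + y"] by linarith
qed

subsection \<open>The Galerkin approximations\<close>

text \<open>
  The truncated Hamiltonian. Both summands are symmetric and commute with \<open>J\<close>, so \<open>J (H n x)\<close> is skew.
\<close>

definition H :: "nat \<Rightarrow> 'h \<Rightarrow> 'h" where "H n x = A n x + P n (W (P n x))"

definition flow :: "nat \<Rightarrow> real \<Rightarrow> 'h \<Rightarrow> 'h" where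
  "flow n t x = exp_orbit (\<lambda>x. J (H n x)) t (P n x)"

lemma JH_linear: "bounded_linear (\<lambda>x. J (H n x))"
  unfolding H_def
  by (intro bounded_linear_compose[OF J_linear] bounded_linear_add A_linear
      bounded_linear_compose[OF P_linear] bounded_linear_compose[OF W_linear] P_linear)

lemma H_sym: "inner (H n x) y = inner x (H n y)"
  unfolding H_def by (simp add: inner_add_left inner_add_right A_sym P_sym W_sym)

lemma H_J: "H n (J x) = J (H n x)"
  by (simp add: H_def A_J P_J W_J J.add)

lemma JH_skew: "inner (J (H n x)) x = 0"
  by (rule J_skew_sym[OF H_sym H_J])

lemma flow_deriv: "((\<lambda>t. flow n t x) has_vector_derivative J (H n (flow n t x))) (at t)"
  unfolding flow_def by (rule exp_orbit_has_vector_derivative[OF JH_linear])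

lemma flow_0 [simp]: "flow n 0 x = P n x"
  by (simp add: flow_def)

lemma flow_norm: "norm (flow n t x) = norm (P n x)"
  using skew_orbit_norm[of "\<lambda>t. flow n t x" "\<lambda>x. J (H n x)", OF flow_deriv JH_skew, of t 0] by simp

lemma flow_norm_le: "norm (flow n t x) \<le> norm x"
  by (simp add: flow_norm norm_P_le)

lemma P_flow: "P n (flow n t x) = flow n t x"
proof -
  have PH: "P n (J (H n y)) = J (H n (P n y))" for y
    by (simp add: P_J H_def P.add P_A A_P P_P)
  have "norm (P n (flow n t x) - flow n t x) = norm (P n (flow n 0 x) - flow n 0 x)"
  proof (rule skew_orbit_unique[OF JH_linear _ flow_deriv JH_skew])
    fix t
    show "((\<lambda>t. P n (flow n t x)) has_vector_derivative J (H n (P n (flow n t x)))) (at t)"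
      unfolding PH[symmetric] by (rule P.has_vector_derivative[OF flow_deriv])
  qed
  then show ?thesis by (simp add: P_P)
qed

lemma continuous_flow: "continuous_on S (\<lambda>t. flow n t x)"
  by (intro continuous_at_imp_continuous_on ballI has_vector_derivative_continuous[OF flow_deriv])

text \<open>
  The cocycle property in a form that tolerates an error in the initial value: in the limit, the
  flow may be restarted at \<open>U r x\<close> although the approximation passes through \<open>flow n r x\<close>.
\<close>

lemma flow_flow: "norm (flow n t y - flow n (t + r) x) \<le> norm (y - flow n r x)"
proof -
  have "norm (flow n t y - flow n (t + r) x) = norm (flow n 0 y - flow n (0 + r) x)"
  proof (rule skew_orbit_unique[OF JH_linear flow_deriv _ JH_skew])
    fix t
    have "((\<lambda>t. flow n t x) \<circ> (\<lambda>t. t + r) has_vector_derivative (1 *\<^sub>R J (H n (flow n (t + r) x)))) (at t)"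
      by (rule vector_diff_chain_at) (auto intro!: derivative_eq_intros flow_deriv)
    then show "((\<lambda>t. flow n (t + r) x) has_vector_derivative J (H n (flow n (t + r) x))) (at t)"
      by (simp add: o_def)
  qed
  also have "\<dots> = norm (P n (y - flow n r x))" by (simp add: P.diff P_flow)
  also have "\<dots> \<le> norm (y - flow n r x)" by (rule norm_P_le)
  finally show ?thesis .
qed

text \<open>
  The quadratic form \<open>\<langle>H n u, u\<rangle>\<close> is constant along the flow, because \<open>J\<close> is skew. The flow stays in the
  range of \<open>P n\<close>, so that the cutoffs around \<open>W\<close> disappear on the left.
\<close>

lemma flow_energy:
  "kin n (flow n t x) + inner (W (flow n t x)) (flow n t x) = kin n x + inner (W (P n x)) (P n x)"
proof -
  let ?u = "\<lambda>t. flow n t x"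
  have H_linear: "bounded_linear (H n)"
    unfolding H_def by (intro bounded_linear_add A_linear
      bounded_linear_compose[OF P_linear] bounded_linear_compose[OF W_linear] P_linear)
  have "((\<lambda>t. inner (H n (?u t)) (?u t)) has_real_derivative 0) (at t)" for t
  proof -
    have "((\<lambda>t. inner (H n (?u t)) (?u t)) has_real_derivative
        inner (H n (?u t)) (J (H n (?u t))) + inner (H n (J (H n (?u t)))) (?u t)) (at t)"
      by (intro has_vector_derivative_inner flow_deriv bounded_linear.has_vector_derivative[OF H_linear])
    moreover have "inner (H n (?u t)) (J (H n (?u t))) = 0"
      using J_skew[of "H n (?u t)" "H n (?u t)"] by (simp add: inner_commute)
    moreover have "inner (H n (J (H n (?u t)))) (?u t) = inner (H n (?u t)) (J (H n (?u t)))"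
      by (simp add: H_sym inner_commute[of "J (H n (?u t))"])
    ultimately show ?thesis by simp
  qed
  then have "inner (H n (?u t)) (?u t) = inner (H n (?u 0)) (?u 0)"
    by (rule DERIV_isconst_all[rule_format])
  moreover have "inner (H n y) y = kin n y + inner (W (P n y)) (P n y)" for y
    by (simp add: H_def inner_add_left P_sym)
  moreover have "kin n (P n x) = kin n x"
    using P_sym[of n "A n x" x] by (simp add: A_P P_A)
  ultimately show ?thesis by (simp add: P_flow P_P)
qed

lemma flow_kin_le:
  assumes "\<And>n. kin n x \<le> q"
  shows "kin n (flow n t x) \<le> q + M * (norm x)\<^sup>2"
proof -
  have "kin n (flow n t x) \<le> kin n x + inner (W (P n x)) (P n x)"
    using flow_energy[of n t x] W_nonneg[of "flow n t x"] by linarith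
  also have "inner (W (P n x)) (P n x) \<le> M * (norm (P n x))\<^sup>2" by (rule inner_W_le)
  also have "\<dots> \<le> M * (norm x)\<^sup>2" by (intro mult_left_mono power_mono norm_P_le M_nonneg) auto
  finally show ?thesis using assms[of n] by linarith
qed

text \<open>
  The central estimate. For the difference \<open>w\<close> of two approximations, the terms of the equation
  containing \<open>w\<close> itself are skew and do not contribute to \<open>(\<parallel>w\<parallel>\<^sup>2)'\<close>. What remains is the potential
  acting on the lower approximation, tested against the part of the higher approximation in the
  frequency band between the two cutoffs; energy conservation and \<open>P_tail\<close> bound that part by
  \<open>sqrt (\<delta> k)\<close>. The right-hand side does not depend on \<open>n\<close>.
\<close>

lemma flow_cauchy:
  assumes q: "\<And>n. kin n x \<le> q" and kn: "k \<le> n"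
  shows "(norm (flow n t x - flow k t x))\<^sup>2
      \<le> \<delta> k * q + 2 * \<bar>t\<bar> * (M * norm x * sqrt (\<delta> k * (q + M * (norm x)\<^sup>2)))"
proof -
  let ?E = "M * norm x * sqrt (\<delta> k * (q + M * (norm x)\<^sup>2))"
  define u v where "u = (\<lambda>t. flow n t x)" and "v = (\<lambda>t. flow k t x)"
  define w where "w = (\<lambda>t. u t - v t)"
  have Pu: "P n (u t) = u t" and Pv: "P k (v t) = v t" for t by (simp_all add: u_def v_def P_flow)
  have Pnv: "P n (v t) = v t" for t using kn Pv[of t] P_P[of n k "v t"] by (simp add: min_absorb2)
  have Av: "A k (v t) = A n (v t)" for t using kn Pv[of t] A_P[of n k "v t"] by (simp add: min_absorb2)
  have der: "((\<lambda>t. inner (w t) (w t)) has_real_derivative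
      2 * inner (w t) (J (P n (W (v t)) - P k (W (v t))))) (at t)" for t
  proof -
    have wd: "(w has_vector_derivative J (H n (u t)) - J (H k (v t))) (at t)"
      unfolding w_def u_def v_def by (intro has_vector_derivative_diff flow_deriv)
\<comment> \<open>The lower approximation is moved into the higher equation; the mismatch of the two
  cutoffs of the potential is the only inhomogeneity.\<close>
    have eq: "J (H n (u t)) - J (H k (v t)) = J (H n (w t)) + J (P n (W (v t)) - P k (W (v t)))"
      by (simp add: H_def w_def Pu Pv Pnv Av A.diff J.diff J.add P.diff W.diff)
    show ?thesis
      using has_vector_derivative_inner[OF wd wd] JH_skew[of n "w t"] unfolding eq
      by (simp add: inner_commute inner_add_left inner_add_right)
  qed
  have bound: "\<bar>2 * inner (w t) (J (P n (W (v t)) - P k (W (v t))))\<bar> \<le> 2 * ?E" for t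
  proof -
    have "inner (w t) (J (P n (W (v t)) - P k (W (v t)))) = inner (P n (w t) - P k (w t)) (J (W (v t)))"
      by (simp add: J.diff inner_diff_right inner_diff_left P_sym flip: P_J)
\<comment> \<open>The lower approximation has no frequencies beyond the cutoff \<open>k\<close>.\<close>
    also have "P n (w t) - P k (w t) = P n (u t) - P k (u t)"
      using kn by (simp add: w_def P.diff Pnv Pv)
    finally have "\<bar>inner (w t) (J (P n (W (v t)) - P k (W (v t))))\<bar>
        \<le> norm (P n (u t) - P k (u t)) * norm (J (W (v t)))"
      by (simp add: Cauchy_Schwarz_ineq2)
    also have "\<dots> \<le> sqrt (\<delta> k * (q + M * (norm x)\<^sup>2)) * (M * norm x)"
    proof (intro mult_mono)
      have "norm (P n (u t) - P k (u t)) \<le> sqrt (\<delta> k * kin n (u t))"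
        using P_tail[OF kn, of "u t"] by (rule real_le_rsqrt)
      also have "\<dots> \<le> sqrt (\<delta> k * (q + M * (norm x)\<^sup>2))"
        using flow_kin_le[OF q] by (intro real_sqrt_le_mono mult_left_mono \<delta>_nonneg) (simp add: u_def)
      finally show "norm (P n (u t) - P k (u t)) \<le> sqrt (\<delta> k * (q + M * (norm x)\<^sup>2))" .
      have "norm (J (W (v t))) \<le> M * norm (v t)" by (simp add: norm_J W_le)
      also have "\<dots> \<le> M * norm x" by (intro mult_left_mono M_nonneg) (simp add: v_def flow_norm_le)
      finally show "norm (J (W (v t))) \<le> M * norm x" .
      have "0 \<le> kin n (u t)" by (rule A_nonneg)
      also have "\<dots> \<le> q + M * (norm x)\<^sup>2" using flow_kin_le[OF q] by (simp add: u_def)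
      finally show "0 \<le> sqrt (\<delta> k * (q + M * (norm x)\<^sup>2))" using \<delta>_nonneg by simp
    qed auto
    finally show ?thesis by (simp add: mult_ac)
  qed
  have "\<bar>inner (w t) (w t) - inner (w 0) (w 0)\<bar> \<le> 2 * ?E * \<bar>t - 0\<bar>"
    using field_differentiable_bound[of UNIV "\<lambda>t. inner (w t) (w t)"
        "\<lambda>t. 2 * inner (w t) (J (P n (W (v t)) - P k (W (v t))))" "2 * ?E" t 0] der bound
    by (simp del: abs_mult)
  moreover have "inner (w 0) (w 0) \<le> \<delta> k * q"
  proof -
    have "inner (w 0) (w 0) = (norm (P n x - P k x))\<^sup>2"
      by (simp add: w_def u_def v_def power2_norm_eq_inner)
    also have "\<dots> \<le> \<delta> k * kin n x" by (rule P_tail[OF kn])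
    also have "\<dots> \<le> \<delta> k * q" by (intro mult_left_mono q \<delta>_nonneg)
    finally show ?thesis .
  qed
  moreover have "(norm (flow n t x - flow k t x))\<^sup>2 = inner (w t) (w t)"
    by (simp add: w_def u_def v_def power2_norm_eq_inner)
  ultimately show ?thesis by (simp add: mult_ac)
qed

end

context galerkin
begin

subsection \<open>The limit flow\<close>

definition U :: "real \<Rightarrow> 'h \<Rightarrow> 'h" where "U t x = lim (\<lambda>n. flow n t x)"

definition finite_kin :: "'h \<Rightarrow> bool" where "finite_kin x \<longleftrightarrow> bdd_above (range (\<lambda>n. kin n x))"

definition kinetic :: "'h \<Rightarrow> real" where "kinetic x = (SUP n. kin n x)"

text \<open>
  The bound of \<open>flow_cauchy\<close> with the kinetic energy of the initial value inserted.
\<close>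

definition gap :: "nat \<Rightarrow> real \<Rightarrow> 'h \<Rightarrow> real" where
  "gap k t x = \<delta> k * kinetic x
     + 2 * \<bar>t\<bar> * (M * norm x * sqrt (\<delta> k * (kinetic x + M * (norm x)\<^sup>2)))"

lemma kin_le_kinetic: "finite_kin x \<Longrightarrow> kin n x \<le> kinetic x"
  unfolding finite_kin_def kinetic_def by (rule cSUP_upper) auto

lemma finite_kinI: "(\<And>n. kin n x \<le> q) \<Longrightarrow> finite_kin x"
  unfolding finite_kin_def by (rule bdd_aboveI2)

lemma kinetic_le: "(\<And>n. kin n x \<le> q) \<Longrightarrow> kinetic x \<le> q"
  unfolding kinetic_def by (rule cSUP_least) auto

lemma kinetic_nonneg: "finite_kin x \<Longrightarrow> 0 \<le> kinetic x"
  using A_nonneg kin_le_kinetic order_trans by blast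

lemma kin_tendsto: "finite_kin x \<Longrightarrow> (\<lambda>n. kin n x) \<longlonglongrightarrow> kinetic x"
  unfolding finite_kin_def kinetic_def by (rule LIMSEQ_incseq_SUP) (auto simp: incseq_def intro: kin_mono)

lemma gap_tendsto: "(\<lambda>k. gap k t x) \<longlonglongrightarrow> 0"
proof -
  have "(\<lambda>k. gap k t x) \<longlonglongrightarrow> 0 * kinetic x
     + 2 * \<bar>t\<bar> * (M * norm x * sqrt (0 * (kinetic x + M * (norm x)\<^sup>2)))"
    unfolding gap_def by (intro tendsto_intros \<delta>_tendsto)
  then show ?thesis by simp
qed

lemma gap_mono: "finite_kin x \<Longrightarrow> \<bar>t\<bar> \<le> \<bar>R\<bar> \<Longrightarrow> gap k t x \<le> gap k R x"
  unfolding gap_def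
  by (intro add_left_mono mult_left_mono mult_right_mono add_nonneg_nonneg mult_nonneg_nonneg
        \<delta>_nonneg kinetic_nonneg M_nonneg real_sqrt_ge_zero) auto

lemma flow_gap:
  assumes "finite_kin x" "k \<le> n"
  shows "norm (flow n t x - flow k t x) \<le> sqrt (gap k t x)"
  using flow_cauchy[OF kin_le_kinetic[OF assms(1)] assms(2), of t]
  unfolding gap_def by (rule real_le_rsqrt)

lemma flow_tendsto:
  assumes "finite_kin x"
  shows "(\<lambda>n. flow n t x) \<longlonglongrightarrow> U t x"
proof -
  have "Cauchy (\<lambda>n. flow n t x)"
  proof (rule metric_CauchyI)
    fix e :: real assume "e > 0"
    then have "\<forall>\<^sub>F k in sequentially. sqrt (gap k t x) < e / 2"
      using order_tendstoD(2)[OF tendsto_real_sqrt[OF gap_tendsto[of t x]], of "e / 2"] by simp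
    then obtain k where k: "sqrt (gap k t x) < e / 2" by (auto simp: eventually_sequentially)
    have "dist (flow m t x) (flow n t x) < e" if "m \<ge> k" "n \<ge> k" for m n
      using flow_gap[OF assms that(1), of t] flow_gap[OF assms that(2), of t] k
        dist_triangle2[of "flow m t x" "flow n t x" "flow k t x"] by (simp add: dist_norm)
    then show "\<exists>k. \<forall>m\<ge>k. \<forall>n\<ge>k. dist (flow m t x) (flow n t x) < e" by blast
  qed
  then show ?thesis unfolding U_def by (simp add: Cauchy_convergent_iff convergent_LIMSEQ_iff)
qed

lemma U_gap:
  assumes "finite_kin x"
  shows "norm (U t x - flow k t x) \<le> sqrt (gap k t x)"
proof (rule tendsto_upperbound)
  show "(\<lambda>n. norm (flow n t x - flow k t x)) \<longlonglongrightarrow> norm (U t x - flow k t x)"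
    by (intro tendsto_intros flow_tendsto assms)
  show "\<forall>\<^sub>F n in sequentially. norm (flow n t x - flow k t x) \<le> sqrt (gap k t x)"
    using eventually_ge_at_top[of k] by eventually_elim (rule flow_gap[OF assms])
qed auto

lemma U_0: "finite_kin x \<Longrightarrow> U 0 x = x"
  using flow_tendsto[of x 0] P_tendsto[of x] by (auto intro: LIMSEQ_unique)

lemma norm_U_le: "finite_kin x \<Longrightarrow> norm (U t x) \<le> norm x"
  by (rule tendsto_upperbound[OF tendsto_norm[OF flow_tendsto]]) (auto simp: flow_norm_le)

lemma U_continuous:
  assumes "finite_kin x"
  shows "continuous_on UNIV (\<lambda>t. U t x)"
proof -
  have "continuous_on (ball 0 R) (\<lambda>t. U t x)" for R :: real
  proof (rule uniform_limit_theorem)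
    show "\<forall>\<^sub>F n in sequentially. continuous_on (ball 0 R) (\<lambda>t. flow n t x)"
      by (simp add: continuous_flow)
    show "uniform_limit (ball 0 R) (\<lambda>n t. flow n t x) (\<lambda>t. U t x) sequentially"
    proof (rule uniform_limitI)
      fix e :: real assume "e > 0"
      then have "\<forall>\<^sub>F k in sequentially. sqrt (gap k R x) < e"
        using order_tendstoD(2)[OF tendsto_real_sqrt[OF gap_tendsto[of R x]], of e] by simp
      then show "\<forall>\<^sub>F k in sequentially. \<forall>t\<in>ball 0 R. dist (flow k t x) (U t x) < e"
      proof eventually_elim
        case (elim k)
        show ?case
        proof
          fix t :: real assume "t \<in> ball 0 R"
          then have "sqrt (gap k t x) \<le> sqrt (gap k R x)"
            by (intro real_sqrt_le_mono gap_mono assms) auto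
          from order_trans[OF U_gap[OF assms, of t k] this] elim have "norm (U t x - flow k t x) < e" by linarith
          then show "dist (flow k t x) (U t x) < e" by (simp add: dist_norm norm_minus_commute)
        qed
      qed
    qed
  qed auto
  then have "isCont (\<lambda>t. U t x) t" for t :: real
    by (rule continuous_on_interior[of "ball 0 (\<bar>t\<bar> + 1)"]) auto
  then show ?thesis by (simp add: continuous_at_imp_continuous_on)
qed

subsection \<open>Conservation of energy and continuity in the energy space\<close>

text \<open>
  Only the kinetic energy of the frequencies below \<open>k\<close> is continuous in the \<open>L\<^sup>2\<close> limit, so the limit yields
  an inequality.
\<close>

lemma U_energy_le:
  assumes "finite_kin x"
  shows "kin k (U t x) + inner (W (U t x)) (U t x) \<le> kinetic x + inner (W x) x"
proof (rule tendsto_le[OF trivial_limit_sequentially])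
  show "(\<lambda>n. kin k (flow n t x) + inner (W (flow n t x)) (flow n t x))
          \<longlonglongrightarrow> kin k (U t x) + inner (W (U t x)) (U t x)"
    by (intro tendsto_intros flow_tendsto assms A.tendsto W.tendsto)
  show "(\<lambda>n. kin n x + inner (W (P n x)) (P n x)) \<longlonglongrightarrow> kinetic x + inner (W x) x"
    by (intro tendsto_intros kin_tendsto assms W.tendsto P_tendsto)
  show "\<forall>\<^sub>F n in sequentially. kin k (flow n t x) + inner (W (flow n t x)) (flow n t x)
          \<le> kin n x + inner (W (P n x)) (P n x)"
    using eventually_ge_at_top[of k]
  proof eventually_elim
    case (elim n)
    then show ?case using flow_energy[of n t x] kin_mono[of k n "flow n t x"] by linarith
  qed
qed

lemma finite_kin_U:
  assumes "finite_kin x"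
  shows "finite_kin (U t x)"
proof (rule finite_kinI)
  show "kin n (U t x) \<le> kinetic x + inner (W x) x" for n
    using U_energy_le[OF assms, of n t] W_nonneg[of "U t x"] by linarith
qed

lemma kinetic_U_le: "finite_kin x \<Longrightarrow> kinetic (U t x) + inner (W (U t x)) (U t x) \<le> kinetic x + inner (W x) x"
  using kinetic_le[of "U t x" "kinetic x + inner (W x) x - inner (W (U t x)) (U t x)"]
    U_energy_le[of x _ t] by (simp add: le_diff_eq)

lemma U_U:
  assumes "finite_kin x"
  shows "U t (U r x) = U (t + r) x"
proof -
  have "(\<lambda>n. flow n t (U r x) - flow n (t + r) x) \<longlonglongrightarrow> 0"
  proof (rule Lim_null_comparison)
    show "\<forall>\<^sub>F n in sequentially. norm (flow n t (U r x) - flow n (t + r) x) \<le> norm (U r x - flow n r x)"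
      by (simp add: flow_flow)
    have "(\<lambda>n. norm (U r x - flow n r x)) \<longlonglongrightarrow> norm (U r x - U r x)"
      by (intro tendsto_intros flow_tendsto assms)
    then show "(\<lambda>n. norm (U r x - flow n r x)) \<longlonglongrightarrow> 0" by simp
  qed
  moreover have "(\<lambda>n. flow n t (U r x) - flow n (t + r) x) \<longlonglongrightarrow> U t (U r x) - U (t + r) x"
    by (intro tendsto_intros flow_tendsto assms finite_kin_U)
  ultimately show ?thesis using LIMSEQ_unique by force
qed

text \<open>
  Running the flow backwards by the group property exchanges the two sides of the inequality.
\<close>

lemma energy_conservation:
  assumes "finite_kin x"
  shows "kinetic (U t x) + inner (W (U t x)) (U t x) = kinetic x + inner (W x) x"
  using kinetic_U_le[OF assms, of t] kinetic_U_le[OF finite_kin_U[OF assms, of t], of "- t"]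
  by (simp add: U_U U_0 assms)

lemma kinetic_bound: "finite_kin x \<Longrightarrow> kinetic (U t x) \<le> kinetic x + M * (norm x)\<^sup>2"
  using energy_conservation[of x t] W_nonneg[of "U t x"] inner_W_le[of x] by linarith

text \<open>
  Continuity in the energy space. Energy conservation makes the total kinetic energy continuous in
  time, hence also the energy above a fixed frequency, which is small at time \<open>t\<close> and therefore small
  at nearby times. Below that frequency the kinetic energy is a continuous form on the whole space.
\<close>

lemma U_continuous_kin:
  assumes x: "finite_kin x" and "e > 0"
  shows "\<forall>\<^sub>F \<tau> in at t. \<forall>n. kin n (U \<tau> x - U t x) \<le> e"
proof -
\<comment> \<open>One fifth for the low frequencies and, by the parallelogram law, twice one fifth for the
  high frequencies of each of the two states.\<close>
  define e' where "e' = e / 5"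
  have e': "e' > 0" "5 * e' = e" using \<open>e > 0\<close> by (auto simp: e'_def)
  have Ut: "((\<lambda>\<tau>. U \<tau> x) \<longlongrightarrow> U t x) (at t)" for t
    using U_continuous[OF x] by (simp add: continuous_on_def)
  have "\<forall>\<^sub>F k in sequentially. kin k (U t x) > kinetic (U t x) - e'"
    using e' by (intro order_tendstoD(1)[OF kin_tendsto[OF finite_kin_U[OF x]]]) auto
  then obtain k where k: "kinetic (U t x) - kin k (U t x) < e'"
    by (auto simp: eventually_sequentially algebra_simps)
  have kinetic_eq: "kinetic (U \<tau> x) = kinetic x + inner (W x) x - inner (W (U \<tau> x)) (U \<tau> x)" for \<tau>
    using energy_conservation[OF x, of \<tau>] by linarith
  have "((\<lambda>\<tau>. kinetic (U \<tau> x) - kin k (U \<tau> x)) \<longlongrightarrow> kinetic (U t x) - kin k (U t x)) (at t)"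
    unfolding kinetic_eq by (intro tendsto_intros Ut W.tendsto A.tendsto)
  from order_tendstoD(2)[OF this k]
  have ev1: "\<forall>\<^sub>F \<tau> in at t. kinetic (U \<tau> x) - kin k (U \<tau> x) < e'" .
  have "((\<lambda>\<tau>. kin k (U \<tau> x - U t x)) \<longlongrightarrow> kin k (U t x - U t x)) (at t)"
    by (intro tendsto_intros Ut A.tendsto)
  then have ev2: "\<forall>\<^sub>F \<tau> in at t. kin k (U \<tau> x - U t x) < e'"
    using e' by (intro order_tendstoD(2)[of _ 0]) (auto simp: A.zero)
  show ?thesis using ev1 ev2
  proof eventually_elim
    case (elim \<tau>)
    let ?y = "U \<tau> x - U t x"
    have high: "kin n z - kin k z \<le> kinetic z - kin k z" if "finite_kin z" for n z
      using kin_le_kinetic[OF that, of n] by simp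
    have "kin n ?y \<le> e" if "n \<ge> k" for n
    proof -
      have "kin n ?y = kin k ?y + kin n (?y - P k ?y)" using kin_high[OF that, of ?y] by simp
      moreover have "?y - P k ?y = (U \<tau> x - P k (U \<tau> x)) - (U t x - P k (U t x))" by (simp add: P.diff)
      moreover have "kin n ((U \<tau> x - P k (U \<tau> x)) - (U t x - P k (U t x)))
          \<le> 2 * (kin n (U \<tau> x) - kin k (U \<tau> x)) + 2 * (kin n (U t x) - kin k (U t x))"
        using kin_diff_le[of n "U \<tau> x - P k (U \<tau> x)" "U t x - P k (U t x)"]
        by (simp only: kin_high[OF that])
      ultimately have "kin n ?y \<le> kin k ?y + (2 * (kin n (U \<tau> x) - kin k (U \<tau> x)) + 2 * (kin n (U t x) - kin k (U t x)))"
        by (simp only: add_left_mono)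
      moreover have "kin n (U \<tau> x) - kin k (U \<tau> x) \<le> e'"
        using high[OF finite_kin_U[OF x], of n \<tau>] elim(1) by linarith
      moreover have "kin n (U t x) - kin k (U t x) \<le> e'"
        using high[OF finite_kin_U[OF x], of n t] k by linarith
      moreover have "a \<le> e" if "a \<le> b + (2 * c + 2 * d)" "c \<le> e'" "d \<le> e'" "b < e'" for a b c d :: real
        using that e'(2) by linarith
      ultimately show ?thesis using elim(2) by blast
    qed
    note ge = this
    have "kin n ?y \<le> e" for n
      using kin_mono[of n k ?y] ge[of n] ge[of k] by linarith
    then show ?case by blast
  qed
qed

subsection \<open>The weak formulation\<close>

text \<open>
  The assumption \<open>A n (\<Phi> t) = P n (\<Psi> t)\<close> expresses that \<open>\<Phi> t\<close> is in the domain of \<open>A\<close> with image \<open>\<Psi> t\<close>.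
  It moves \<open>A n\<close> from the approximation to the test function, after which every term converges
  pointwise in time and boundedly. Since \<open>\<Psi>\<close> is only assumed to be bounded, integrability of the term
  containing it is obtained from the approximations, where it equals a continuous function.
\<close>

lemma U_weak:
  assumes x: "finite_kin x" and T: "T > 0"
    and \<Phi>: "\<And>t. (\<Phi> has_vector_derivative \<Phi>' t) (at t)" "continuous_on UNIV \<Phi>'"
    and \<Phi>0: "\<Phi> 0 = 0" "\<Phi> T = 0"
    and \<Psi>: "\<And>n t. A n (\<Phi> t) = P n (\<Psi> t)" "\<And>t. norm (\<Psi> t) \<le> C"
  shows "set_integrable lborel {0..T} (\<lambda>t. inner (U t x) (J (\<Psi> t)))"
    and "set_integrable lborel {0..T} (\<lambda>t. inner (U t x) (\<Phi>' t))"
    and "set_integrable lborel {0..T} (\<lambda>t. inner (W (U t x)) (J (\<Phi> t)))"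
    and "(LINT t:{0..T}|lborel. inner (U t x) (J (\<Psi> t)))
       = (LINT t:{0..T}|lborel. inner (U t x) (\<Phi>' t)) - (LINT t:{0..T}|lborel. inner (W (U t x)) (J (\<Phi> t)))"
proof -
  have \<Phi>c: "continuous_on S \<Phi>" for S
    by (intro continuous_at_imp_continuous_on ballI has_vector_derivative_continuous[OF \<Phi>(1)])
  have \<Phi>'c: "continuous_on S \<Phi>'" for S using \<Phi>(2) continuous_on_subset by blast
  have Uc: "continuous_on S (\<lambda>t. U t x)" for S using U_continuous[OF x] continuous_on_subset by blast
  define f g h where "f = (\<lambda>n t. inner (A n (flow n t x)) (J (\<Phi> t)))"
    and "g = (\<lambda>n t. inner (W (flow n t x)) (P n (J (\<Phi> t))))"
    and "h = (\<lambda>n t. inner (flow n t x) (\<Phi>' t))"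
  have f_eq: "f n t = inner (flow n t x) (J (\<Psi> t))" for n t
  proof -
    have "f n t = inner (flow n t x) (P n (J (\<Psi> t)))" by (simp add: f_def A_sym A_J \<Psi> P_J)
    also have "\<dots> = inner (P n (flow n t x)) (J (\<Psi> t))" by (simp only: P_sym)
    finally show ?thesis by (simp only: P_flow)
  qed
  have der: "((\<lambda>t. inner (flow n t x) (\<Phi> t)) has_real_derivative h n t - f n t - g n t) (at t)" for n t
  proof -
    have "inner (J (H n (flow n t x))) (\<Phi> t) = - f n t - g n t"
      by (simp add: J_skew H_def P_flow inner_add_left f_def g_def P_sym[of n "W _"])
    then have "h n t - f n t - g n t = inner (flow n t x) (\<Phi>' t) + inner (J (H n (flow n t x))) (\<Phi> t)"
      by (simp add: h_def)
    then show ?thesis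
      using has_vector_derivative_inner[OF flow_deriv[of n x t] \<Phi>(1)[of t]] by (simp only:)
  qed
  have fc: "continuous_on {0..T} (f n)" and gc: "continuous_on {0..T} (g n)" and hc: "continuous_on {0..T} (h n)" for n
    unfolding f_def g_def h_def
    by (intro continuous_intros A.continuous_on P.continuous_on J.continuous_on W.continuous_on continuous_flow \<Phi>c \<Phi>'c)+
  have ints: "set_integrable lborel {0..T} (f n)" "set_integrable lborel {0..T} (g n)" "set_integrable lborel {0..T} (h n)" for n
    by (intro borel_integrable_atLeastAtMost' fc gc hc)+
  have FTC: "(LINT t:{0..T}|lborel. f n t) = (LINT t:{0..T}|lborel. h n t) - (LINT t:{0..T}|lborel. g n t)" for n
  proof -
    have "(LINT t:{0..T}|lborel. h n t - f n t - g n t) = inner (flow n T x) (\<Phi> T) - inner (flow n 0 x) (\<Phi> 0)"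
      unfolding set_lebesgue_integral_def
      using T by (intro integral_FTC_atLeastAtMost)
        (auto intro!: continuous_intros fc gc hc has_vector_derivative_at_within
          der[unfolded has_real_derivative_iff_has_vector_derivative])
    also have "\<dots> = 0" by (simp add: \<Phi>0)
    finally show ?thesis by (simp add: set_integral_diff ints)
  qed
  obtain B where B: "\<And>t. t \<in> {0..T} \<Longrightarrow> norm (\<Phi> t) \<le> B" "\<And>t. t \<in> {0..T} \<Longrightarrow> norm (\<Phi>' t) \<le> B"
  proof -
    have "bounded (\<Phi> ` {0..T} \<union> \<Phi>' ` {0..T})"
      by (intro bounded_Un[THEN iffD2] conjI compact_imp_bounded compact_continuous_image \<Phi>c \<Phi>'c) auto
    then obtain B where "\<forall>y\<in>\<Phi> ` {0..T} \<union> \<Phi>' ` {0..T}. norm y \<le> B" unfolding bounded_iff by blast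
    then show ?thesis using that[of B] by blast
  qed
  have lims: "(\<lambda>n. f n t) \<longlonglongrightarrow> inner (U t x) (J (\<Psi> t))" "(\<lambda>n. h n t) \<longlonglongrightarrow> inner (U t x) (\<Phi>' t)"
    "(\<lambda>n. g n t) \<longlonglongrightarrow> inner (W (U t x)) (J (\<Phi> t))" for t
    unfolding f_eq g_def h_def by (intro tendsto_intros flow_tendsto x W.tendsto P_tendsto)+
  have bf: "\<bar>f n t\<bar> \<le> norm x * C" for n t
  proof -
    have "\<bar>f n t\<bar> \<le> norm (flow n t x) * norm (J (\<Psi> t))" unfolding f_eq by (rule Cauchy_Schwarz_ineq2)
    also have "\<dots> \<le> norm x * C" by (intro mult_mono flow_norm_le) (auto simp: norm_J \<Psi>)
    finally show ?thesis .
  qed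
  have bh: "\<bar>h n t\<bar> \<le> norm x * B" if "t \<in> {0..T}" for n t
  proof -
    have "\<bar>h n t\<bar> \<le> norm (flow n t x) * norm (\<Phi>' t)" unfolding h_def by (rule Cauchy_Schwarz_ineq2)
    also have "\<dots> \<le> norm x * B" by (intro mult_mono flow_norm_le B that) auto
    finally show ?thesis .
  qed
  have bg: "\<bar>g n t\<bar> \<le> M * norm x * B" if "t \<in> {0..T}" for n t
  proof -
    have "\<bar>g n t\<bar> \<le> norm (W (flow n t x)) * norm (P n (J (\<Phi> t)))" unfolding g_def by (rule Cauchy_Schwarz_ineq2)
    also have "\<dots> \<le> (M * norm x) * B"
    proof (intro mult_mono)
      show "norm (W (flow n t x)) \<le> M * norm x"
        using W_le[of "flow n t x"] mult_left_mono[OF flow_norm_le M_nonneg, of n t x] by linarith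
      show "norm (P n (J (\<Phi> t))) \<le> B" using norm_P_le[of n "J (\<Phi> t)"] B(1)[OF that] by (simp add: norm_J)
    qed (auto simp: M_nonneg)
    finally show ?thesis .
  qed
  have conv: "set_integrable lborel {0..T} F \<and>
      (\<lambda>n. LINT t:{0..T}|lborel. s n t) \<longlonglongrightarrow> (LINT t:{0..T}|lborel. F t)"
    if s: "\<And>n. set_integrable lborel {0..T} (s n)" "\<And>t. (\<lambda>n. s n t) \<longlonglongrightarrow> F t"
      "\<And>n t. t \<in> {0..T} \<Longrightarrow> \<bar>s n t\<bar> \<le> K" for s F and K :: real
  proof -
    define r where "r = (\<lambda>n t. indicat_real {0..T} t *\<^sub>R s n t)"
    have meas: "r n \<in> borel_measurable lborel" for n
      using s(1)[of n] unfolding set_integrable_def r_def by (rule borel_measurable_integrable)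
    have lim: "(\<lambda>n. r n t) \<longlonglongrightarrow> indicat_real {0..T} t *\<^sub>R F t" for t
      unfolding r_def by (intro tendsto_intros s)
    have dom: "integrable lborel (\<lambda>t. indicat_real {0..T} t * K)"
      using T by (intro integrable_mult_left integrable_real_indicator) auto
    have bd: "norm (r n t) \<le> indicat_real {0..T} t * K" for n t
      using s(3) by (auto simp: indicator_def r_def)
    have measF: "(\<lambda>t. indicat_real {0..T} t *\<^sub>R F t) \<in> borel_measurable lborel"
      by (rule borel_measurable_LIMSEQ_metric[OF meas lim])
    show ?thesis unfolding set_integrable_def set_lebesgue_integral_def
      using integrable_dominated_convergence[OF measF meas dom AE_I2[OF lim] AE_I2[OF bd]]
        integral_dominated_convergence[OF measF meas dom AE_I2[OF lim] AE_I2[OF bd]]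
      by (simp add: r_def)
  qed
  note cf = conv[OF ints(1) lims(1) bf] and cg = conv[OF ints(2) lims(3) bg] and ch = conv[OF ints(3) lims(2) bh]
  show "set_integrable lborel {0..T} (\<lambda>t. inner (U t x) (J (\<Psi> t)))"
    "set_integrable lborel {0..T} (\<lambda>t. inner (U t x) (\<Phi>' t))"
    "set_integrable lborel {0..T} (\<lambda>t. inner (W (U t x)) (J (\<Phi> t)))"
    using cf cg ch by auto
  have "(\<lambda>n. LINT t:{0..T}|lborel. f n t) \<longlonglongrightarrow>
      (LINT t:{0..T}|lborel. inner (U t x) (\<Phi>' t)) - (LINT t:{0..T}|lborel. inner (W (U t x)) (J (\<Phi> t)))"
    unfolding FTC by (intro tendsto_diff) (use cg ch in auto)
  with cf show "(LINT t:{0..T}|lborel. inner (U t x) (J (\<Psi> t)))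
       = (LINT t:{0..T}|lborel. inner (U t x) (\<Phi>' t)) - (LINT t:{0..T}|lborel. inner (W (U t x)) (J (\<Phi> t)))"
    by (auto intro: LIMSEQ_unique)
qed

end

section \<open>The Hilbert space of square integrable functions\<close>

lemma L2_measurable [measurable_dest]: "L2 f \<Longrightarrow> f \<in> borel_measurable lebesgue"
  and L2_integrable: "L2 f \<Longrightarrow> integrable lebesgue (\<lambda>x. (norm (f x))\<^sup>2)"
  by (simp_all add: L2_def)

lemma L2_bound:
  assumes [measurable]: "f \<in> borel_measurable lebesgue" and "integrable lebesgue g"
    and "AE x in lebesgue. (norm (f x))\<^sup>2 \<le> g x"
  shows "L2 f"
  unfolding L2_def
proof
  show "integrable lebesgue (\<lambda>x. (norm (f x))\<^sup>2)"
    by (rule Bochner_Integration.integrable_bound[OF assms(2)]) (use assms in auto)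
qed fact

lemma L2_0 [simp]: "L2 (\<lambda>x. 0)"
  by (simp add: L2_def)

lemma norm_add_power2_le: "(norm (x + y))\<^sup>2 \<le> 2 * (norm x)\<^sup>2 + 2 * (norm (y::'b::real_normed_vector))\<^sup>2"
proof -
  have "(norm (x + y))\<^sup>2 \<le> (norm x + norm y)\<^sup>2" by (intro power_mono norm_triangle_ineq) auto
  also have "\<dots> \<le> 2 * (norm x)\<^sup>2 + 2 * (norm y)\<^sup>2"
    using zero_le_power2[of "norm x - norm y"] by (simp add: power2_sum power2_diff)
  finally show ?thesis .
qed

lemma L2_add [simp]: assumes "L2 f" "L2 g" shows "L2 (\<lambda>x. f x + g x)"
proof (rule L2_bound)
  show "(\<lambda>x. f x + g x) \<in> borel_measurable lebesgue"
    using assms by (intro borel_measurable_add L2_measurable)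
  show "integrable lebesgue (\<lambda>x. 2 * (norm (f x))\<^sup>2 + 2 * (norm (g x))\<^sup>2)"
    by (intro Bochner_Integration.integrable_add integrable_mult_right L2_integrable assms)
qed (simp add: norm_add_power2_le)

lemma L2_bounded_mult:
  assumes "L2 f" "m \<in> borel_measurable lebesgue" "AE x in lebesgue. norm (m x) \<le> B"
  shows "L2 (\<lambda>x. m x * f x)"
proof (rule L2_bound)
  show "(\<lambda>x. m x * f x) \<in> borel_measurable lebesgue"
    by (intro borel_measurable_times assms(2) L2_measurable[OF assms(1)])
  show "integrable lebesgue (\<lambda>x. B\<^sup>2 * (norm (f x))\<^sup>2)"
    by (intro integrable_mult_right L2_integrable assms)
  show "AE x in lebesgue. (norm (m x * f x))\<^sup>2 \<le> B\<^sup>2 * (norm (f x))\<^sup>2"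
    using assms(3) by eventually_elim (auto simp: norm_mult power_mult_distrib intro!: mult_right_mono power_mono)
qed

lemma L2_cmult [simp]: "L2 f \<Longrightarrow> L2 (\<lambda>x. c * f x)"
  by (rule L2_bounded_mult[where B="norm c"]) auto

lemma L2_scaleR [simp]: "L2 f \<Longrightarrow> L2 (\<lambda>x. c *\<^sub>R f x)"
  using L2_cmult[of f "of_real c"] by (simp add: scaleR_conv_of_real)

lemma L2_minus [simp]: "L2 f \<Longrightarrow> L2 (\<lambda>x. - f x)"
  using L2_cmult[of f "-1"] by simp

lemma L2_diff [simp]: "L2 f \<Longrightarrow> L2 g \<Longrightarrow> L2 (\<lambda>x. f x - g x)"
  using L2_add[OF _ L2_minus, of f g] by simp

lemma L2_cnj [simp]: assumes "L2 f" shows "L2 (\<lambda>x. cnj (f x))"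
proof (rule L2_bound[OF _ L2_integrable[OF assms]])
  have "cnj \<in> borel_measurable borel"
    by (intro borel_measurable_continuous_onI continuous_intros)
  from measurable_compose[OF L2_measurable[OF assms] this]
  show "(\<lambda>x. cnj (f x)) \<in> borel_measurable lebesgue" .
qed simp

text \<open>
  Lebesgue measure is complete, so changing a function on a null set preserves measurability.
\<close>

lemma lebesgue_measurable_cong_AE:
  fixes f g :: "'a::euclidean_space \<Rightarrow> 'b::topological_space"
  assumes f: "f \<in> borel_measurable lebesgue" and ae: "AE x in lebesgue. f x = g x"
  shows "g \<in> borel_measurable lebesgue"
proof (rule measurableI)
  fix A :: "'b set" assume A: "A \<in> sets borel"
  show "g -` A \<inter> space lebesgue \<in> sets lebesgue"
  proof (rule completion.in_sets_AE)
    show "AE x in lebesgue. (x \<in> f -` A \<inter> space lebesgue) = (x \<in> g -` A \<inter> space lebesgue)"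
      using ae by eventually_elim auto
  qed (use measurable_sets[OF f A] in auto)
qed auto

lemma L2_cong_AE:
  assumes "L2 f" "AE x in lebesgue. f x = g x"
  shows "L2 g"
proof (rule L2_bound[OF _ L2_integrable[OF assms(1)]])
  show "g \<in> borel_measurable lebesgue"
    by (rule lebesgue_measurable_cong_AE[OF L2_measurable[OF assms(1)] assms(2)])
  show "AE x in lebesgue. (norm (g x))\<^sup>2 \<le> (norm (f x))\<^sup>2" using assms(2) by eventually_elim simp
qed

lemma L2_integrable_mult:
  assumes f: "L2 f" and g: "L2 g"
  shows "integrable lebesgue (\<lambda>x. f x * g x)"
proof (rule Bochner_Integration.integrable_bound)
  show "integrable lebesgue (\<lambda>x. (norm (f x))\<^sup>2 + (norm (g x))\<^sup>2)"
    by (intro Bochner_Integration.integrable_add L2_integrable assms)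
  show "(\<lambda>x. f x * g x) \<in> borel_measurable lebesgue"
    by (intro borel_measurable_times L2_measurable assms)
  have "norm (f x * g x) \<le> (norm (f x))\<^sup>2 + (norm (g x))\<^sup>2" for x
    using zero_le_power2[of "norm (f x) - norm (g x)"] zero_le_power2[of "norm (f x)"] zero_le_power2[of "norm (g x)"]
    unfolding norm_mult power2_diff by linarith
  then show "AE x in lebesgue. norm (f x * g x) \<le> norm ((norm (f x))\<^sup>2 + (norm (g x))\<^sup>2)" by simp
qed

lemma complex_inner_eq: "inner (z::complex) w = Re (z * cnj w)"
  by (simp add: inner_complex_def)

lemma L2_integrable_inner:
  assumes "L2 f" "L2 g"
  shows "integrable lebesgue (\<lambda>x. inner (f x) (g x))"
  unfolding complex_inner_eq using assms by (intro integrable_Re L2_integrable_mult L2_cnj)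

definition l2_rel :: "('a::euclidean_space \<Rightarrow> complex) \<Rightarrow> ('a \<Rightarrow> complex) \<Rightarrow> bool" where
  "l2_rel f g \<longleftrightarrow> L2 f \<and> L2 g \<and> (AE x in lebesgue. f x = g x)"

text \<open>
  Square integrable functions modulo null sets. As a type they form a Hilbert space in which limits
  and time derivatives of \<open>L\<^sup>2\<close>-valued functions can be taken. The inner product is the real part of the Hermitian one.
\<close>

quotient_type (overloaded) 'a l2 = "'a::euclidean_space \<Rightarrow> complex" / partial: l2_rel
proof (rule part_equivpI)
  show "\<exists>f. l2_rel f f" by (rule exI[of _ "\<lambda>x. 0"]) (simp add: l2_rel_def)
  show "symp l2_rel" by (auto simp: symp_def l2_rel_def elim: eventually_mono)
  show "transp l2_rel" unfolding transp_def l2_rel_def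
    by (auto elim: eventually_elim2)
qed

lemma l2_rel_refl [simp]: "l2_rel f f \<longleftrightarrow> L2 f"
  by (simp add: l2_rel_def)

instantiation l2 :: (euclidean_space) real_vector
begin

lift_definition zero_l2 :: "'a l2" is "\<lambda>x. 0" by simp
lift_definition plus_l2 :: "'a l2 \<Rightarrow> 'a l2 \<Rightarrow> 'a l2" is "\<lambda>f g x. f x + g x"
  unfolding l2_rel_def by (auto elim: eventually_elim2)
lift_definition minus_l2 :: "'a l2 \<Rightarrow> 'a l2 \<Rightarrow> 'a l2" is "\<lambda>f g x. f x - g x"
  unfolding l2_rel_def by (auto elim: eventually_elim2)
lift_definition uminus_l2 :: "'a l2 \<Rightarrow> 'a l2" is "\<lambda>f x. - f x"
  unfolding l2_rel_def by (auto elim: eventually_mono)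
lift_definition scaleR_l2 :: "real \<Rightarrow> 'a l2 \<Rightarrow> 'a l2" is "\<lambda>c f x. c *\<^sub>R f x"
  unfolding l2_rel_def by (auto elim: eventually_mono)

instance
proof
  fix x y z :: "'a l2" and a b :: real
  show "x + y + z = x + (y + z)" by transfer (auto simp: l2_rel_def add.assoc)
  show "x + y = y + x" by transfer (auto simp: l2_rel_def add.commute)
  show "0 + x = x" by transfer (auto simp: l2_rel_def)
  show "- x + x = 0" by transfer (auto simp: l2_rel_def)
  show "x - y = x + - y" by transfer (auto simp: l2_rel_def)
  show "a *\<^sub>R (x + y) = a *\<^sub>R x + a *\<^sub>R y" by transfer (auto simp: l2_rel_def scaleR_add_right)
  show "(a + b) *\<^sub>R x = a *\<^sub>R x + b *\<^sub>R x" by transfer (auto simp: l2_rel_def scaleR_add_left)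
  show "a *\<^sub>R b *\<^sub>R x = (a * b) *\<^sub>R x" by transfer (auto simp: l2_rel_def)
  show "1 *\<^sub>R x = x" by transfer (auto simp: l2_rel_def)
qed

end

instantiation l2 :: (euclidean_space) real_inner
begin

lift_definition inner_l2 :: "'a l2 \<Rightarrow> 'a l2 \<Rightarrow> real" is "\<lambda>f g. LINT x|lebesgue. inner (f x) (g x)"
proof -
  fix f f' g g' :: "'a \<Rightarrow> complex"
  assume *: "l2_rel f f'" "l2_rel g g'"
  show "(LINT x|lebesgue. inner (f x) (g x)) = (LINT x|lebesgue. inner (f' x) (g' x))"
  proof (rule integral_cong_AE)
    show "(\<lambda>x. inner (f x) (g x)) \<in> borel_measurable lebesgue" "(\<lambda>x. inner (f' x) (g' x)) \<in> borel_measurable lebesgue"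
      using * L2_integrable_inner by (auto simp: l2_rel_def intro: borel_measurable_integrable)
    show "AE x in lebesgue. inner (f x) (g x) = inner (f' x) (g' x)"
      using * unfolding l2_rel_def by (auto elim: eventually_elim2)
  qed
qed
definition norm_l2 :: "'a l2 \<Rightarrow> real" where "norm_l2 x = sqrt (inner x x)"
definition dist_l2 :: "'a l2 \<Rightarrow> 'a l2 \<Rightarrow> real" where "dist_l2 x y = norm (x - y)"
definition sgn_l2 :: "'a l2 \<Rightarrow> 'a l2" where "sgn_l2 x = x /\<^sub>R norm x"
definition uniformity_l2 :: "('a l2 \<times> 'a l2) filter" where
  "uniformity_l2 = (INF e\<in>{0<..}. principal {(x, y). dist x y < e})"
definition open_l2 :: "'a l2 set \<Rightarrow> bool" where
  "open_l2 U = (\<forall>x\<in>U. eventually (\<lambda>(x', y). x' = x \<longrightarrow> y \<in> U) uniformity)"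

instance
proof
  fix x y z :: "'a l2" and r :: real
  show "dist x y = norm (x - y)" by (fact dist_l2_def)
  show "sgn x = x /\<^sub>R norm x" by (fact sgn_l2_def)
  show "uniformity = (INF e\<in>{0<..}. principal {(x, y::'a l2). dist x y < e})" by (fact uniformity_l2_def)
  show "open U = (\<forall>x\<in>U. eventually (\<lambda>(x', y). x' = x \<longrightarrow> y \<in> U) uniformity)" for U :: "'a l2 set"
    by (fact open_l2_def)
  show "inner x y = inner y x" by transfer (simp add: inner_commute)
  show "inner (x + y) z = inner x z + inner y z"
    by transfer (simp add: inner_add_left L2_integrable_inner)
  show "inner (r *\<^sub>R x) y = r * inner x y" by transfer simp
  show "0 \<le> inner x x" by transfer (simp add: integral_nonneg)
  show "inner x x = 0 \<longleftrightarrow> x = 0"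
  proof (transfer, unfold l2_rel_refl)
    fix f :: "'a \<Rightarrow> complex" assume f: "L2 f"
    show "(LINT x|lebesgue. inner (f x) (f x)) = 0 \<longleftrightarrow> l2_rel f (\<lambda>x. 0)"
      using integral_nonneg_eq_0_iff_AE[OF L2_integrable_inner[OF f f]] f by (simp add: l2_rel_def)
  qed
  show "norm x = sqrt (inner x x)" by (fact norm_l2_def)
qed

end

lemma norm_abs_l2: "L2 f \<Longrightarrow> norm (abs_l2 f) = L2_norm f"
  by (simp add: norm_l2_def inner_l2.abs_eq L2_norm_def power2_norm_eq_inner)

lemma L2_rep [simp]: "L2 (rep_l2 x)"
  using Quotient_rep_reflp[OF Quotient_l2, of x] by simp

lemma abs_rep_l2 [simp]: "abs_l2 (rep_l2 x) = x"
  by (rule Quotient_abs_rep[OF Quotient_l2])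

lemma abs_l2_eq_iff: "L2 f \<Longrightarrow> L2 g \<Longrightarrow> abs_l2 f = abs_l2 g \<longleftrightarrow> (AE x in lebesgue. f x = g x)"
  using Quotient_rel[OF Quotient_l2, of f g] by (simp add: l2_rel_def)

lemma rep_abs_l2: "L2 f \<Longrightarrow> AE x in lebesgue. rep_l2 (abs_l2 f) x = f x"
  by (subst abs_l2_eq_iff[symmetric]) auto

lemma L2_norm_rep: "L2_norm (rep_l2 x) = norm x"
  using norm_abs_l2[of "rep_l2 x"] by simp

text \<open>
  The Riesz--Fischer theorem. On a space of infinite measure a Cauchy sequence in \<open>L\<^sup>2\<close> need not be
  Cauchy in \<open>L\<^sup>1\<close>, but it becomes so after multiplication by a strictly positive function \<open>w \<in> L\<^sup>2\<close>.
  A subsequence then converges almost everywhere, and Fatou's lemma identifies the limit.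
\<close>

lemma Riesz_Fischer:
  fixes X :: "nat \<Rightarrow> 'a::euclidean_space \<Rightarrow> complex"
  assumes L: "\<And>n. L2 (X n)"
    and C: "\<And>e. e > 0 \<Longrightarrow> \<exists>N. \<forall>i\<ge>N. \<forall>j\<ge>N. (LINT x|lebesgue. (norm (X i x - X j x))\<^sup>2) \<le> e"
  shows "\<exists>f. L2 f \<and> (\<forall>e>0. \<exists>N. \<forall>i\<ge>N. (LINT x|lebesgue. (norm (X i x - f x))\<^sup>2) \<le> e)"
proof -
  note [measurable] = L[THEN L2_measurable]
  obtain h :: "'a \<Rightarrow> ennreal" where h: "h \<in> borel_measurable lborel" "(\<integral>\<^sup>+x. h x \<partial>lborel) \<noteq> \<infinity>"
    "\<And>x. 0 < h x" "\<And>x. h x < \<infinity>"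
    using sigma_finite_measure.Ex_finite_integrable_function[OF sigma_finite_lborel] by auto
  define w where "w x = sqrt (enn2real (h x))" for x
  have w0: "w x > 0" for x using h(3,4)[of x] by (simp add: w_def enn2real_positive_iff)
  have wm [measurable]: "w \<in> borel_measurable lebesgue"
  proof -
    have [measurable]: "h \<in> borel_measurable borel" using h(1) by simp
    show ?thesis unfolding w_def by (intro measurable_completion) measurable
  qed
  have w2: "integrable lebesgue (\<lambda>x. (w x)\<^sup>2)"
  proof (rule integrableI_nonneg)
    have "(\<integral>\<^sup>+x. ennreal ((w x)\<^sup>2) \<partial>lebesgue) = (\<integral>\<^sup>+x. h x \<partial>lborel)"
      using h(4)[THEN less_imp_neq] by (simp add: nn_integral_completion w_def ennreal_enn2real_if)
    then show "(\<integral>\<^sup>+x. ennreal ((w x)\<^sup>2) \<partial>lebesgue) < \<infinity>" using h(2) by (simp add: less_top)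
  qed (auto simp: measurable_completion)
  define K where "K = (LINT x|lebesgue. (w x)\<^sup>2)"
  have Lw: "L2 (\<lambda>x. of_real (w x))"
    unfolding L2_def using w2 by simp
  have intw: "integrable lebesgue (\<lambda>x. of_real (w x) * X n x)" for n
    by (rule L2_integrable_mult[OF Lw L])
  have "\<exists>N. \<forall>i\<ge>N. \<forall>j\<ge>N. (LINT x|lebesgue. norm (of_real (w x) * X i x - of_real (w x) * X j x)) < e"
    if "e > 0" for e
  proof -
    \<comment> \<open>Young's inequality \<open>2 w y \<le> d w\<^sup>2 + y\<^sup>2 / d\<close>: the weight \<open>d\<close> makes the first term
      small, and the Cauchy property the second.\<close>
    define d where "d = e / (K + 1)"
    have K: "K \<ge> 0" unfolding K_def by simp
    then have d: "d > 0" "d * K < e" using that by (auto simp: d_def field_simps)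
    obtain N where N: "\<forall>i\<ge>N. \<forall>j\<ge>N. (LINT x|lebesgue. (norm (X i x - X j x))\<^sup>2) \<le> d * (e - d * K)"
      using C[of "d * (e - d * K)"] d by auto
    show ?thesis
    proof (intro exI[of _ N] allI impI)
      fix i j assume "i \<ge> N" "j \<ge> N"
      have pw: "norm (of_real (w x) * X i x - of_real (w x) * X j x)
          \<le> (d * (w x)\<^sup>2 + (norm (X i x - X j x))\<^sup>2 / d) / 2" for x
      proof -
        have "0 \<le> (d * w x - norm (X i x - X j x))\<^sup>2 / d" using d by simp
        also have "\<dots> = d * (w x)\<^sup>2 + (norm (X i x - X j x))\<^sup>2 / d - 2 * (w x * norm (X i x - X j x))"
          using d by (simp add: power2_diff field_simps power2_eq_square)
        finally show ?thesis using w0[of x] by (simp add: norm_mult flip: right_diff_distrib)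
      qed
      have i1: "integrable lebesgue (\<lambda>x. (norm (X i x - X j x))\<^sup>2)"
        by (intro L2_integrable L2_diff L)
      have "(LINT x|lebesgue. norm (of_real (w x) * X i x - of_real (w x) * X j x))
          \<le> (LINT x|lebesgue. (d * (w x)\<^sup>2 + (norm (X i x - X j x))\<^sup>2 / d) / 2)"
        by (intro integral_mono pw integrable_norm Bochner_Integration.integrable_diff intw
            integrable_divide Bochner_Integration.integrable_add integrable_mult_right i1 w2)
      also have "\<dots> = (d * K + (LINT x|lebesgue. (norm (X i x - X j x))\<^sup>2) / d) / 2"
        using i1 w2 by (simp add: K_def)
      also have "\<dots> \<le> (d * K + (e - d * K)) / 2"
      proof -
        have "(LINT x|lebesgue. (norm (X i x - X j x))\<^sup>2) / d \<le> e - d * K"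
          using N \<open>i \<ge> N\<close> \<open>j \<ge> N\<close> d(1) by (simp add: pos_divide_le_eq mult.commute)
        then show ?thesis by (intro divide_right_mono add_left_mono) auto
      qed
      also have "\<dots> < e" using that by simp
      finally show "(LINT x|lebesgue. norm (of_real (w x) * X i x - of_real (w x) * X j x)) < e" .
    qed
  qed
  from cauchy_L1_AE_cauchy_subseq[OF intw this] obtain r where r: "strict_mono r"
    "AE x in lebesgue. Cauchy (\<lambda>i. of_real (w x) * X (r i) x)" by blast
  define f where "f x = lim (\<lambda>i. X (r i) x)" for x
  have conv: "AE x in lebesgue. (\<lambda>i. X (r i) x) \<longlonglongrightarrow> f x"
    using r(2)
  proof eventually_elim
    case (elim x)
    then obtain l where "(\<lambda>i. of_real (w x) * X (r i) x) \<longlonglongrightarrow> l"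
      using Cauchy_convergent convergent_def by blast
    then have "(\<lambda>i. inverse (of_real (w x)) * (of_real (w x) * X (r i) x)) \<longlonglongrightarrow> inverse (of_real (w x)) * l"
      by (intro tendsto_intros)
    moreover have "inverse (of_real (w x)) * (of_real (w x) * X (r i) x) = X (r i) x" for i
      using w0[of x] by (simp add: mult.assoc[symmetric])
    ultimately have "convergent (\<lambda>i. X (r i) x)" by (auto simp: convergent_def)
    then show ?case by (simp add: f_def convergent_LIMSEQ_iff)
  qed
  have fm [measurable]: "f \<in> borel_measurable lebesgue"
    unfolding f_def by (rule borel_measurable_lim_metric) measurable
  have key: "integrable lebesgue (\<lambda>x. (norm (X i x - f x))\<^sup>2) \<and> (LINT x|lebesgue. (norm (X i x - f x))\<^sup>2) \<le> e"
    if N: "\<forall>i\<ge>N. \<forall>j\<ge>N. (LINT x|lebesgue. (norm (X i x - X j x))\<^sup>2) \<le> e" and "i \<ge> N" "e > 0" for e i N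
  proof -
    have ij: "integrable lebesgue (\<lambda>x. (norm (X i x - X j x))\<^sup>2)" for j
      by (intro L2_integrable L2_diff L)
    have "(\<integral>\<^sup>+x. ennreal ((norm (X i x - f x))\<^sup>2) \<partial>lebesgue)
        = (\<integral>\<^sup>+x. liminf (\<lambda>j. ennreal ((norm (X i x - X (r j) x))\<^sup>2)) \<partial>lebesgue)"
    proof (rule nn_integral_cong_AE)
      show "AE x in lebesgue. ennreal ((norm (X i x - f x))\<^sup>2) = liminf (\<lambda>j. ennreal ((norm (X i x - X (r j) x))\<^sup>2))"
        using conv
      proof eventually_elim
        case (elim x)
        then have "(\<lambda>j. ennreal ((norm (X i x - X (r j) x))\<^sup>2)) \<longlonglongrightarrow> ennreal ((norm (X i x - f x))\<^sup>2)"
          by (intro tendsto_intros)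
        then show ?case by (intro lim_imp_Liminf[symmetric]) auto
      qed
    qed
    also have "\<dots> \<le> liminf (\<lambda>j. \<integral>\<^sup>+x. ennreal ((norm (X i x - X (r j) x))\<^sup>2) \<partial>lebesgue)"
      by (rule nn_integral_liminf) measurable
    also have "\<dots> \<le> ennreal e"
    proof (rule Liminf_le)
      show "\<forall>\<^sub>F j in sequentially. (\<integral>\<^sup>+x. ennreal ((norm (X i x - X (r j) x))\<^sup>2) \<partial>lebesgue) \<le> ennreal e"
        using eventually_ge_at_top[of N]
      proof eventually_elim
        case (elim j)
        then have "r j \<ge> N" using strict_mono_imp_increasing[OF r(1), of j] by linarith
        then show ?case using N \<open>i \<ge> N\<close>
          by (subst nn_integral_eq_integral[OF ij]) (auto intro: ennreal_leI)
      qed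
    qed simp
    finally have le: "(\<integral>\<^sup>+x. ennreal ((norm (X i x - f x))\<^sup>2) \<partial>lebesgue) \<le> ennreal e" .
    have int: "integrable lebesgue (\<lambda>x. (norm (X i x - f x))\<^sup>2)"
      by (rule integrableI_nonneg) (use le in \<open>auto simp: order_le_less_trans\<close>)
    moreover have "ennreal (LINT x|lebesgue. (norm (X i x - f x))\<^sup>2) \<le> ennreal e"
      using le by (subst (asm) nn_integral_eq_integral[OF int]) auto
    ultimately show ?thesis using that by (simp add: ennreal_le_iff)
  qed
  obtain N where N: "\<forall>i\<ge>N. \<forall>j\<ge>N. (LINT x|lebesgue. (norm (X i x - X j x))\<^sup>2) \<le> 1"
    using C[of 1] by auto
  have "L2 (\<lambda>x. X N x - f x)" using key[OF N, of N] by (simp add: L2_def)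
  then have "L2 f" using L2_diff[OF L[of N]] by fastforce
  moreover have "\<exists>N. \<forall>i\<ge>N. (LINT x|lebesgue. (norm (X i x - f x))\<^sup>2) \<le> e" if "e > 0" for e
    using C[OF that] key that by blast
  ultimately show ?thesis by blast
qed

instance l2 :: (euclidean_space) banach
proof
  fix X :: "nat \<Rightarrow> 'a l2"
  assume X: "Cauchy X"
  have dist: "(dist (abs_l2 f) (abs_l2 g))\<^sup>2 = (LINT x|lebesgue. (norm (f x - g x))\<^sup>2)"
    if "L2 f" "L2 g" for f g :: "'a \<Rightarrow> complex"
    using that by (simp add: dist_norm minus_l2.abs_eq norm_abs_l2 L2_norm_def)
  have "\<exists>f. L2 f \<and> (\<forall>e>0. \<exists>N. \<forall>i\<ge>N. (LINT x|lebesgue. (norm (rep_l2 (X i) x - f x))\<^sup>2) \<le> e)"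
  proof (rule Riesz_Fischer)
    fix e :: real assume "e > 0"
    then obtain N where N: "\<forall>i\<ge>N. \<forall>j\<ge>N. dist (X i) (X j) < sqrt e"
      using metric_CauchyD[OF X, of "sqrt e"] by auto
    have "(dist (X i) (X j))\<^sup>2 \<le> e" if "i \<ge> N" "j \<ge> N" for i j
      using N that real_sqrt_less_iff[of "(dist (X i) (X j))\<^sup>2" e] by (auto intro: less_imp_le)
    then show "\<exists>N. \<forall>i\<ge>N. \<forall>j\<ge>N. (LINT x|lebesgue. (norm (rep_l2 (X i) x - rep_l2 (X j) x))\<^sup>2) \<le> e"
      by (auto simp flip: dist)
  qed simp
  then obtain f where f: "L2 f" "\<And>e. e > 0 \<Longrightarrow> \<exists>N. \<forall>i\<ge>N. (dist (X i) (abs_l2 f))\<^sup>2 \<le> e"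
    by (auto simp flip: dist)
  have "X \<longlonglongrightarrow> abs_l2 f"
  proof (rule metric_LIMSEQ_I)
    fix e :: real assume "e > 0"
    then obtain N where N: "\<forall>i\<ge>N. (dist (X i) (abs_l2 f))\<^sup>2 \<le> (e / 2)\<^sup>2" using f(2)[of "(e / 2)\<^sup>2"] by auto
    have "dist (X i) (abs_l2 f) < e" if "i \<ge> N" for i
      using N that power2_le_imp_le[of "dist (X i) (abs_l2 f)" "e / 2"] \<open>e > 0\<close> by fastforce
    then show "\<exists>N. \<forall>i\<ge>N. dist (X i) (abs_l2 f) < e" by blast
  qed
  then show "convergent X" by (rule convergentI)
qed

section \<open>Plancherel's theorem for continuous functions of compact support\<close>

definition fourier_unnorm :: "('a::euclidean_space \<Rightarrow> complex) \<Rightarrow> 'a \<Rightarrow> complex" where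
  "fourier_unnorm f \<xi> = (LINT x|lborel. iexp (- (x \<bullet> \<xi>)) * f x)"

definition gaussian :: "'a::euclidean_space \<Rightarrow> real" where
  "gaussian x = exp (- (norm x)\<^sup>2 / 2)"

lemma gaussian_pos: "gaussian x > 0"
  by (simp add: gaussian_def)

lemma gaussian_continuous [continuous_intros]: "continuous_on S gaussian"
  unfolding gaussian_def by (intro continuous_intros) auto

lemma gaussian_measurable [measurable]: "gaussian \<in> borel_measurable borel"
  by (intro borel_measurable_continuous_onI gaussian_continuous)

lemma norm_iexp [simp]: "norm (iexp r) = 1"
  by simp

text \<open>
  The characteristic function of the standard normal distribution, without its normalisation.
\<close>

lemma real_gaussian_fourier:
  fixes t :: real
  shows "integrable lborel (\<lambda>x. iexp (x * t) * of_real (exp (- x\<^sup>2 / 2)))"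
    and "(LINT x|lborel. iexp (x * t) * of_real (exp (- x\<^sup>2 / 2)))
         = of_real (sqrt (2 * pi) * exp (- t\<^sup>2 / 2))"
proof -
  have eq: "iexp (x * t) * of_real (exp (- x\<^sup>2 / 2)) = of_real (sqrt (2 * pi)) * (std_normal_density x *\<^sub>R iexp (t * x))" for x
    by (simp add: std_normal_density_def scaleR_conv_of_real mult_ac)
  have int: "integrable lborel (\<lambda>x. std_normal_density x *\<^sub>R iexp (t * x))"
  proof (rule Bochner_Integration.integrable_bound[OF integrable_normal_density[of 1 0]])
    show "AE x in lborel. norm (std_normal_density x *\<^sub>R iexp (t * x)) \<le> norm (std_normal_density x)" by simp
  qed auto
  show "integrable lborel (\<lambda>x. iexp (x * t) * of_real (exp (- x\<^sup>2 / 2)))"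
    unfolding eq by (intro integrable_mult_right int)
  have "char std_normal_distribution t = (LINT x|lborel. std_normal_density x *\<^sub>R iexp (t * x))"
    unfolding char_def by (subst integral_density) auto
  then show "(LINT x|lborel. iexp (x * t) * of_real (exp (- x\<^sup>2 / 2)))
         = of_real (sqrt (2 * pi) * exp (- t\<^sup>2 / 2))"
    unfolding eq integral_mult_right_zero by (simp add: char_std_normal_distribution)
qed

text \<open>
  Lebesgue measure on a Euclidean space is the image of a product measure and the integrand is a
  product over the coordinates, so the one-dimensional case suffices.
\<close>

lemma gaussian_fourier:
  fixes \<xi> :: "'a::euclidean_space"
  shows "integrable lborel (\<lambda>x. iexp (x \<bullet> \<xi>) * of_real (gaussian x))"
    and "(LINT x|lborel. iexp (x \<bullet> \<xi>) * of_real (gaussian x))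
         = of_real ((2 * pi) powr (DIM('a) / 2) * gaussian \<xi>)"
proof -
  interpret product_sigma_finite "\<lambda>_::'a. lborel :: real measure" ..
  define g where "g b x = iexp (x * (\<xi> \<bullet> b)) * of_real (exp (- x\<^sup>2 / 2))" for b :: 'a and x
  let ?T = "\<lambda>f. \<Sum>b\<in>Basis. f b *\<^sub>R (b::'a)"
  have T: "?T \<in> measurable (\<Pi>\<^sub>M b\<in>Basis. lborel) borel" by measurable
  have m: "(\<lambda>x. iexp (x \<bullet> \<xi>) * of_real (gaussian x)) \<in> borel_measurable borel" by measurable
  have inner_T: "?T f \<bullet> b = f b" if "b \<in> Basis" for f and b :: 'a
    using that by (simp add: inner_sum_left inner_Basis if_distrib cong: if_cong)
  have eq: "iexp (?T f \<bullet> \<xi>) * of_real (gaussian (?T f)) = (\<Prod>b\<in>Basis. g b (f b))" for f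
  proof -
    have "?T f \<bullet> \<xi> = (\<Sum>b\<in>Basis. f b * (\<xi> \<bullet> b))"
      unfolding inner_sum_left inner_scaleR_left by (simp add: inner_commute)
    then have 1: "iexp (?T f \<bullet> \<xi>) = (\<Prod>b\<in>Basis. iexp (f b * (\<xi> \<bullet> b)))"
      by (simp add: exp_sum[symmetric] sum_distrib_left)
    have "(norm (?T f))\<^sup>2 = (\<Sum>b\<in>Basis. (f b)\<^sup>2)"
      by (subst power2_norm_eq_inner, subst euclidean_inner) (simp add: inner_T power2_eq_square cong: sum.cong)
    then have 2: "gaussian (?T f) = (\<Prod>b\<in>Basis. exp (- (f b)\<^sup>2 / 2))"
      unfolding gaussian_def by (simp add: exp_sum[symmetric] sum_negf sum_divide_distrib[symmetric])
    show ?thesis unfolding 1 2 g_def by (simp add: prod.distrib)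
  qed
  have gi: "integrable lborel (g b)" for b unfolding g_def by (rule real_gaussian_fourier)
  show "integrable lborel (\<lambda>x. iexp (x \<bullet> \<xi>) * of_real (gaussian x))"
    by (subst lborel_eq, subst integrable_distr_eq[OF T m], unfold eq)
      (intro product_integrable_prod finite_Basis gi)
  have "(LINT x|lborel. iexp (x \<bullet> \<xi>) * of_real (gaussian x)) = (\<Prod>b\<in>Basis. integral\<^sup>L lborel (g b))"
    by (subst lborel_eq, subst integral_distr[OF T m], unfold eq)
      (intro product_integral_prod finite_Basis gi)
  also have "\<dots> = (\<Prod>b\<in>Basis. of_real (sqrt (2 * pi) * exp (- (\<xi> \<bullet> b)\<^sup>2 / 2)))"
    unfolding g_def real_gaussian_fourier(2) ..
  also have "\<dots> = of_real (sqrt (2 * pi) ^ DIM('a) * gaussian \<xi>)"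
  proof -
    have "(norm \<xi>)\<^sup>2 = (\<Sum>b\<in>Basis. (\<xi> \<bullet> b)\<^sup>2)"
      unfolding power2_norm_eq_inner by (subst euclidean_inner) (simp add: power2_eq_square)
    then have "gaussian \<xi> = (\<Prod>b\<in>Basis. exp (- (\<xi> \<bullet> b)\<^sup>2 / 2))"
      unfolding gaussian_def by (simp add: exp_sum[symmetric] sum_negf sum_divide_distrib[symmetric])
    then show ?thesis by (simp add: prod.distrib flip: of_real_prod)
  qed
  also have "sqrt (2 * pi) ^ DIM('a) = (2 * pi) powr (DIM('a) / 2)"
    by (simp add: powr_half_sqrt[symmetric] powr_realpow[symmetric] powr_powr)
  finally show "(LINT x|lborel. iexp (x \<bullet> \<xi>) * of_real (gaussian x))
         = of_real ((2 * pi) powr (DIM('a) / 2) * gaussian \<xi>)" .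
qed

lemma gaussian_integrable: "integrable lborel (gaussian :: 'a::euclidean_space \<Rightarrow> real)"
  using integrable_Re[OF gaussian_fourier(1)[of "0::'a"]] by simp

lemma gaussian_integral: "(LINT x|lborel. gaussian (x::'a::euclidean_space)) = (2 * pi) powr (DIM('a) / 2)"
  using gaussian_fourier(2)[of "0::'a"] by (simp add: gaussian_def flip: of_real_mult)

lemma lborel_integral_affine:
  fixes g :: "'a::euclidean_space \<Rightarrow> 'b::{banach, second_countable_topology}"
  assumes [measurable]: "g \<in> borel_measurable borel" and "c > 0"
  shows "(LINT y|lborel. g y) = c ^ DIM('a) *\<^sub>R (LINT z|lborel. g (t + c *\<^sub>R z))"
proof -
  have "(LINT y|lborel. g y) = (LINT y|density (distr lborel borel (\<lambda>x. t + c *\<^sub>R x)) (\<lambda>_. ennreal (c ^ DIM('a))). g y)"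
    using lborel_affine[of c t] \<open>c > 0\<close> by (simp add: ennreal_power)
  also have "\<dots> = (LINT y|distr lborel borel (\<lambda>x. t + c *\<^sub>R x). c ^ DIM('a) *\<^sub>R g y)"
    using \<open>c > 0\<close> by (subst integral_density) auto
  also have "\<dots> = (LINT z|lborel. c ^ DIM('a) *\<^sub>R g (t + c *\<^sub>R z))"
    by (subst integral_distr) auto
  finally show ?thesis by simp
qed

lemma lborel_integrable_affine:
  fixes g :: "'a::euclidean_space \<Rightarrow> 'b::{banach, second_countable_topology}"
  assumes g: "integrable lborel g" and "c > 0"
  shows "integrable lborel (\<lambda>z. g (t + c *\<^sub>R z))"
proof -
  have [measurable]: "g \<in> borel_measurable borel" using borel_measurable_integrable[OF g] by simp
  have "integrable (density (distr lborel borel (\<lambda>x. t + c *\<^sub>R x)) (\<lambda>_. ennreal (c ^ DIM('a)))) g"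
    using g lborel_affine[of c t] \<open>c > 0\<close> by (simp add: ennreal_power)
  then have "integrable (distr lborel borel (\<lambda>x. t + c *\<^sub>R x)) (\<lambda>y. c ^ DIM('a) *\<^sub>R g y)"
    using \<open>c > 0\<close> by (subst (asm) integrable_density) auto
  then have "integrable lborel (\<lambda>z. c ^ DIM('a) *\<^sub>R g (t + c *\<^sub>R z))"
    by (subst (asm) integrable_distr_eq) auto
  then have "integrable lborel (\<lambda>z. inverse (c ^ DIM('a)) *\<^sub>R (c ^ DIM('a) *\<^sub>R g (t + c *\<^sub>R z)))"
    by (rule integrable_scaleR_right)
  then show ?thesis using \<open>c > 0\<close> by simp
qed

lemma integrable_iexp_mult:
  assumes "integrable lborel f"
  shows "integrable lborel (\<lambda>x. iexp (- (x \<bullet> \<xi>)) * f x)"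
proof (rule Bochner_Integration.integrable_bound[OF assms])
  have [measurable]: "f \<in> borel_measurable borel" using borel_measurable_integrable[OF assms] by simp
  show "(\<lambda>x. iexp (- (x \<bullet> \<xi>)) * f x) \<in> borel_measurable lborel" by measurable
qed (simp add: norm_mult)

lemma fourier_unnorm_bound:
  assumes "integrable lborel f"
  shows "norm (fourier_unnorm f \<xi>) \<le> (LINT x|lborel. norm (f x))"
  unfolding fourier_unnorm_def
  using integral_norm_bound[of lborel "\<lambda>x. iexp (- (x \<bullet> \<xi>)) * f x"] by (simp add: norm_mult)

lemma fourier_unnorm_continuous:
  assumes f: "integrable lborel f"
  shows "continuous_on UNIV (fourier_unnorm f)"
proof -
  have [measurable]: "f \<in> borel_measurable borel" using borel_measurable_integrable[OF f] by simp
  have "(\<lambda>n. fourier_unnorm f (y n)) \<longlonglongrightarrow> fourier_unnorm f \<xi>" if y: "y \<longlonglongrightarrow> \<xi>" for y \<xi>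
    unfolding fourier_unnorm_def
  proof (rule integral_dominated_convergence[where w="\<lambda>x. norm (f x)"])
    show "AE x in lborel. (\<lambda>n. iexp (- (x \<bullet> y n)) * f x) \<longlonglongrightarrow> iexp (- (x \<bullet> \<xi>)) * f x"
      by (intro AE_I2 tendsto_intros y)
  qed (auto simp: norm_mult f)
  then show ?thesis by (auto simp: continuous_on_sequentially o_def)
qed

text \<open>
  Both sides equal the double integral of \<open>exp (- i x \<cdot> \<xi>) f(x) g(\<xi>)\<close>, by Fubini's theorem.
\<close>

lemma fourier_multiplication_formula:
  assumes f: "integrable lborel f" and g: "integrable lborel g"
  shows "(LINT \<xi>|lborel. fourier_unnorm f \<xi> * g \<xi>) = (LINT x|lborel. f x * fourier_unnorm g (x::'a::euclidean_space))"
proof -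
  have [measurable]: "f \<in> borel_measurable borel" "g \<in> borel_measurable borel"
    using borel_measurable_integrable[OF f] borel_measurable_integrable[OF g] by simp_all
  let ?h = "\<lambda>x \<xi>. iexp (- (x \<bullet> \<xi>)) * f x * g \<xi>"
  have "integrable (lborel \<Otimes>\<^sub>M lborel) (case_prod ?h)"
  proof (rule lborel_pair.Fubini_integrable)
    show "case_prod ?h \<in> borel_measurable (lborel \<Otimes>\<^sub>M lborel)" by measurable
    show "integrable lborel (\<lambda>x. LINT y|lborel. norm (case_prod ?h (x, y)))"
      using f by (simp add: norm_mult)
    show "AE x in lborel. integrable lborel (\<lambda>y. case_prod ?h (x, y))"
    proof (rule AE_I2)
      fix x
      have "integrable lborel (\<lambda>y. f x * (iexp (- (y \<bullet> x)) * g y))"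
        by (intro integrable_mult_right integrable_iexp_mult g)
      then show "integrable lborel (\<lambda>y. case_prod ?h (x, y))" by (simp add: mult_ac inner_commute)
    qed
  qed
  from lborel_pair.Fubini_integral[OF this]
  have "(LINT \<xi>|lborel. LINT x|lborel. ?h x \<xi>) = (LINT x|lborel. LINT \<xi>|lborel. ?h x \<xi>)" .
  moreover have "(LINT x|lborel. ?h x \<xi>) = fourier_unnorm f \<xi> * g \<xi>" for \<xi>
    unfolding fourier_unnorm_def by (simp only: integral_mult_left_zero)
  moreover have "(LINT \<xi>|lborel. ?h x \<xi>) = f x * fourier_unnorm g x" for x
    unfolding fourier_unnorm_def by (simp add: mult_ac inner_commute flip: integral_mult_right_zero)
  ultimately show ?thesis by (simp only:)
qed

definition Cc :: "real \<Rightarrow> ('a::euclidean_space \<Rightarrow> complex) \<Rightarrow> bool" where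
  "Cc R f \<longleftrightarrow> continuous_on UNIV f \<and> (\<forall>x. R < norm x \<longrightarrow> f x = 0)"

lemma Cc_measurable: "Cc R f \<Longrightarrow> f \<in> borel_measurable borel"
  by (auto simp: Cc_def intro: borel_measurable_continuous_onI)

lemma Cc_diff: "Cc R f \<Longrightarrow> Cc R g \<Longrightarrow> Cc R (\<lambda>x. f x - g x)"
  by (auto simp: Cc_def intro: continuous_intros)

lemma Cc_bounded:
  assumes "Cc R f"
  obtains B where "\<And>x. norm (f x) \<le> B * indicator (cball 0 R) x" "B \<ge> 0"
proof -
  have "bounded (f ` cball 0 R)"
    using assms by (intro compact_imp_bounded compact_continuous_image)
      (auto simp: Cc_def intro: continuous_on_subset)
  then obtain B where B: "\<And>x. x \<in> cball 0 R \<Longrightarrow> norm (f x) \<le> B" unfolding bounded_iff by blast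
  have "norm (f x) \<le> \<bar>B\<bar> * indicator (cball 0 R) x" for x
    using B[of x] assms by (cases "x \<in> cball 0 R") (auto simp: Cc_def)
  then show ?thesis using that[of "\<bar>B\<bar>"] by simp
qed

lemma Cc_integrable:
  assumes "Cc R f"
  shows "integrable lborel f" "integrable lborel (\<lambda>x. (norm (f x))\<^sup>2)"
proof -
  obtain B where B: "\<And>x. norm (f x) \<le> B * indicator (cball 0 R) x" "B \<ge> 0" by (rule Cc_bounded[OF assms]) blast
  have i: "integrable lborel (\<lambda>x. c * indicator (cball (0::'a) R) x)" for c :: real
    by (intro integrable_mult_right integrable_real_indicator emeasure_bounded_finite) auto
  note [measurable] = Cc_measurable[OF assms]
  show "integrable lborel f"
    by (rule Bochner_Integration.integrable_bound[OF i[of B]]) (use B in auto)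
  have "(norm (f x))\<^sup>2 \<le> B\<^sup>2 * indicator (cball 0 R) x" for x
    using B(1)[of x] B(2) power_mono[OF B(1)[of x], of 2] by (auto simp: indicator_def split: if_splits)
  then show "integrable lborel (\<lambda>x. (norm (f x))\<^sup>2)"
    by (intro Bochner_Integration.integrable_bound[OF i[of "B\<^sup>2"]]) auto
qed

text \<open>
  With a Gaussian weight, \<open>\<integral> |\<F>f|\<^sup>2\<close> is an integral of \<open>f\<close> against an average of \<open>f\<close> at scale \<open>e\<close>. The
  multiplication formula is used twice: first to move one transform from \<open>f\<close> to the weighted conjugate
  \<open>h\<close> of the other, then, for each \<open>x\<close>, to move the remaining one to a modulated Gaussian \<open>g\<close>, whose
  transform is again a Gaussian, centred at \<open>x\<close>.
\<close>

lemma fourier_gaussian_weight: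
  fixes f :: "'a::euclidean_space \<Rightarrow> complex"
  assumes f: "Cc R f" and e: "e > 0"
  shows "(LINT \<xi>|lborel. of_real ((norm (fourier_unnorm f \<xi>))\<^sup>2 * gaussian (e *\<^sub>R \<xi>)))
     = (LINT x|lborel. f x * cnj ((2 * pi) powr (DIM('a) / 2) * (LINT z|lborel. f (x + e *\<^sub>R z) * of_real (gaussian z))))"
proof -
  note [measurable] = Cc_measurable[OF f]
  note fi = Cc_integrable(1)[OF f]
  let ?c = "complex_of_real ((2 * pi) powr (DIM('a) / 2))"
  have ge: "integrable lborel (\<lambda>\<xi>::'a. gaussian (e *\<^sub>R \<xi>))"
    using lborel_integrable_affine[OF gaussian_integrable e, of 0] by simp
  have Fm [measurable]: "fourier_unnorm f \<in> borel_measurable borel"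
    by (intro borel_measurable_continuous_onI fourier_unnorm_continuous fi)
  define h where "h \<xi> = cnj (fourier_unnorm f \<xi>) * of_real (gaussian (e *\<^sub>R \<xi>))" for \<xi>
  define B where "B = (LINT x|lborel. norm (f x))"
  have "continuous_on UNIV (\<lambda>\<xi>. cnj (fourier_unnorm f \<xi>))"
    by (intro continuous_intros fourier_unnorm_continuous fi)
  then have [measurable]: "(\<lambda>\<xi>. cnj (fourier_unnorm f \<xi>)) \<in> borel_measurable borel"
    by (rule borel_measurable_continuous_onI)
  have hi: "integrable lborel h"
  proof (rule Bochner_Integration.integrable_bound)
    show "integrable lborel (\<lambda>\<xi>::'a. B * gaussian (e *\<^sub>R \<xi>))" by (intro integrable_mult_right ge)
    show "h \<in> borel_measurable lborel" unfolding h_def by measurable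
    have "norm (h \<xi>) \<le> B * gaussian (e *\<^sub>R \<xi>)" for \<xi>
      using gaussian_pos[of "e *\<^sub>R \<xi>"]
      by (auto simp: h_def norm_mult B_def intro!: mult_right_mono fourier_unnorm_bound[OF fi])
    then show "AE \<xi> in lborel. norm (h \<xi>) \<le> norm (B * gaussian (e *\<^sub>R \<xi>))"
      unfolding real_norm_def by (intro AE_I2 order_trans[OF _ abs_ge_self])
  qed
  have fourier_h: "fourier_unnorm h x = cnj (?c * (LINT z|lborel. f (x + e *\<^sub>R z) * of_real (gaussian z)))" for x
  proof -
    define g where "g \<xi> = iexp (\<xi> \<bullet> x) * of_real (gaussian (e *\<^sub>R \<xi>))" for \<xi>
    have gi: "integrable lborel g"
      unfolding g_def by (rule Bochner_Integration.integrable_bound[OF ge]) (auto simp: norm_mult)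
    have fourier_g: "fourier_unnorm g y = ?c * of_real (gaussian ((x - y) /\<^sub>R e) / e ^ DIM('a))" for y
    proof -
      define G where "G \<eta> = iexp (\<eta> \<bullet> ((x - y) /\<^sub>R e)) * of_real (gaussian \<eta>)" for \<eta>
      have "G \<in> borel_measurable borel" unfolding G_def by measurable
      from lborel_integral_affine[OF this e, of 0]
      have "(LINT \<eta>|lborel. G \<eta>) = e ^ DIM('a) *\<^sub>R (LINT \<xi>|lborel. G (e *\<^sub>R \<xi>))" by simp
      moreover have "G (e *\<^sub>R \<xi>) = iexp (- (\<xi> \<bullet> y)) * g \<xi>" for \<xi>
      proof -
        have "(e *\<^sub>R \<xi>) \<bullet> ((x - y) /\<^sub>R e) = \<xi> \<bullet> x + - (\<xi> \<bullet> y)"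
          using e by (simp add: inner_diff_right field_simps)
        then have "G (e *\<^sub>R \<xi>) = iexp (\<xi> \<bullet> x + - (\<xi> \<bullet> y)) * of_real (gaussian (e *\<^sub>R \<xi>))"
          by (simp only: G_def)
        then show ?thesis unfolding g_def by (simp only: of_real_add distrib_left exp_add mult_ac)
      qed
      moreover have "(LINT \<eta>|lborel. G \<eta>) = ?c * of_real (gaussian ((x - y) /\<^sub>R e))"
        unfolding G_def gaussian_fourier(2) by (simp only: of_real_mult)
      ultimately have "e ^ DIM('a) *\<^sub>R fourier_unnorm g y = ?c * of_real (gaussian ((x - y) /\<^sub>R e))"
        by (simp add: fourier_unnorm_def)
      then show ?thesis using e by (simp add: scaleR_conv_of_real field_simps)
    qed
    have "iexp (- (\<xi> \<bullet> x)) * h \<xi> = cnj (fourier_unnorm f \<xi> * g \<xi>)" for \<xi>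
      by (simp add: h_def g_def exp_cnj mult_ac)
    then have "fourier_unnorm h x = cnj (LINT \<xi>|lborel. fourier_unnorm f \<xi> * g \<xi>)"
      unfolding fourier_unnorm_def[of h] by (simp only: Bochner_Integration.integral_cnj)
    also have "(LINT \<xi>|lborel. fourier_unnorm f \<xi> * g \<xi>) = (LINT y|lborel. f y * fourier_unnorm g y)"
      by (rule fourier_multiplication_formula[OF fi gi])
    also have "\<dots> = e ^ DIM('a) *\<^sub>R (LINT z|lborel. f (x + e *\<^sub>R z) * fourier_unnorm g (x + e *\<^sub>R z))"
      unfolding fourier_g by (rule lborel_integral_affine[OF _ e]) measurable
    also have "\<dots> = e ^ DIM('a) *\<^sub>R (LINT z|lborel. (?c * of_real (inverse (e ^ DIM('a)))) * (f (x + e *\<^sub>R z) * of_real (gaussian z)))"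
    proof -
      have "gaussian ((x - (x + e *\<^sub>R z)) /\<^sub>R e) = gaussian z" for z
        using e by (simp add: gaussian_def)
      then show ?thesis unfolding fourier_g by (simp add: field_simps)
    qed
    also have "\<dots> = ?c * (LINT z|lborel. f (x + e *\<^sub>R z) * of_real (gaussian z))"
      using e by (simp only: integral_mult_right_zero) (simp add: scaleR_conv_of_real field_simps)
    finally show ?thesis .
  qed
  have "complex_of_real ((norm (fourier_unnorm f \<xi>))\<^sup>2 * gaussian (e *\<^sub>R \<xi>)) = fourier_unnorm f \<xi> * h \<xi>" for \<xi>
    unfolding h_def of_real_mult complex_norm_square by (simp add: mult_ac)
  then show ?thesis
    using fourier_multiplication_formula[OF fi hi] unfolding fourier_h by simp
qed

text \<open>
  The Gaussian weight \<open>gaussian (s n *\<^sub>R \<xi>)\<close> increases to \<open>1\<close> as \<open>s n\<close> tends to \<open>0\<close>, while the averages of \<open>f\<close> at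
  scale \<open>s n\<close> converge to \<open>f\<close> by continuity. Monotone convergence on the Fourier side also yields square
  integrability of the transform.
\<close>

lemma Plancherel_Cc:
  fixes f :: "'a::euclidean_space \<Rightarrow> complex"
  assumes f: "Cc R f"
  shows "integrable lborel (\<lambda>\<xi>. (norm (fourier_unnorm f \<xi>))\<^sup>2)"
    and "(LINT \<xi>|lborel. (norm (fourier_unnorm f \<xi>))\<^sup>2) = (2 * pi) ^ DIM('a) * (LINT x|lborel. (norm (f x))\<^sup>2)"
proof -
  note [measurable] = Cc_measurable[OF f]
  note fi = Cc_integrable(1)[OF f]
  obtain B where B: "\<And>x. norm (f x) \<le> B * indicator (cball 0 R) x" "B \<ge> 0" by (rule Cc_bounded[OF f]) blast
  have B': "norm (f x) \<le> B" for x using B(1)[of x] B(2) by (cases "x \<in> cball 0 R") auto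
  define s where "s n = inverse (real (Suc n))" for n
  have s: "s n > 0" for n by (simp add: s_def)
  have s_lim: "s \<longlonglongrightarrow> 0" unfolding s_def by (rule LIMSEQ_inverse_real_of_nat)
  let ?c = "(2 * pi) powr (DIM('a) / 2)"
  have cc: "?c * ?c = (2 * pi) ^ DIM('a)" by (simp add: powr_realpow flip: powr_add)
  define I where "I n x = (LINT z|lborel. f (x + s n *\<^sub>R z) * of_real (gaussian z))" for n x
  have [measurable]: "I n \<in> borel_measurable borel" for n
    unfolding I_def by measurable
  have gi: "integrable lborel (\<lambda>z::'a. B * gaussian z)" by (intro integrable_mult_right gaussian_integrable)
  have bd: "norm (f y * of_real (gaussian z)) \<le> B * gaussian z" for y z
    using gaussian_pos[of z] B'[of y] by (simp add: norm_mult mult_right_mono)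
  have I_lim: "(\<lambda>n. I n x) \<longlonglongrightarrow> f x * of_real ?c" for x
  proof -
    have "(\<lambda>n. I n x) \<longlonglongrightarrow> (LINT z|lborel. f x * of_real (gaussian (z::'a)))"
      unfolding I_def
    proof (rule integral_dominated_convergence[where w="\<lambda>z::'a. B * gaussian z"])
      have "(\<lambda>n. f (x + s n *\<^sub>R z)) \<longlonglongrightarrow> f (x + 0 *\<^sub>R z)" for z
        using f by (intro continuous_on_tendsto_compose[of UNIV f] tendsto_intros s_lim) (auto simp: Cc_def)
      then show "AE z in lborel. (\<lambda>n. f (x + s n *\<^sub>R z) * of_real (gaussian z)) \<longlonglongrightarrow> f x * of_real (gaussian z)"
        by (intro AE_I2 tendsto_intros) simp
    qed (auto intro!: bd gi simp: gaussian_integrable)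
    then show ?thesis by (simp add: gaussian_integral)
  qed
  have I_bd: "norm (I n x) \<le> B * ?c" for n x
  proof -
    have "norm (I n x) \<le> (LINT z|lborel. B * gaussian (z::'a))"
    proof -
      have "integrable lborel (\<lambda>z. f (x + s n *\<^sub>R z) * complex_of_real (gaussian z))"
        by (rule Bochner_Integration.integrable_bound[OF gi])
          (auto intro!: AE_I2 order_trans[OF bd])
      then show ?thesis
        unfolding I_def by (intro order_trans[OF integral_norm_bound] integral_mono integrable_norm gi bd)
    qed
    then show ?thesis by (simp add: gaussian_integral)
  qed
  define a where "a n = (LINT \<xi>|lborel. (norm (fourier_unnorm f \<xi>))\<^sup>2 * gaussian (s n *\<^sub>R \<xi>))" for n
  have cnjm: "(\<lambda>x. cnj (g x)) \<in> borel_measurable borel" if "g \<in> borel_measurable borel" for g :: "'a \<Rightarrow> complex"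
    using measurable_compose[OF that borel_measurable_continuous_onI[of cnj]] by (simp add: continuous_on_cnj)
  have "(\<lambda>n. LINT x|lborel. f x * cnj (?c * I n x)) \<longlonglongrightarrow> (LINT x|lborel. f x * cnj (?c * (f x * of_real ?c)))"
  proof (rule integral_dominated_convergence[where w="\<lambda>x. norm (f x) * (?c * (B * ?c))"])
    show "AE x in lborel. (\<lambda>n. f x * cnj (?c * I n x)) \<longlonglongrightarrow> f x * cnj (?c * (f x * of_real ?c))"
      by (intro AE_I2 tendsto_intros I_lim)
    show "AE x in lborel. norm (f x * cnj (?c * I n x)) \<le> norm (f x) * (?c * (B * ?c))" for n
      unfolding norm_mult complex_mod_cnj
      by (intro AE_I2 mult_left_mono) (auto simp: abs_of_nonneg intro!: mult_left_mono I_bd)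
    show "(\<lambda>x. f x * cnj (?c * (f x * of_real ?c))) \<in> borel_measurable lborel"
      "(\<lambda>x. f x * cnj (?c * I n x)) \<in> borel_measurable lborel" for n
      unfolding measurable_lborel2 by (intro borel_measurable_times cnjm; measurable)+
    show "integrable lborel (\<lambda>x. norm (f x) * (?c * (B * ?c)))"
      by (intro integrable_mult_left integrable_norm fi)
  qed
  also have "(\<lambda>n. LINT x|lborel. f x * cnj (?c * I n x)) = (\<lambda>n. complex_of_real (a n))"
    unfolding a_def I_def by (simp only: fourier_gaussian_weight[OF f s, symmetric] integral_complex_of_real)
  also have "(\<lambda>x. f x * cnj (?c * (f x * of_real ?c))) = (\<lambda>x. of_real ((2 * pi) ^ DIM('a) * (norm (f x))\<^sup>2))"
    unfolding cc[symmetric] of_real_mult complex_norm_square by (simp add: mult_ac fun_eq_iff)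
  finally have a_lim: "a \<longlonglongrightarrow> (2 * pi) ^ DIM('a) * (LINT x|lborel. (norm (f x))\<^sup>2)"
    unfolding integral_complex_of_real tendsto_of_real_iff by simp
  have Fm [measurable]: "fourier_unnorm f \<in> borel_measurable borel"
    by (intro borel_measurable_continuous_onI fourier_unnorm_continuous fi)
  define bb where "bb = (LINT x|lborel. norm (f x))"
  have int: "integrable lborel (\<lambda>\<xi>. (norm (fourier_unnorm f \<xi>))\<^sup>2 * gaussian (s n *\<^sub>R \<xi>))" for n
  proof (rule Bochner_Integration.integrable_bound)
    show "integrable lborel (\<lambda>\<xi>::'a. bb\<^sup>2 * gaussian (s n *\<^sub>R \<xi>))"
      using lborel_integrable_affine[OF gaussian_integrable s, of 0] by (intro integrable_mult_right) simp
    have "(norm (fourier_unnorm f \<xi>))\<^sup>2 * gaussian (s n *\<^sub>R \<xi>) \<le> bb\<^sup>2 * gaussian (s n *\<^sub>R \<xi>)" for \<xi>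
      unfolding bb_def using gaussian_pos[of "s n *\<^sub>R \<xi>"]
      by (intro mult_right_mono power_mono fourier_unnorm_bound[OF fi]) auto
    then show "AE \<xi> in lborel. norm ((norm (fourier_unnorm f \<xi>))\<^sup>2 * gaussian (s n *\<^sub>R \<xi>)) \<le> norm (bb\<^sup>2 * gaussian (s n *\<^sub>R \<xi>))"
      by (intro AE_I2) (simp only: real_norm_def abs_of_nonneg mult_nonneg_nonneg zero_le_power2
          less_imp_le[OF gaussian_pos])
  qed measurable
  have mono: "mono (\<lambda>n. (norm (fourier_unnorm f \<xi>))\<^sup>2 * gaussian (s n *\<^sub>R \<xi>))" for \<xi>
  proof (rule monoI)
    fix m n :: nat assume "m \<le> n"
    then have "s n \<le> s m" unfolding s_def by (intro le_imp_inverse_le) auto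
    then have "(norm (s n *\<^sub>R \<xi>))\<^sup>2 \<le> (norm (s m *\<^sub>R \<xi>))\<^sup>2"
      using s[of n] s[of m] by (intro power_mono) (auto intro!: mult_right_mono)
    then show "(norm (fourier_unnorm f \<xi>))\<^sup>2 * gaussian (s m *\<^sub>R \<xi>) \<le> (norm (fourier_unnorm f \<xi>))\<^sup>2 * gaussian (s n *\<^sub>R \<xi>)"
      by (intro mult_left_mono) (simp_all add: gaussian_def)
  qed
  have lim: "(\<lambda>n. (norm (fourier_unnorm f \<xi>))\<^sup>2 * gaussian (s n *\<^sub>R \<xi>)) \<longlonglongrightarrow> (norm (fourier_unnorm f \<xi>))\<^sup>2" for \<xi>
  proof -
    have "(\<lambda>n. gaussian (s n *\<^sub>R \<xi>)) \<longlonglongrightarrow> gaussian (0 *\<^sub>R \<xi>)"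
      by (intro continuous_on_tendsto_compose[of UNIV gaussian] tendsto_intros s_lim gaussian_continuous) auto
    then have "(\<lambda>n. (norm (fourier_unnorm f \<xi>))\<^sup>2 * gaussian (s n *\<^sub>R \<xi>)) \<longlonglongrightarrow> (norm (fourier_unnorm f \<xi>))\<^sup>2 * gaussian (0 *\<^sub>R \<xi>)"
      by (intro tendsto_intros)
    then show ?thesis by (simp add: gaussian_def)
  qed
  show "integrable lborel (\<lambda>\<xi>. (norm (fourier_unnorm f \<xi>))\<^sup>2)"
    by (rule integrable_monotone_convergence[OF int AE_I2[OF mono] AE_I2[OF lim] a_lim[unfolded a_def]]) measurable
  show "(LINT \<xi>|lborel. (norm (fourier_unnorm f \<xi>))\<^sup>2) = (2 * pi) ^ DIM('a) * (LINT x|lborel. (norm (f x))\<^sup>2)"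
    by (rule integral_monotone_convergence[OF int AE_I2[OF mono] AE_I2[OF lim] a_lim[unfolded a_def]]) measurable
qed

section \<open>The Fourier transform as a unitary operator\<close>

lemma tendsto_l2I:
  assumes "\<And>n. L2 (g n)" "L2 f" "(\<lambda>n. LINT x|lebesgue. (norm (g n x - f x))\<^sup>2) \<longlonglongrightarrow> 0"
  shows "(\<lambda>n. abs_l2 (g n)) \<longlonglongrightarrow> abs_l2 f"
proof (rule tendsto_dist_iff[THEN iffD2])
  have "dist (abs_l2 (g n)) (abs_l2 f) = sqrt (LINT x|lebesgue. (norm (g n x - f x))\<^sup>2)" for n
    using assms by (simp add: dist_norm minus_l2.abs_eq norm_abs_l2 L2_norm_def)
  then show "(\<lambda>n. dist (abs_l2 (g n)) (abs_l2 f)) \<longlonglongrightarrow> 0"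
    using tendsto_real_sqrt[OF assms(3)] by simp
qed

lemma tendsto_l2D:
  assumes "\<And>n. L2 (g n)" "L2 f" "(\<lambda>n. abs_l2 (g n)) \<longlonglongrightarrow> abs_l2 f"
  shows "(\<lambda>n. L2_norm (\<lambda>x. g n x - f x)) \<longlonglongrightarrow> 0"
proof -
  have "L2_norm (\<lambda>x. g n x - f x) = dist (abs_l2 (g n)) (abs_l2 f)" for n
    using assms by (simp add: dist_norm minus_l2.abs_eq norm_abs_l2)
  then show ?thesis using tendsto_dist_iff[THEN iffD1, OF assms(3)] by simp
qed

lemma l2_dominated_convergence:
  assumes g: "\<And>n. g n \<in> borel_measurable lebesgue" and f: "f \<in> borel_measurable lebesgue" and h: "L2 h"
    and bd: "\<And>n. AE x in lebesgue. norm (g n x) \<le> norm (h x)"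
    and lim: "AE x in lebesgue. (\<lambda>n. g n x) \<longlonglongrightarrow> f x"
  shows "\<And>n. L2 (g n)" and "L2 f" and "(\<lambda>n. abs_l2 (g n)) \<longlonglongrightarrow> abs_l2 f"
proof -
  show gL: "L2 (g n)" for n
    using bd[of n] by (intro L2_bound[OF g L2_integrable[OF h]]) (auto intro: power_mono)
  have bd': "AE x in lebesgue. \<forall>n. norm (g n x) \<le> norm (h x)" using bd by (simp add: AE_all_countable)
  have bf: "AE x in lebesgue. norm (f x) \<le> norm (h x)"
    using bd' lim
  proof eventually_elim
    case (elim x)
    then show ?case using LIMSEQ_le_const2[OF tendsto_norm[OF elim(2)]] by auto
  qed
  show fL: "L2 f"
    using bf by (intro L2_bound[OF f L2_integrable[OF h]]) (auto intro: power_mono)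
  have "(\<lambda>n. LINT x|lebesgue. (norm (g n x - f x))\<^sup>2) \<longlonglongrightarrow> (LINT x::'a|lebesgue. 0)"
  proof (rule integral_dominated_convergence[where w="\<lambda>x. 4 * (norm (h x))\<^sup>2"])
    show "(\<lambda>x. (norm (g n x - f x))\<^sup>2) \<in> borel_measurable lebesgue" for n
      using L2_diff[OF gL fL, THEN L2_integrable] by (rule borel_measurable_integrable)
    show "integrable lebesgue (\<lambda>x. 4 * (norm (h x))\<^sup>2)" by (intro integrable_mult_right L2_integrable h)
    show "AE x in lebesgue. (\<lambda>n. (norm (g n x - f x))\<^sup>2) \<longlonglongrightarrow> 0"
      using lim
    proof eventually_elim
      case (elim x)
      have "(\<lambda>n. (norm (g n x - f x))\<^sup>2) \<longlonglongrightarrow> (norm (f x - f x))\<^sup>2"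
        by (intro tendsto_intros elim)
      then show ?case by simp
    qed
    show "AE x in lebesgue. norm ((norm (g n x - f x))\<^sup>2) \<le> 4 * (norm (h x))\<^sup>2" for n
      using bd[of n] bf
    proof eventually_elim
      case (elim x)
      have "(norm (g n x - f x))\<^sup>2 \<le> (2 * norm (h x))\<^sup>2"
        using elim norm_triangle_ineq4[of "g n x" "f x"] by (intro power_mono) auto
      then show ?case by (simp add: power_mult_distrib)
    qed
  qed auto
  then show "(\<lambda>n. abs_l2 (g n)) \<longlonglongrightarrow> abs_l2 f"
    by (intro tendsto_l2I gL fL) simp
qed

text \<open>
  Convergence in \<open>L\<^sup>2\<close> implies convergence almost everywhere along a subsequence. It is used to identify
  an abstract \<open>L\<^sup>2\<close> limit with a pointwise one.
\<close>

lemma l2_AE_subseq: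
  assumes g: "\<And>n. L2 (g n)" and f: "L2 f" and lim: "(\<lambda>n. abs_l2 (g n)) \<longlonglongrightarrow> abs_l2 f"
  shows "\<exists>r. strict_mono (r :: nat \<Rightarrow> nat) \<and> (AE x in lebesgue. (\<lambda>n. g (r n) x) \<longlonglongrightarrow> f x)"
proof -
  have "\<exists>r. strict_mono (r :: nat \<Rightarrow> nat) \<and> (AE x in lebesgue. (\<lambda>n. (norm (g (r n) x - f x))\<^sup>2) \<longlonglongrightarrow> 0)"
  proof (rule tendsto_L1_AE_subseq)
    show "integrable lebesgue (\<lambda>x. (norm (g n x - f x))\<^sup>2)" for n
      by (intro L2_integrable L2_diff g f)
    have "(\<lambda>n. (L2_norm (\<lambda>x. g n x - f x))\<^sup>2) \<longlonglongrightarrow> 0\<^sup>2"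
      by (intro tendsto_power tendsto_l2D g f lim)
    then show "(\<lambda>n. LINT x|lebesgue. norm ((norm (g n x - f x))\<^sup>2)) \<longlonglongrightarrow> 0"
      by (simp add: L2_norm_def)
  qed
  then obtain r where r: "strict_mono (r :: nat \<Rightarrow> nat)" "AE x in lebesgue. (\<lambda>n. (norm (g (r n) x - f x))\<^sup>2) \<longlonglongrightarrow> 0"
    by blast
  from r(2) have "AE x in lebesgue. (\<lambda>n. g (r n) x) \<longlonglongrightarrow> f x"
  proof eventually_elim
    case (elim x)
    then have "(\<lambda>n. norm (g (r n) x - f x)) \<longlonglongrightarrow> 0" using tendsto_real_sqrt[OF elim] by simp
    then show ?case by (simp add: tendsto_norm_zero_iff LIM_zero_iff)
  qed
  with r(1) show ?thesis by blast
qed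

subsection \<open>Density of continuous functions\<close>

lemma L2_indicator_cball: "L2 (indicator (cball 0 R) :: 'a::euclidean_space \<Rightarrow> complex)"
proof -
  have "integrable lebesgue (indicator (cball (0::'a) R) :: 'a \<Rightarrow> real)"
    using lmeasurable_cball[of "0::'a" R] by (simp only: lmeasurable_iff_integrable)
  moreover have "(\<lambda>x. (norm (indicator (cball (0::'a) R) x :: complex))\<^sup>2) = indicator (cball 0 R)"
    by (auto simp: fun_eq_iff indicator_def)
  ultimately show ?thesis unfolding L2_def by (auto intro!: borel_measurable_indicator)
qed

lemma Cc_L2:
  assumes "Cc R f" shows "L2 f"
proof -
  note [measurable] = Cc_measurable[OF assms]
  have "(\<lambda>x. (norm (f x))\<^sup>2) \<in> borel_measurable lborel" by measurable
  then show ?thesis unfolding L2_def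
    using Cc_integrable(2)[OF assms] Cc_measurable[OF assms]
    by (simp add: integrable_completion measurable_completion)
qed

text \<open>
  A Lebesgue measurable function is a limit almost everywhere of continuous functions. Clamping these
  to the bound of \<open>f\<close> and cutting them off just outside its support makes dominated convergence
  applicable.
\<close>

lemma Cc_approx_bounded:
  fixes f :: "'a::euclidean_space \<Rightarrow> complex"
  assumes f: "f \<in> borel_measurable lebesgue" and supp: "\<And>x. R < norm x \<Longrightarrow> f x = 0"
    and bd: "\<And>x. norm (f x) \<le> K" and "K > 0"
  shows "\<exists>g. (\<forall>n. Cc (R + 1) (g n)) \<and> (\<lambda>n. abs_l2 (g n)) \<longlonglongrightarrow> abs_l2 f"
proof -
  have "f measurable_on UNIV" using f by (rule lebesgue_measurable_imp_measurable_on) simp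
  then obtain N :: "'a set" and g :: "nat \<Rightarrow> 'a \<Rightarrow> complex" where N: "negligible N"
    and gc: "\<And>n. continuous_on UNIV (g n)" and glim: "\<And>x. x \<notin> N \<Longrightarrow> (\<lambda>n. g n x) \<longlonglongrightarrow> f x"
    unfolding measurable_on_def by auto
  define cut where "cut x = max 0 (min 1 (R + 1 - norm x))" for x :: 'a
  define clamp where "clamp z = (K / max K (norm z)) *\<^sub>R z" for z :: complex
  define G where "G n x = cut x *\<^sub>R clamp (g n x)" for n x
  have cutc: "continuous_on UNIV cut" unfolding cut_def by (intro continuous_intros)
  have cc: "continuous_on UNIV clamp"
    unfolding clamp_def using \<open>K > 0\<close> by (intro continuous_intros) auto
  have norm_clamp: "norm (clamp z) \<le> K" for z
    unfolding clamp_def using \<open>K > 0\<close> by (auto simp: max_def field_simps)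
  have clamp_id: "clamp z = z" if "norm z \<le> K" for z
    using that \<open>K > 0\<close> by (simp add: clamp_def max_def)
  have cut1: "0 \<le> cut x" "cut x \<le> 1" for x by (auto simp: cut_def)
  have cut_supp: "cut x = 0" if "R + 1 < norm x" for x using that by (simp add: cut_def)
  have GC: "Cc (R + 1) (G n)" for n
    unfolding Cc_def G_def
    using continuous_on_compose[OF gc[of n], of clamp] cc continuous_on_subset[OF cc]
    by (auto intro!: continuous_intros cutc simp: cut_supp o_def)
  have "(\<lambda>n. abs_l2 (G n)) \<longlonglongrightarrow> abs_l2 f"
  proof (rule l2_dominated_convergence(3))
    show "L2 (\<lambda>x. of_real K * indicator (cball 0 (R + 1)) x :: complex)" by (intro L2_cmult L2_indicator_cball)
    show "G n \<in> borel_measurable lebesgue" for n using Cc_L2[OF GC] by (rule L2_measurable)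
    show "AE x in lebesgue. norm (G n x) \<le> norm (of_real K * indicator (cball 0 (R + 1)) x :: complex)" for n
    proof (rule AE_I2)
      fix x
      show "norm (G n x) \<le> norm (of_real K * indicator (cball 0 (R + 1)) x :: complex)"
        using norm_clamp[of "g n x"] cut1[of x] cut_supp[of x] \<open>K > 0\<close>
          mult_mono[of "cut x" 1 "norm (clamp (g n x))" K]
        by (cases "x \<in> cball 0 (R + 1)") (auto simp: G_def norm_mult)
    qed
    have "AE x in lebesgue. x \<notin> N" using N by (simp add: negligible_iff_null_sets AE_not_in)
    then show "AE x in lebesgue. (\<lambda>n. G n x) \<longlonglongrightarrow> f x"
    proof eventually_elim
      case (elim x)
      have "(\<lambda>n. G n x) \<longlonglongrightarrow> cut x *\<^sub>R clamp (f x)"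
        unfolding G_def by (intro tendsto_intros continuous_on_tendsto_compose[OF cc] glim elim) auto
      moreover have "cut x *\<^sub>R clamp (f x) = f x"
        using supp[of x] bd[of x] by (cases "R < norm x") (auto simp: clamp_id cut_def)
      ultimately show ?case by simp
    qed
  qed (fact f)
  with GC show ?thesis by blast
qed

lemma Cc_approx:
  fixes f :: "'a::euclidean_space \<Rightarrow> complex"
  assumes f: "L2 f" and supp: "\<And>x. R < norm x \<Longrightarrow> f x = 0" and "e > 0"
  shows "\<exists>g. Cc (R + 1) g \<and> dist (abs_l2 g) (abs_l2 f) < e"
proof -
  define h where "h n x = (if norm (f x) \<le> real (Suc n) then f x else 0)" for n x
  note fm [measurable] = L2_measurable[OF f]
  have hm: "h n \<in> borel_measurable lebesgue" for n unfolding h_def by measurable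
  have "(\<lambda>n. abs_l2 (h n)) \<longlonglongrightarrow> abs_l2 f"
  proof (rule l2_dominated_convergence(3)[OF hm fm f])
    show "AE x in lebesgue. norm (h n x) \<le> norm (f x)" for n by (auto simp: h_def)
    show "AE x in lebesgue. (\<lambda>n. h n x) \<longlonglongrightarrow> f x"
    proof (intro AE_I2 tendsto_eventually)
      fix x
      show "\<forall>\<^sub>F n in sequentially. h n x = f x"
        using eventually_ge_at_top[of "nat \<lceil>norm (f x)\<rceil>"]
        by eventually_elim (auto simp: h_def; linarith)
    qed
  qed
  then obtain n where n: "dist (abs_l2 (h n)) (abs_l2 f) < e / 2"
    using metric_LIMSEQ_D[of _ _ "e / 2"] \<open>e > 0\<close> by (meson half_gt_zero order_refl)
  have "\<exists>g. (\<forall>k. Cc (R + 1) (g k)) \<and> (\<lambda>k. abs_l2 (g k)) \<longlonglongrightarrow> abs_l2 (h n)"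
    by (rule Cc_approx_bounded[where K="real (Suc n)"]) (auto simp: h_def supp intro: hm)
  then obtain g where g: "\<And>k. Cc (R + 1) (g k)" "(\<lambda>k. abs_l2 (g k)) \<longlonglongrightarrow> abs_l2 (h n)" by blast
  then obtain k where "dist (abs_l2 (g k)) (abs_l2 (h n)) < e / 2"
    using metric_LIMSEQ_D[of _ _ "e / 2"] \<open>e > 0\<close> by (meson half_gt_zero order_refl)
  then have "dist (abs_l2 (g k)) (abs_l2 f) < e"
    by (rule dist_triangle_half_l[OF _ n[unfolded dist_commute[of "abs_l2 (h n)"]]])
  with g(1) show ?thesis by blast
qed

definition trunc :: "nat \<Rightarrow> ('a::euclidean_space \<Rightarrow> complex) \<Rightarrow> 'a \<Rightarrow> complex" where
  "trunc n f x = indicator (cball 0 (real n)) x * f x"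

lemma trunc_L2: "L2 f \<Longrightarrow> L2 (trunc n f)"
  unfolding trunc_def[abs_def]
  by (rule L2_bounded_mult[where B=1, OF _ borel_measurable_indicator]) (auto simp: indicator_def)

lemma trunc_supp: "real n < norm x \<Longrightarrow> trunc n f x = 0"
  by (simp add: trunc_def)

lemma trunc_tendsto:
  assumes f: "L2 f"
  shows "(\<lambda>n. abs_l2 (trunc n f)) \<longlonglongrightarrow> abs_l2 f"
proof (rule l2_dominated_convergence(3)[OF _ _ f])
  show "trunc n f \<in> borel_measurable lebesgue" for n by (intro L2_measurable trunc_L2 f)
  show "f \<in> borel_measurable lebesgue" by (intro L2_measurable f)
  show "AE x in lebesgue. norm (trunc n f x) \<le> norm (f x)" for n
    by (auto simp: trunc_def norm_mult indicator_def)
  show "AE x in lebesgue. (\<lambda>n. trunc n f x) \<longlonglongrightarrow> f x"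
  proof (intro AE_I2 tendsto_eventually)
    fix x
    show "\<forall>\<^sub>F n in sequentially. trunc n f x = f x"
      using eventually_ge_at_top[of "nat \<lceil>norm x\<rceil>"]
      by eventually_elim (auto simp: trunc_def indicator_def; linarith)
  qed
qed

lemma Cc_dense:
  fixes x :: "'a::euclidean_space l2"
  assumes "e > 0"
  shows "\<exists>R g. Cc R g \<and> dist (abs_l2 g) x < e"
proof -
  obtain n where n: "dist (abs_l2 (trunc n (rep_l2 x))) x < e / 2"
    using metric_LIMSEQ_D[OF trunc_tendsto[OF L2_rep, of x], of "e / 2"] \<open>e > 0\<close>
    by (metis abs_rep_l2 half_gt_zero order_refl)
  obtain g where "Cc (real n + 1) g" "dist (abs_l2 g) (abs_l2 (trunc n (rep_l2 x))) < e / 2"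
    using Cc_approx[OF trunc_L2[OF L2_rep], of "real n" n x "e / 2"] trunc_supp \<open>e > 0\<close> by auto
  moreover from this(2) have "dist (abs_l2 g) x < e"
    by (rule dist_triangle_half_l[OF _ n[unfolded dist_commute[of _ x]]])
  ultimately show ?thesis by blast
qed

lemma Cc_dense_eq:
  fixes \<phi> \<psi> :: "'a::euclidean_space l2 \<Rightarrow> 'b::t2_space"
  assumes "continuous_on UNIV \<phi>" "continuous_on UNIV \<psi>" "\<And>R g. Cc R g \<Longrightarrow> \<phi> (abs_l2 g) = \<psi> (abs_l2 g)"
  shows "\<phi> x = \<psi> x"
proof -
  have "closed {x. \<phi> x = \<psi> x}" using assms(1,2) by (rule closed_Collect_eq)
  moreover have "x \<in> closure {x. \<phi> x = \<psi> x}"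
    unfolding closure_approachable using Cc_dense[of _ x] assms(3) by blast
  ultimately show ?thesis by simp
qed

subsection \<open>The Fourier integral of functions of bounded support\<close>

lemma fourier_L1_unnorm:
  fixes f :: "'a::euclidean_space \<Rightarrow> complex"
  assumes "f \<in> borel_measurable borel"
  shows "fourier_L1 f \<xi> = of_real ((2 * pi) powr (- real DIM('a) / 2)) * fourier_unnorm f \<xi>"
proof -
  note [measurable] = assms
  have "(\<lambda>x. iexp (- (x \<bullet> \<xi>)) * f x) \<in> borel_measurable lborel" by measurable
  from integral_completion[OF this] show ?thesis
    unfolding fourier_L1_def fourier_unnorm_def by simp
qed

lemma Plancherel_Cc_L2:
  fixes f :: "'a::euclidean_space \<Rightarrow> complex"
  assumes f: "Cc R f"
  shows "L2 (fourier_L1 f)" "L2_norm (fourier_L1 f) = L2_norm f"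
proof -
  let ?c = "(2 * pi) powr (- real DIM('a) / 2)"
  have [measurable]: "fourier_unnorm f \<in> borel_measurable borel"
    by (intro borel_measurable_continuous_onI fourier_unnorm_continuous Cc_integrable[OF f])
  note [measurable] = Cc_measurable[OF f]
  have eq: "fourier_L1 f = (\<lambda>\<xi>. of_real ?c * fourier_unnorm f \<xi>)"
    using fourier_L1_unnorm[OF Cc_measurable[OF f]] by auto
  have c2: "?c\<^sup>2 * (2 * pi) ^ DIM('a) = 1"
  proof -
    have "(2 * pi) ^ DIM('a) = (2 * pi) powr real DIM('a)" by (simp add: powr_realpow)
    then show ?thesis by (simp only: power2_eq_square powr_add[symmetric]) simp
  qed
  have m: "(\<lambda>\<xi>. (norm (fourier_unnorm f \<xi>))\<^sup>2) \<in> borel_measurable lborel"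
    "(\<lambda>x. (norm (f x))\<^sup>2) \<in> borel_measurable lborel" by measurable
  have "L2 (fourier_unnorm f)"
    unfolding L2_def using Plancherel_Cc(1)[OF f]
    by (auto simp: integrable_completion[OF m(1)] measurable_completion)
  then show "L2 (fourier_L1 f)" unfolding eq by (rule L2_cmult)
  have "(LINT \<xi>|lebesgue. (norm (fourier_L1 f \<xi>))\<^sup>2) = ?c\<^sup>2 * (LINT \<xi>|lebesgue. (norm (fourier_unnorm f \<xi>))\<^sup>2)"
    unfolding eq by (simp add: norm_mult power_mult_distrib)
  also have "\<dots> = ?c\<^sup>2 * (2 * pi) ^ DIM('a) * (LINT x|lborel. (norm (f x))\<^sup>2)"
    by (simp add: integral_completion[OF m(1)] Plancherel_Cc(2)[OF f])
  also have "\<dots> = (LINT x|lebesgue. (norm (f x))\<^sup>2)"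
    unfolding c2 by (simp add: integral_completion[OF m(2)])
  finally show "L2_norm (fourier_L1 f) = L2_norm f" by (simp add: L2_norm_def)
qed

text \<open>
  By the Cauchy--Schwarz inequality against the indicator function of the ball, on functions of
  common bounded support \<open>L\<^sup>2\<close> convergence implies \<open>L\<^sup>1\<close> convergence.
\<close>

lemma bounded_support_integrable:
  fixes f :: "'a::euclidean_space \<Rightarrow> complex"
  assumes f: "L2 f" and supp: "\<And>x. R < norm x \<Longrightarrow> f x = 0"
  shows "integrable lebesgue f"
    and "(LINT x|lebesgue. norm (f x)) \<le> L2_norm (indicator (cball (0::'a) R)) * L2_norm f"
proof -
  let ?I = "indicator (cball 0 R) :: 'a \<Rightarrow> complex"
  have eq: "?I x * f x = f x" for x using supp[of x] by (auto simp: indicator_def)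
  show "integrable lebesgue f"
    using L2_integrable_mult[OF L2_indicator_cball f, of R] by (simp add: eq)
  have n: "L2 (\<lambda>x. of_real (norm (f x)))"
    using f by (auto simp: L2_def)
  have "(LINT x|lebesgue. norm (f x)) = inner (abs_l2 ?I) (abs_l2 (\<lambda>x. of_real (norm (f x))))"
    using supp by (subst inner_l2.abs_eq) (auto simp: n L2_indicator_cball indicator_def inner_complex_def intro!: Bochner_Integration.integral_cong)
  also have "\<dots> \<le> norm (abs_l2 ?I) * norm (abs_l2 (\<lambda>x. complex_of_real (norm (f x))))"
    by (rule norm_cauchy_schwarz)
  also have "\<dots> = L2_norm ?I * L2_norm f"
    by (simp add: norm_abs_l2 n L2_indicator_cball) (simp add: L2_norm_def)
  finally show "(LINT x|lebesgue. norm (f x)) \<le> L2_norm (indicator (cball (0::'a) R)) * L2_norm f" .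
qed

lemma integrable_fourier_kernel:
  assumes "integrable lebesgue f"
  shows "integrable lebesgue (\<lambda>x. exp (- \<i> * of_real (x \<bullet> \<xi>)) * f x)"
proof (rule Bochner_Integration.integrable_bound[OF assms])
  have "(\<lambda>x. exp (- \<i> * of_real (x \<bullet> \<xi>))) \<in> borel_measurable borel"
    by (intro borel_measurable_continuous_onI continuous_intros)
  then show "(\<lambda>x. exp (- \<i> * of_real (x \<bullet> \<xi>)) * f x) \<in> borel_measurable lebesgue"
    by (intro borel_measurable_times borel_measurable_integrable[OF assms] measurable_completion) simp
  have "norm (exp (- \<i> * of_real r)) = 1" for r
    using norm_iexp[of "- r"] by simp
  then show "AE x in lebesgue. norm (exp (- \<i> * of_real (x \<bullet> \<xi>)) * f x) \<le> norm (f x)"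
    by (simp add: norm_mult)
qed

lemma fourier_L1_add:
  "integrable lebesgue f \<Longrightarrow> integrable lebesgue g \<Longrightarrow>
    fourier_L1 (\<lambda>x. f x + g x) \<xi> = fourier_L1 f \<xi> + fourier_L1 g \<xi>"
  using integrable_fourier_kernel[of f \<xi>] integrable_fourier_kernel[of g \<xi>]
  by (simp add: fourier_L1_def distrib_left)

lemma fourier_L1_cmult: "fourier_L1 (\<lambda>x. c * f x) \<xi> = c * fourier_L1 f \<xi>"
  unfolding fourier_L1_def by (simp add: mult.left_commute flip: integral_mult_right_zero)

lemma fourier_L1_diff:
  assumes "integrable lebesgue f" "integrable lebesgue g"
  shows "fourier_L1 (\<lambda>x. f x - g x) \<xi> = fourier_L1 f \<xi> - fourier_L1 g \<xi>"
  using fourier_L1_add[of f "\<lambda>x. -1 * g x" \<xi>] fourier_L1_cmult[of "-1" g \<xi>] assms by simp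

lemma fourier_L1_bound:
  fixes f :: "'a::euclidean_space \<Rightarrow> complex"
  shows "norm (fourier_L1 f \<xi>) \<le> (2 * pi) powr (- real DIM('a) / 2) * (LINT x|lebesgue. norm (f x))"
proof -
  have n: "norm (exp (- \<i> * of_real r)) = 1" for r
    using norm_iexp[of "- r"] by simp
  have "norm (LINT x|lebesgue. exp (- \<i> * complex_of_real (x \<bullet> \<xi>)) * f x) \<le> (LINT x|lebesgue. norm (f x))"
    using integral_norm_bound[of lebesgue "\<lambda>x. exp (- \<i> * complex_of_real (x \<bullet> \<xi>)) * f x"]
    unfolding norm_mult n by simp
  then show ?thesis unfolding fourier_L1_def norm_mult by (simp add: mult_left_mono)
qed

text \<open>
  Approximate \<open>f\<close> by continuous functions with a common bounded support. Their transforms converge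
  pointwise, because there is convergence in \<open>L\<^sup>1\<close>, and they are Cauchy in \<open>L\<^sup>2\<close> by Plancherel's identity
  for differences; the two limits agree almost everywhere.
\<close>

lemma Plancherel_bounded_support:
  fixes f :: "'a::euclidean_space \<Rightarrow> complex"
  assumes f: "L2 f" and supp: "\<And>x. R < norm x \<Longrightarrow> f x = 0"
  shows "L2 (fourier_L1 f)" and "L2_norm (fourier_L1 f) = L2_norm f"
proof -
  have "\<exists>g. Cc (R + 1) g \<and> dist (abs_l2 g) (abs_l2 f) < inverse (real (Suc n))" for n
    by (rule Cc_approx[OF f supp]) auto
  then obtain g where g: "\<And>n. Cc (R + 1) (g n)" "\<And>n. dist (abs_l2 (g n)) (abs_l2 f) < inverse (real (Suc n))"
    by metis
  have gL: "L2 (g n)" for n using g(1) by (rule Cc_L2)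
  have lim: "(\<lambda>n. abs_l2 (g n)) \<longlonglongrightarrow> abs_l2 f"
    by (rule tendsto_dist_iff[THEN iffD2], rule tendsto_sandwich[OF _ _ tendsto_const LIMSEQ_inverse_real_of_nat])
      (use g(2) in \<open>auto intro: less_imp_le always_eventually\<close>)
  have supp': "f x = 0" if "R + 1 < norm x" for x using supp that by simp
  have gsupp: "g n x = 0" if "R + 1 < norm x" for n x using g(1)[of n] that by (simp add: Cc_def)
  note fi = bounded_support_integrable(1)[OF f supp'] and gi = bounded_support_integrable(1)[OF gL gsupp]
  have "norm (abs_l2 (fourier_L1 (g n)) - abs_l2 (fourier_L1 (g m))) = norm (abs_l2 (g n) - abs_l2 (g m))" for n m
  proof -
    have d: "fourier_L1 (\<lambda>x. g n x - g m x) = (\<lambda>\<xi>. fourier_L1 (g n) \<xi> - fourier_L1 (g m) \<xi>)"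
      using fourier_L1_diff[OF gi gi] by auto
    show ?thesis
      using Plancherel_Cc_L2(2)[OF Cc_diff[OF g(1) g(1)], of n m] unfolding d
      by (simp add: minus_l2.abs_eq norm_abs_l2 gL Plancherel_Cc_L2(1)[OF g(1)])
  qed
  then have "Cauchy (\<lambda>n. abs_l2 (fourier_L1 (g n)))"
    using LIMSEQ_imp_Cauchy[OF lim] by (simp add: Cauchy_def dist_norm)
  then obtain y where y: "(\<lambda>n. abs_l2 (fourier_L1 (g n))) \<longlonglongrightarrow> y"
    using Cauchy_convergent convergent_def by blast
  obtain r :: "nat \<Rightarrow> nat" where r: "strict_mono r" "AE \<xi> in lebesgue. (\<lambda>n. fourier_L1 (g (r n)) \<xi>) \<longlonglongrightarrow> rep_l2 y \<xi>"
    using l2_AE_subseq[of "\<lambda>n. fourier_L1 (g n)" "rep_l2 y"] Plancherel_Cc_L2(1)[OF g(1)] y by auto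
  have pw: "(\<lambda>n. fourier_L1 (g n) \<xi>) \<longlonglongrightarrow> fourier_L1 f \<xi>" for \<xi>
  proof -
    let ?C = "(2 * pi) powr (- real DIM('a) / 2) * L2_norm (indicator (cball (0::'a) (R + 1)))"
    have "(\<lambda>n. fourier_L1 (g n) \<xi> - fourier_L1 f \<xi>) \<longlonglongrightarrow> 0"
    proof (rule Lim_null_comparison)
      show "\<forall>\<^sub>F n in sequentially. norm (fourier_L1 (g n) \<xi> - fourier_L1 f \<xi>) \<le> ?C * L2_norm (\<lambda>x. g n x - f x)"
      proof (rule always_eventually, rule allI)
        fix n
        have "norm (fourier_L1 (g n) \<xi> - fourier_L1 f \<xi>) = norm (fourier_L1 (\<lambda>x. g n x - f x) \<xi>)"
          by (simp add: fourier_L1_diff[OF gi fi])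
        also have "\<dots> \<le> (2 * pi) powr (- real DIM('a) / 2) * (LINT x|lebesgue. norm (g n x - f x))"
          by (rule fourier_L1_bound)
        also have "\<dots> \<le> (2 * pi) powr (- real DIM('a) / 2) * (L2_norm (indicator (cball (0::'a) (R + 1))) * L2_norm (\<lambda>x. g n x - f x))"
          using gsupp supp' by (intro mult_left_mono bounded_support_integrable(2) L2_diff gL f) auto
        finally show "norm (fourier_L1 (g n) \<xi> - fourier_L1 f \<xi>) \<le> ?C * L2_norm (\<lambda>x. g n x - f x)"
          by (simp add: mult.assoc)
      qed
      show "(\<lambda>n. ?C * L2_norm (\<lambda>x. g n x - f x)) \<longlonglongrightarrow> 0"
        by (rule tendsto_mult_right_zero[OF tendsto_l2D[OF gL f lim]])
    qed
    then show ?thesis by (simp add: LIM_zero_iff)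
  qed
  have ae: "AE \<xi> in lebesgue. rep_l2 y \<xi> = fourier_L1 f \<xi>"
    using r(2)
  proof eventually_elim
    case (elim \<xi>)
    then show ?case using LIMSEQ_subseq_LIMSEQ[OF pw[of \<xi>] r(1)] by (auto simp: o_def intro: LIMSEQ_unique)
  qed
  show L: "L2 (fourier_L1 f)" by (rule L2_cong_AE[OF L2_rep ae])
  have "y = abs_l2 (fourier_L1 f)"
    using abs_l2_eq_iff[OF L2_rep L, of y] ae by simp
  then have "norm y = L2_norm (fourier_L1 f)" by (simp add: norm_abs_l2 L)
  moreover have "(\<lambda>n. norm (abs_l2 (fourier_L1 (g n)))) \<longlonglongrightarrow> norm y" by (intro tendsto_norm y)
  moreover have "norm (abs_l2 (fourier_L1 (g n))) = norm (abs_l2 (g n))" for n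
    by (simp add: norm_abs_l2 gL Plancherel_Cc_L2[OF g(1)])
  moreover have "(\<lambda>n. norm (abs_l2 (g n))) \<longlonglongrightarrow> L2_norm f"
    using tendsto_norm[OF lim] by (simp add: norm_abs_l2 f)
  ultimately show "L2_norm (fourier_L1 f) = L2_norm f" by (auto intro: LIMSEQ_unique)
qed

subsection \<open>The Fourier transform on square integrable functions\<close>

lemma fourier_trunc:
  assumes "L2 f"
  shows "L2 (fourier_L1 (trunc n f))" "integrable lebesgue (trunc n f)"
  using Plancherel_bounded_support(1)[OF trunc_L2[OF assms] trunc_supp]
    bounded_support_integrable(1)[OF trunc_L2[OF assms] trunc_supp] by blast+

lemma fourier_trunc_Cauchy:
  assumes f: "L2 f"
  shows "Cauchy (\<lambda>n. abs_l2 (fourier_L1 (trunc n f)))"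
proof -
  have "norm (abs_l2 (fourier_L1 (trunc n f)) - abs_l2 (fourier_L1 (trunc m f))) = norm (abs_l2 (trunc n f) - abs_l2 (trunc m f))" for n m
  proof -
    have d: "fourier_L1 (\<lambda>x. trunc n f x - trunc m f x) = (\<lambda>\<xi>. fourier_L1 (trunc n f) \<xi> - fourier_L1 (trunc m f) \<xi>)"
      using fourier_L1_diff[OF fourier_trunc(2)[OF f] fourier_trunc(2)[OF f]] by auto
    have "L2_norm (fourier_L1 (\<lambda>x. trunc n f x - trunc m f x)) = L2_norm (\<lambda>x. trunc n f x - trunc m f x)"
      by (rule Plancherel_bounded_support(2)[where R="real (max n m)"])
        (auto intro!: L2_diff trunc_L2 f simp: trunc_supp)
    then show ?thesis unfolding d
      by (simp add: minus_l2.abs_eq norm_abs_l2 fourier_trunc f trunc_L2)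
  qed
  then show ?thesis
    using LIMSEQ_imp_Cauchy[OF trunc_tendsto[OF f]] by (simp add: Cauchy_def dist_norm)
qed

lemma is_fourier_L2_iff:
  assumes "L2 f"
  shows "is_fourier_L2 f g \<longleftrightarrow> L2 g \<and> (\<lambda>n. abs_l2 (fourier_L1 (trunc n f))) \<longlonglongrightarrow> abs_l2 g"
proof -
  have t: "trunc n f = (\<lambda>x. indicator (cball 0 (real n)) x * f x)" for n
    by (simp add: fun_eq_iff trunc_def)
  have "is_fourier_L2 f g \<longleftrightarrow> L2 g \<and> (\<lambda>n. L2_norm (\<lambda>\<xi>. fourier_L1 (trunc n f) \<xi> - g \<xi>)) \<longlonglongrightarrow> 0"
    using fourier_trunc(1)[OF assms] assms unfolding is_fourier_L2_def t by auto
  moreover have "L2_norm (\<lambda>\<xi>. fourier_L1 (trunc n f) \<xi> - g \<xi>) = dist (abs_l2 (fourier_L1 (trunc n f))) (abs_l2 g)" if "L2 g" for n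
    using that assms by (simp add: dist_norm minus_l2.abs_eq norm_abs_l2 fourier_trunc)
  ultimately show ?thesis
    using tendsto_dist_iff[of "\<lambda>n. abs_l2 (fourier_L1 (trunc n f))" "abs_l2 g" sequentially] by auto
qed

text \<open>
  The transforms of the truncations converge, so the choice operator defining \<open>fourier_L2\<close> picks an
  actual \<open>L\<^sup>2\<close> Fourier transform.
\<close>

lemma is_fourier_L2_fourier:
  assumes "L2 f" shows "is_fourier_L2 f (fourier_L2 f)"
proof -
  obtain y where "(\<lambda>n. abs_l2 (fourier_L1 (trunc n f))) \<longlonglongrightarrow> y"
    using Cauchy_convergent[OF fourier_trunc_Cauchy[OF assms]] convergent_def by blast
  then have "is_fourier_L2 f (rep_l2 y)" by (simp add: is_fourier_L2_iff assms)
  then show ?thesis unfolding fourier_L2_def by (rule someI[where P="is_fourier_L2 f"])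
qed

lemma fourier_L2_L2: "L2 f \<Longrightarrow> L2 (fourier_L2 f)"
  using is_fourier_L2_fourier is_fourier_L2_def by blast

definition FT :: "'a::euclidean_space l2 \<Rightarrow> 'a l2" where
  "FT x = abs_l2 (fourier_L2 (rep_l2 x))"

lemma fourier_trunc_tendsto:
  "L2 f \<Longrightarrow> (\<lambda>n. abs_l2 (fourier_L1 (trunc n f))) \<longlonglongrightarrow> abs_l2 (fourier_L2 f)"
  using is_fourier_L2_fourier is_fourier_L2_iff by blast

lemma fourier_L1_cong_AE:
  fixes f g :: "'a::euclidean_space \<Rightarrow> complex"
  assumes "AE x in lebesgue. f x = g x" "f \<in> borel_measurable lebesgue"
  shows "fourier_L1 f = fourier_L1 g"
proof
  fix \<xi> :: 'a
  have "(\<lambda>x. exp (- \<i> * of_real (x \<bullet> \<xi>))) \<in> borel_measurable borel"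
    by (intro borel_measurable_continuous_onI continuous_intros)
  then have m: "(\<lambda>x. exp (- \<i> * of_real (x \<bullet> \<xi>)) * h x) \<in> borel_measurable lebesgue"
    if "h \<in> borel_measurable lebesgue" for h :: "'a \<Rightarrow> complex"
    by (intro borel_measurable_times measurable_completion that) simp
  have "(LINT x|lebesgue. exp (- \<i> * of_real (x \<bullet> \<xi>)) * f x) = (LINT x|lebesgue. exp (- \<i> * of_real (x \<bullet> \<xi>)) * g x)"
    using assms by (intro integral_cong_AE m lebesgue_measurable_cong_AE[OF assms(2,1)]) auto
  then show "fourier_L1 f \<xi> = fourier_L1 g \<xi>" by (simp add: fourier_L1_def)
qed

lemma FT_abs: assumes f: "L2 f" shows "FT (abs_l2 f) = abs_l2 (fourier_L2 f)"
proof -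
  have "fourier_L1 (trunc n (rep_l2 (abs_l2 f))) = fourier_L1 (trunc n f)" for n
    using rep_abs_l2[OF f]
    by (intro fourier_L1_cong_AE L2_measurable trunc_L2 L2_rep) (auto simp: trunc_def elim: eventually_mono)
  then show ?thesis
    using fourier_trunc_tendsto[OF f] fourier_trunc_tendsto[OF L2_rep, of "abs_l2 f"]
    unfolding FT_def by (auto intro: LIMSEQ_unique)
qed

lemma FT_tendsto: "L2 f \<Longrightarrow> (\<lambda>n. abs_l2 (fourier_L1 (trunc n f))) \<longlonglongrightarrow> FT (abs_l2 f)"
  by (simp add: FT_abs fourier_trunc_tendsto)

lemma FT_bounded_support:
  assumes f: "L2 f" and supp: "\<And>x. R < norm x \<Longrightarrow> f x = 0"
  shows "FT (abs_l2 f) = abs_l2 (fourier_L1 f)"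
proof -
  have "(\<lambda>n. abs_l2 (fourier_L1 (trunc n f))) \<longlonglongrightarrow> abs_l2 (fourier_L1 f)"
  proof (rule tendsto_eventually)
    show "\<forall>\<^sub>F n in sequentially. abs_l2 (fourier_L1 (trunc n f)) = abs_l2 (fourier_L1 f)"
      using eventually_ge_at_top[of "nat \<lceil>R\<rceil>"]
    proof eventually_elim
      case (elim n)
      have "trunc n f x = f x" for x
        using supp[of x] elim by (cases "norm x \<le> real n") (auto simp: trunc_def; linarith)+
      then have "trunc n f = f" by auto
      then show ?case by simp
    qed
  qed
  then show ?thesis using FT_tendsto[OF f] by (auto intro: LIMSEQ_unique)
qed

lift_definition cscale :: "complex \<Rightarrow> 'a::euclidean_space l2 \<Rightarrow> 'a l2" is "\<lambda>c f x. c * f x"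
  unfolding l2_rel_def by (auto elim: eventually_mono)

lift_definition cconj :: "'a::euclidean_space l2 \<Rightarrow> 'a l2" is "\<lambda>f x. cnj (f x)"
  unfolding l2_rel_def by (auto elim: eventually_mono)

lemma FT_add: "FT (x + y) = FT x + FT y"
proof -
  let ?f = "rep_l2 x" and ?g = "rep_l2 y"
  have s: "x + y = abs_l2 (\<lambda>z. ?f z + ?g z)"
    using plus_l2.abs_eq[of ?f ?g] by simp
  have "trunc n (\<lambda>z. ?f z + ?g z) = (\<lambda>z. trunc n ?f z + trunc n ?g z)" for n
    by (simp add: fun_eq_iff trunc_def distrib_left)
  then have "fourier_L1 (trunc n (\<lambda>z. ?f z + ?g z)) = (\<lambda>\<xi>. fourier_L1 (trunc n ?f) \<xi> + fourier_L1 (trunc n ?g) \<xi>)" for n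
    by (intro ext) (simp add: fourier_L1_add fourier_trunc(2))
  then have "abs_l2 (fourier_L1 (trunc n (\<lambda>z. ?f z + ?g z))) = abs_l2 (fourier_L1 (trunc n ?f)) + abs_l2 (fourier_L1 (trunc n ?g))" for n
    by (simp add: plus_l2.abs_eq fourier_trunc)
  then have "(\<lambda>n. abs_l2 (fourier_L1 (trunc n (\<lambda>z. ?f z + ?g z)))) \<longlonglongrightarrow> FT x + FT y"
    using tendsto_add[OF FT_tendsto[OF L2_rep, of x] FT_tendsto[OF L2_rep, of y]] by simp
  moreover have "(\<lambda>n. abs_l2 (fourier_L1 (trunc n (\<lambda>z. ?f z + ?g z)))) \<longlonglongrightarrow> FT (x + y)"
    unfolding s by (rule FT_tendsto) simp
  ultimately show ?thesis by (rule LIMSEQ_unique[symmetric])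
qed

lemma norm_cscale: "norm (cscale c x) = norm c * norm x"
proof -
  have "cscale c x = abs_l2 (\<lambda>z. c * rep_l2 x z)"
    using cscale.abs_eq[of "rep_l2 x" c] by simp
  then have "norm (cscale c x) = sqrt (LINT z|lebesgue. (norm c)\<^sup>2 * (norm (rep_l2 x z))\<^sup>2)"
    by (simp add: norm_abs_l2 L2_norm_def norm_mult power_mult_distrib)
  also have "\<dots> = norm c * L2_norm (rep_l2 x)"
    by (simp add: L2_norm_def real_sqrt_mult)
  finally show ?thesis by (simp add: L2_norm_rep)
qed

lemma cscale_linear: "bounded_linear (cscale c)"
proof (rule bounded_linear_intro)
  show "cscale c (x + y) = cscale c x + cscale c y" for x y
    by transfer (simp add: distrib_left)
  show "cscale c (r *\<^sub>R x) = r *\<^sub>R cscale c x" for r x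
    by transfer simp
  show "norm (cscale c x) \<le> norm x * norm c" for x by (simp add: norm_cscale)
qed

lemma scaleR_eq_cscale: "r *\<^sub>R x = cscale (of_real r) x"
  by transfer (simp add: scaleR_conv_of_real)

lemma FT_cscale: "FT (cscale c x) = cscale c (FT x)"
proof -
  let ?f = "rep_l2 x"
  have s: "cscale c x = abs_l2 (\<lambda>z. c * ?f z)"
    using cscale.abs_eq[of ?f c] by simp
  have "trunc n (\<lambda>z. c * ?f z) = (\<lambda>z. c * trunc n ?f z)" for n
    by (simp add: fun_eq_iff trunc_def)
  then have "fourier_L1 (trunc n (\<lambda>z. c * ?f z)) = (\<lambda>\<xi>. c * fourier_L1 (trunc n ?f) \<xi>)" for n
    by (auto simp: fourier_L1_cmult)
  then have "abs_l2 (fourier_L1 (trunc n (\<lambda>z. c * ?f z))) = cscale c (abs_l2 (fourier_L1 (trunc n ?f)))" for n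
    by (simp add: cscale.abs_eq fourier_trunc)
  then have "(\<lambda>n. abs_l2 (fourier_L1 (trunc n (\<lambda>z. c * ?f z)))) \<longlonglongrightarrow> cscale c (FT x)"
    using bounded_linear.tendsto[OF cscale_linear FT_tendsto[OF L2_rep, of x], of c] by simp
  moreover have "(\<lambda>n. abs_l2 (fourier_L1 (trunc n (\<lambda>z. c * ?f z)))) \<longlonglongrightarrow> FT (cscale c x)"
    unfolding s by (rule FT_tendsto) simp
  ultimately show ?thesis by (rule LIMSEQ_unique[symmetric])
qed

lemma norm_FT [simp]: "norm (FT x) = norm x"
proof -
  have "norm (abs_l2 (fourier_L1 (trunc n (rep_l2 x)))) = norm (abs_l2 (trunc n (rep_l2 x)))" for n
    using Plancherel_bounded_support(2)[OF trunc_L2[OF L2_rep] trunc_supp]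
    by (simp add: norm_abs_l2 fourier_trunc trunc_L2)
  then show ?thesis
    using tendsto_norm[OF FT_tendsto[OF L2_rep, of x]] tendsto_norm[OF trunc_tendsto[OF L2_rep, of x]]
    by (auto intro: LIMSEQ_unique)
qed

lemma FT_linear: "bounded_linear FT"
proof (rule bounded_linear_intro)
  show "FT (r *\<^sub>R x) = r *\<^sub>R FT x" for r x by (simp only: scaleR_eq_cscale FT_cscale)
  show "norm (FT x) \<le> norm x * 1" for x by simp
qed (rule FT_add)


lemma isometry_inner:
  fixes F :: "'h::real_inner \<Rightarrow> 'k::real_inner"
  assumes "linear F" "\<And>x. norm (F x) = norm x"
  shows "inner (F x) (F y) = inner x y"
  using assms(2)[of "x + y"] by (simp add: dot_norm linear_add[OF assms(1)] assms(2))

lemma inner_FT: "inner (FT x) (FT y) = inner x y"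
  by (rule isometry_inner[OF bounded_linear.linear[OF FT_linear] norm_FT])

lemma cconj_cconj [simp]: "cconj (cconj x) = x"
  by transfer (simp add: l2_rel_def)

lemma inner_cconj: "inner (cconj x) (cconj y) = inner x y"
  by transfer (simp add: inner_complex_def)

lemma norm_cconj [simp]: "norm (cconj x) = norm x"
  by (simp add: norm_eq_sqrt_inner inner_cconj)

lemma cconj_linear: "bounded_linear cconj"
proof (rule bounded_linear_intro)
  show "cconj (x + y) = cconj x + cconj y" for x y :: "'a::euclidean_space l2" by transfer simp
  show "cconj (r *\<^sub>R x) = r *\<^sub>R cconj x" for r and x :: "'a::euclidean_space l2"
    by transfer (simp add: scaleR_conv_of_real)
  show "norm (cconj x) \<le> norm x * 1" for x :: "'a::euclidean_space l2" by simp
qed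


lemma inner_abs_l2_lborel:
  assumes f: "L2 f" "f \<in> borel_measurable borel" and g: "L2 g" "g \<in> borel_measurable borel"
  shows "inner (abs_l2 f) (cconj (abs_l2 g)) = Re (LINT x|lborel. f x * g x)"
proof -
  have m: "(\<lambda>x. f x * g x) \<in> borel_measurable lborel" using f(2) g(2) by simp
  have "inner (abs_l2 f) (cconj (abs_l2 g)) = (LINT x|lebesgue. inner (f x) (cnj (g x)))"
    using f g by (simp add: cconj.abs_eq inner_l2.abs_eq)
  also have "\<dots> = Re (LINT x|lebesgue. f x * g x)"
    unfolding complex_inner_eq complex_cnj_cnj by (rule integral_Re[OF L2_integrable_mult[OF f(1) g(1)]])
  finally show "inner (abs_l2 f) (cconj (abs_l2 g)) = Re (LINT x|lborel. f x * g x)"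
    by (simp add: integral_completion[OF m])
qed

text \<open>
  The multiplication formula on \<open>L\<^sup>2\<close>, extended from continuous functions of compact support by density
  in each argument.
\<close>

lemma inner_FT_cconj: "inner (FT x) (cconj y) = inner x (cconj (FT y))"
proof -
  have Cc: "inner (FT (abs_l2 f)) (cconj (abs_l2 g)) = inner (abs_l2 f) (cconj (FT (abs_l2 g)))"
    if f: "Cc R f" and g: "Cc S g" for f g :: "'a \<Rightarrow> complex" and R S
  proof -
    let ?c = "complex_of_real ((2 * pi) powr (- real DIM('a) / 2))"
    have L1: "fourier_L1 h = (\<lambda>\<xi>. ?c * fourier_unnorm h \<xi>)" and Lm: "fourier_L1 h \<in> borel_measurable borel"
      and LF: "FT (abs_l2 h) = abs_l2 (fourier_L1 h)" if h: "Cc r h" for h :: "'a \<Rightarrow> complex" and r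
    proof -
      show e: "fourier_L1 h = (\<lambda>\<xi>. ?c * fourier_unnorm h \<xi>)"
        using fourier_L1_unnorm[OF Cc_measurable[OF h]] by auto
      show "fourier_L1 h \<in> borel_measurable borel" unfolding e
        by (intro borel_measurable_continuous_onI continuous_intros fourier_unnorm_continuous Cc_integrable[OF h])
      show "FT (abs_l2 h) = abs_l2 (fourier_L1 h)"
        by (rule FT_bounded_support[OF Cc_L2[OF h], of r]) (use h in \<open>auto simp: Cc_def\<close>)
    qed
    have "inner (FT (abs_l2 f)) (cconj (abs_l2 g)) = Re (LINT x|lborel. fourier_L1 f x * g x)"
      unfolding LF[OF f]
      by (intro inner_abs_l2_lborel Plancherel_Cc_L2[OF f] Lm[OF f] Cc_L2[OF g] Cc_measurable[OF g])
    also have "(LINT x|lborel. fourier_L1 f x * g x) = (LINT x|lborel. f x * fourier_L1 g x)"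
      unfolding L1[OF f] L1[OF g]
      using fourier_multiplication_formula[OF Cc_integrable(1)[OF f] Cc_integrable(1)[OF g]]
      unfolding mult.assoc mult.left_commute[of _ ?c] by (simp only: integral_mult_right_zero)
    also have "Re \<dots> = inner (abs_l2 f) (cconj (FT (abs_l2 g)))"
      unfolding LF[OF g]
      by (intro inner_abs_l2_lborel[symmetric] Plancherel_Cc_L2[OF g] Lm[OF g] Cc_L2[OF f] Cc_measurable[OF f])
    finally show ?thesis .
  qed
  note cont = continuous_on_inner bounded_linear.continuous_on[OF FT_linear]
    bounded_linear.continuous_on[OF cconj_linear] continuous_on_const continuous_on_id
  have "inner (FT x) (cconj (abs_l2 g)) = inner x (cconj (FT (abs_l2 g)))" if g: "Cc S g" for S g
  proof (rule Cc_dense_eq[where x=x and \<phi>="\<lambda>x. inner (FT x) (cconj (abs_l2 g))"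
        and \<psi>="\<lambda>x. inner x (cconj (FT (abs_l2 g)))"])
    show "inner (FT (abs_l2 f)) (cconj (abs_l2 g)) = inner (abs_l2 f) (cconj (FT (abs_l2 g)))"
      if "Cc R f" for R f using that g by (rule Cc)
  qed (intro cont)+
  note Cc' = this
  show ?thesis
  proof (rule Cc_dense_eq[where x=y and \<phi>="\<lambda>y. inner (FT x) (cconj y)"
        and \<psi>="\<lambda>y. inner x (cconj (FT y))"])
    show "inner (FT x) (cconj (abs_l2 g)) = inner x (cconj (FT (abs_l2 g)))"
      if "Cc S g" for S g using that by (rule Cc')
  qed (intro cont)+
qed

text \<open>
  The inverse Fourier transform. By the multiplication formula this is the adjoint of \<open>FT\<close>; it is visibly
  an isometry, and two mutually adjoint isometries are inverse to each other.
\<close>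

definition FTi :: "'a::euclidean_space l2 \<Rightarrow> 'a l2" where "FTi x = cconj (FT (cconj x))"

lemma FTi_linear: "bounded_linear FTi"
  unfolding FTi_def by (intro bounded_linear_compose[OF cconj_linear] bounded_linear_compose[OF FT_linear] cconj_linear)

lemma norm_FTi [simp]: "norm (FTi x) = norm x"
  by (simp add: FTi_def)

lemma FT_FTi [simp]: "FT (FTi y) = y"
proof (rule vector_eq_rdot[THEN iffD1], rule allI)
  fix z
  have "inner (FT (FTi y)) z = inner (FTi y) (cconj (FT (cconj z)))"
    using inner_FT_cconj[of "FTi y" "cconj z"] by simp
  also have "\<dots> = inner y z" by (simp add: FTi_def inner_cconj inner_FT)
  finally show "inner (FT (FTi y)) z = inner y z" .
qed

lemma FTi_FT [simp]: "FTi (FT x) = x"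
proof (rule vector_eq_rdot[THEN iffD1], rule allI)
  fix z
  have "inner (FTi (FT x)) z = inner (FT (cconj (FT x))) (cconj z)"
    using inner_cconj[of "FT (cconj (FT x))" "cconj z"] by (simp add: FTi_def)
  also have "\<dots> = inner x z" by (simp add: inner_FT_cconj inner_cconj inner_FT)
  finally show "inner (FTi (FT x)) z = inner x z" .
qed

lemma inner_FT_left: "inner (FT x) y = inner x (FTi y)"
  using inner_FT[of x "FTi y"] by simp

lemma FTi_cscale: "FTi (cscale c x) = cscale c (FTi x)"
  using FT_cscale[of c "FTi x"] FTi_FT[of "cscale c (FTi x)"] by simp

section \<open>Test functions\<close>

definition dir_deriv :: "'v::euclidean_space \<Rightarrow> ('v \<Rightarrow> complex) \<Rightarrow> 'v \<Rightarrow> complex" where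
  "dir_deriv v \<phi> z = frechet_derivative \<phi> (at z) v"

lemma test_fun_continuous: "test_fun T \<phi> \<Longrightarrow> continuous_on UNIV \<phi>"
  unfolding test_fun_def using C_k.simps(1) by blast

lemma test_fun_differentiable: "test_fun T \<phi> \<Longrightarrow> \<phi> differentiable (at z)"
  unfolding test_fun_def using C_k.simps(2)[of 0 \<phi>] by blast

lemma test_fun_dir_deriv:
  assumes "test_fun T \<phi>"
  shows "test_fun T (dir_deriv v \<phi>)"
proof -
  let ?S = "closure {z. \<phi> z \<noteq> 0}"
  have "{z. dir_deriv v \<phi> z \<noteq> 0} \<subseteq> ?S"
  proof (rule subsetI, rule ccontr)
    fix z assume z: "z \<in> {z. dir_deriv v \<phi> z \<noteq> 0}" "z \<notin> ?S"
    have "((\<lambda>z. 0) has_derivative (\<lambda>z. 0)) (at z)" by simp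
    then have "(\<phi> has_derivative (\<lambda>z. 0)) (at z)"
      by (rule has_derivative_transform_within_open[of _ _ _ _ "- ?S"])
        (use z closure_subset[of "{z. \<phi> z \<noteq> 0}"] in auto)
    then have "frechet_derivative \<phi> (at z) = (\<lambda>z. 0)" by (rule frechet_derivative_at[symmetric])
    with z(1) show False by (simp add: dir_deriv_def)
  qed
  then have "closure {z. dir_deriv v \<phi> z \<noteq> 0} \<subseteq> ?S" by (rule closure_minimal) simp
  moreover have "C_k k (dir_deriv v \<phi>)" for k
    using assms C_k.simps(2)[of k \<phi>] unfolding test_fun_def dir_deriv_def[abs_def] by blast
  ultimately show ?thesis
    using assms compact_Int_closed[of ?S "closure {z. dir_deriv v \<phi> z \<noteq> 0}"] unfolding test_fun_def
    by (simp add: Int_absorb1) blast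
qed

lemma test_fun_bounded:
  assumes "test_fun T \<phi>"
  obtains B where "B \<ge> 0" "\<And>z. norm (\<phi> z) \<le> B"
proof -
  let ?S = "closure {z. \<phi> z \<noteq> 0}"
  have "compact (\<phi> ` ?S)"
    using assms test_fun_continuous[OF assms]
    by (intro compact_continuous_image) (auto simp: test_fun_def intro: continuous_on_subset)
  then obtain B where B: "\<forall>y\<in>\<phi> ` ?S. norm y \<le> B" using compact_imp_bounded bounded_iff by blast
  have "norm (\<phi> z) \<le> \<bar>B\<bar>" for z
    using B closure_subset[of "{z. \<phi> z \<noteq> 0}"] by (cases "\<phi> z = 0") force+
  then show ?thesis using that[of "\<bar>B\<bar>"] by simp
qed

lemma test_fun_support:
  assumes "test_fun T \<phi>"
  obtains R where "\<And>t x. R < norm x \<Longrightarrow> \<phi> (t, x) = 0"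
proof -
  have "bounded {z. \<phi> z \<noteq> 0}"
    using assms compact_imp_bounded bounded_subset closure_subset unfolding test_fun_def by blast
  then obtain R where R: "\<And>z. \<phi> z \<noteq> 0 \<Longrightarrow> norm z \<le> R" unfolding bounded_iff by blast
  have "\<phi> (t, x) = 0" if "R < norm x" for t x
    using R[of "(t, x)"] norm_snd_le[where y=x and x=t] that by force
  then show ?thesis using that by blast
qed

lemma test_fun_time:
  assumes "test_fun T \<phi>" "t \<le> 0 \<or> T \<le> t"
  shows "\<phi> (t, x) = 0"
  using assms closure_subset[of "{z. \<phi> z \<noteq> 0}"] unfolding test_fun_def by force

text \<open>
  Both the time derivative and the spatial derivatives of a test function are derivatives along lines,
  with \<open>v = (1, 0)\<close> and \<open>v = (0, b)\<close>.
\<close>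

lemma test_fun_line_derivative:
  assumes "test_fun T \<phi>"
  shows "((\<lambda>h. \<phi> (z + h *\<^sub>R v)) has_vector_derivative dir_deriv v \<phi> (z + h *\<^sub>R v)) (at h)"
proof -
  have "((\<lambda>h. z + h *\<^sub>R v) has_derivative (\<lambda>k. k *\<^sub>R v)) (at h)"
    by (auto intro!: derivative_eq_intros)
  moreover have "(\<phi> has_derivative frechet_derivative \<phi> (at (z + h *\<^sub>R v))) (at (z + h *\<^sub>R v))"
    using test_fun_differentiable[OF assms] frechet_derivative_works by blast
  ultimately have "((\<lambda>h. \<phi> (z + h *\<^sub>R v)) has_derivative (\<lambda>k. frechet_derivative \<phi> (at (z + h *\<^sub>R v)) (k *\<^sub>R v))) (at h)"
    by (rule has_derivative_compose)
  moreover have "linear (frechet_derivative \<phi> (at (z + h *\<^sub>R v)))"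
    using test_fun_differentiable[OF assms] by (rule linear_frechet_derivative)
  ultimately show ?thesis
    unfolding has_vector_derivative_def dir_deriv_def by (simp add: linear_cmul)
qed

text \<open>
  The two facts needed to differentiate under an integral sign by dominated convergence: difference
  quotients are bounded by the derivative, and converge to it.
\<close>

lemma line_difference_quotient:
  fixes f f' :: "real \<Rightarrow> 'b::real_normed_vector"
  assumes "\<And>h. (f has_vector_derivative f' h) (at h)"
  shows "\<And>h. h \<noteq> 0 \<Longrightarrow> (\<And>h. norm (f' h) \<le> B) \<Longrightarrow> norm ((f h - f 0) /\<^sub>R h) \<le> B"
    and "(k \<longlonglongrightarrow> 0) \<Longrightarrow> (\<And>n. k n \<noteq> 0) \<Longrightarrow> (\<lambda>n. (f (k n) - f 0) /\<^sub>R k n) \<longlonglongrightarrow> f' 0"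
proof -
  fix h :: real assume h: "h \<noteq> 0" and B: "\<And>h. norm (f' h) \<le> B"
  have "norm (f h - f 0) \<le> B * norm (h - 0)"
  proof (rule differentiable_bound[of UNIV f "\<lambda>x k. k *\<^sub>R f' x"])
    show "onorm (\<lambda>k. k *\<^sub>R f' x) \<le> B" for x
    proof (rule onorm_le)
      fix y show "norm (y *\<^sub>R f' x) \<le> B * norm y"
        using mult_right_mono[OF B[of x], of "\<bar>y\<bar>"] by (simp add: mult.commute)
    qed
  qed (use assms in \<open>auto simp: has_vector_derivative_def\<close>)
  then show "norm ((f h - f 0) /\<^sub>R h) \<le> B" using h by (simp add: divide_simps mult.commute)
next
  assume k: "k \<longlonglongrightarrow> 0" "\<And>n. k n \<noteq> 0"
  have "((\<lambda>h. norm (f (0 + h) - f 0 - h *\<^sub>R f' 0) / norm h) \<longlongrightarrow> 0) (at 0)"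
    using assms[of 0] unfolding has_vector_derivative_def has_derivative_at by blast
  then have "(\<lambda>n. norm (f (0 + k n) - f 0 - k n *\<^sub>R f' 0) / norm (k n)) \<longlonglongrightarrow> 0"
    by (rule filterlim_compose) (use k in \<open>auto simp: filterlim_at\<close>)
  moreover have "norm (f (0 + k n) - f 0 - k n *\<^sub>R f' 0) / norm (k n) = norm ((f (k n) - f 0) /\<^sub>R k n - f' 0)" for n
  proof -
    have "(f (k n) - f 0) /\<^sub>R k n - f' 0 = (f (k n) - f 0 - k n *\<^sub>R f' 0) /\<^sub>R k n"
      using k(2)[of n] by (simp add: scaleR_diff_right)
    then show ?thesis by (simp add: divide_inverse mult.commute)
  qed
  ultimately show "(\<lambda>n. (f (k n) - f 0) /\<^sub>R k n) \<longlonglongrightarrow> f' 0"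
    by (simp add: tendsto_norm_zero_iff LIM_zero_iff)
qed

definition slice :: "(real \<times> 'a::euclidean_space \<Rightarrow> complex) \<Rightarrow> real \<Rightarrow> 'a \<Rightarrow> complex" where
  "slice \<phi> t x = \<phi> (t, x)"

lemma slice_Cc:
  assumes "test_fun T \<phi>" "\<And>t x. R < norm x \<Longrightarrow> \<phi> (t, x) = 0"
  shows "Cc R (slice \<phi> t)"
  unfolding Cc_def slice_def using assms
  by (auto intro!: continuous_on_compose2[OF test_fun_continuous[OF assms(1)]] continuous_intros)

lemma slice_L2: "test_fun T \<phi> \<Longrightarrow> L2 (slice \<phi> t)"
  by (metis test_fun_support slice_Cc Cc_L2)

definition test_l2 :: "(real \<times> 'a::euclidean_space \<Rightarrow> complex) \<Rightarrow> real \<Rightarrow> 'a l2" where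
  "test_l2 \<phi> t = abs_l2 (slice \<phi> t)"

lemma bounded_dominator:
  fixes f :: "'a::euclidean_space \<Rightarrow> complex"
  assumes "norm (f x) \<le> B" "R < norm x \<Longrightarrow> f x = 0" "B \<ge> 0"
  shows "norm (f x) \<le> norm (of_real B * indicator (cball 0 R) x :: complex)"
  using assms by (cases "x \<in> cball 0 R") (auto simp: norm_mult)

lemma test_l2_continuous:
  assumes \<phi>: "test_fun T \<phi>"
  shows "continuous_on UNIV (test_l2 \<phi>)"
proof -
  obtain B where B: "B \<ge> 0" "\<And>z. norm (\<phi> z) \<le> B" by (rule test_fun_bounded[OF \<phi>]) blast
  obtain R where R: "\<And>t x. R < norm x \<Longrightarrow> \<phi> (t, x) = 0" by (rule test_fun_support[OF \<phi>]) blast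
  have "(\<lambda>n. test_l2 \<phi> (k n)) \<longlonglongrightarrow> test_l2 \<phi> t" if k: "k \<longlonglongrightarrow> t" for k t
    unfolding test_l2_def
  proof (rule l2_dominated_convergence(3))
    show "slice \<phi> t \<in> borel_measurable lebesgue" "slice \<phi> (k n) \<in> borel_measurable lebesgue" for n
      by (intro L2_measurable slice_L2[OF \<phi>])+
    show "L2 (\<lambda>x. of_real B * indicator (cball 0 R) x :: complex)" by (intro L2_cmult L2_indicator_cball)
    show "AE x in lebesgue. norm (slice \<phi> (k n) x) \<le> norm (of_real B * indicator (cball 0 R) x :: complex)" for n
      by (intro AE_I2 bounded_dominator) (auto simp: slice_def B R)
    show "AE x in lebesgue. (\<lambda>n. slice \<phi> (k n) x) \<longlonglongrightarrow> slice \<phi> t x"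
      unfolding slice_def
      by (intro AE_I2 continuous_on_tendsto_compose[OF test_fun_continuous[OF \<phi>]] tendsto_intros k) auto
  qed
  then show ?thesis by (auto simp: continuous_on_sequentially o_def)
qed

lemma test_l2_derivative:
  assumes \<phi>: "test_fun T \<phi>"
  shows "(test_l2 \<phi> has_vector_derivative test_l2 (dir_deriv (1, 0) \<phi>) t) (at t)"
proof -
  let ?\<phi>' = "dir_deriv (1, 0) \<phi>"
  note \<phi>' = test_fun_dir_deriv[OF \<phi>, of "(1, 0)"]
  obtain B where B: "B \<ge> 0" "\<And>z. norm (?\<phi>' z) \<le> B" by (rule test_fun_bounded[OF \<phi>']) blast
  obtain R where R: "\<And>t x. R < norm x \<Longrightarrow> \<phi> (t, x) = 0" by (rule test_fun_support[OF \<phi>]) blast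
  have der: "((\<lambda>h. \<phi> (t + h, x)) has_vector_derivative ?\<phi>' (t + h, x)) (at h)" for h x
    using test_fun_line_derivative[OF \<phi>, of "(t, x)" "(1, 0)" h] by simp
  have "((\<lambda>h. norm (test_l2 \<phi> (t + h) - test_l2 \<phi> t - h *\<^sub>R test_l2 ?\<phi>' t) / norm h) \<longlongrightarrow> 0) (at 0)"
    unfolding tendsto_at_iff_sequentially o_def
  proof (intro allI impI)
    fix k :: "nat \<Rightarrow> real" assume "\<forall>i. k i \<in> UNIV - {0}" and k: "k \<longlonglongrightarrow> 0"
    then have k0: "k n \<noteq> 0" for n by simp
    let ?q = "\<lambda>n x. (slice \<phi> (t + k n) x - slice \<phi> t x) /\<^sub>R k n"
    have qL: "L2 (?q n)" for n by (intro L2_scaleR L2_diff slice_L2[OF \<phi>])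
    have "(\<lambda>n. abs_l2 (?q n)) \<longlonglongrightarrow> test_l2 ?\<phi>' t"
      unfolding test_l2_def
    proof (rule l2_dominated_convergence(3))
      show "?q n \<in> borel_measurable lebesgue" for n by (intro L2_measurable qL)
      show "slice ?\<phi>' t \<in> borel_measurable lebesgue" by (intro L2_measurable slice_L2[OF \<phi>'])
      show "L2 (\<lambda>x. of_real B * indicator (cball 0 R) x :: complex)" by (intro L2_cmult L2_indicator_cball)
      have "norm (?q n x) \<le> B" for n x
      proof -
        have "norm ((\<phi> (t + k n, x) - \<phi> (t + 0, x)) /\<^sub>R k n) \<le> B"
          by (rule line_difference_quotient(1)[OF der]) (use k0 B(2) in auto)
        then show ?thesis by (simp add: slice_def)
      qed
      then show "AE x in lebesgue. norm (?q n x) \<le> norm (of_real B * indicator (cball 0 R) x :: complex)" for n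
        by (intro AE_I2 bounded_dominator) (auto simp: slice_def B R)
      show "AE x in lebesgue. (\<lambda>n. ?q n x) \<longlonglongrightarrow> slice ?\<phi>' t x"
      proof (rule AE_I2)
        fix x
        have "(\<lambda>n. (\<phi> (t + k n, x) - \<phi> (t + 0, x)) /\<^sub>R k n) \<longlonglongrightarrow> ?\<phi>' (t + 0, x)"
          by (rule line_difference_quotient(2)[OF der k k0])
        then show "(\<lambda>n. ?q n x) \<longlonglongrightarrow> slice ?\<phi>' t x" by (simp add: slice_def)
      qed
    qed
    then have "(\<lambda>n. norm (abs_l2 (?q n) - test_l2 ?\<phi>' t)) \<longlonglongrightarrow> 0"
      by (simp add: tendsto_norm_zero_iff LIM_zero_iff)
    moreover have "norm (abs_l2 (?q n) - test_l2 ?\<phi>' t)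
        = norm (test_l2 \<phi> (t + k n) - test_l2 \<phi> t - k n *\<^sub>R test_l2 ?\<phi>' t) / norm (k n)" for n
    proof -
      have "abs_l2 (?q n) = (test_l2 \<phi> (t + k n) - test_l2 \<phi> t) /\<^sub>R k n"
        by (simp add: test_l2_def minus_l2.abs_eq scaleR_l2.abs_eq slice_L2[OF \<phi>])
      then have "abs_l2 (?q n) - test_l2 ?\<phi>' t = (test_l2 \<phi> (t + k n) - test_l2 \<phi> t - k n *\<^sub>R test_l2 ?\<phi>' t) /\<^sub>R k n"
        using k0[of n] by (simp add: scaleR_diff_right)
      then show ?thesis by (simp add: divide_inverse mult.commute)
    qed
    ultimately show "(\<lambda>n. norm (test_l2 \<phi> (t + k n) - test_l2 \<phi> t - k n *\<^sub>R test_l2 ?\<phi>' t) / norm (k n)) \<longlonglongrightarrow> 0"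
      by simp
  qed
  then show ?thesis
    unfolding has_vector_derivative_def has_derivative_at by (simp add: bounded_linear_scaleR_left)
qed

text \<open>
  A translate of \<open>\<psi>\<close> by \<open>h b\<close> has the transform of \<open>\<psi>\<close> multiplied by \<open>exp (i h b \<cdot> \<xi>)\<close>; differentiate at \<open>h = 0\<close>.
  This replaces an integration by parts in several variables.
\<close>

lemma fourier_derivative:
  fixes \<psi> \<psi>' :: "'a::euclidean_space \<Rightarrow> complex"
  assumes \<psi>: "Cc R \<psi>" and \<psi>': "Cc R \<psi>'" and b: "norm b = 1"
    and der: "\<And>x h. ((\<lambda>h. \<psi> (x + h *\<^sub>R b)) has_vector_derivative \<psi>' (x + h *\<^sub>R b)) (at h)"
  shows "fourier_L1 \<psi>' \<xi> = \<i> * of_real (\<xi> \<bullet> b) * fourier_L1 \<psi> \<xi>"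
proof -
  note [measurable] = Cc_measurable[OF \<psi>] Cc_measurable[OF \<psi>']
  obtain B where B: "\<And>x. norm (\<psi>' x) \<le> B * indicator (cball 0 R) x" "B \<ge> 0" by (rule Cc_bounded[OF \<psi>']) blast
  have B': "norm (\<psi>' x) \<le> B" for x using B(1)[of x] B(2) by (cases "x \<in> cball 0 R") auto
  define k where "k n = inverse (real (Suc n))" for n
  have k: "k \<longlonglongrightarrow> 0" "\<And>n. k n \<noteq> 0" "\<And>n. \<bar>k n\<bar> \<le> 1"
    unfolding k_def by (auto intro: LIMSEQ_inverse_real_of_nat simp del: of_nat_Suc simp: inverse_le_1_iff)
\<comment> \<open>The difference quotients are supported in a ball of radius \<open>R + 1\<close>, as \<open>|k n| \<le> 1\<close>.\<close>
  have int: "integrable lborel (\<lambda>x. B * indicator (cball (0::'a) (R + 1)) x)"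
    by (intro integrable_mult_right integrable_real_indicator emeasure_bounded_finite) auto
  define q where "q n x = (\<psi> (x + k n *\<^sub>R b) - \<psi> x) /\<^sub>R k n" for n x
  have qm [measurable]: "q n \<in> borel_measurable borel" for n unfolding q_def by measurable
  have q_bd: "norm (q n x) \<le> B * indicator (cball 0 (R + 1)) x" for n x
  proof (cases "norm x \<le> R + 1")
    case True
    have "norm ((\<psi> (x + k n *\<^sub>R b) - \<psi> (x + 0 *\<^sub>R b)) /\<^sub>R k n) \<le> B"
      by (rule line_difference_quotient(1)[OF der]) (use k(2) B' in auto)
    then show ?thesis using True by (simp add: q_def)
  next
    case False
    have "norm x \<le> norm (x + k n *\<^sub>R b) + norm (k n *\<^sub>R b)"
      using norm_triangle_ineq4[of "x + k n *\<^sub>R b" "k n *\<^sub>R b"] by simp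
    then have "norm x \<le> norm (x + k n *\<^sub>R b) + 1" using k(3)[of n] b by simp
    then have "q n x = 0" using False \<psi> by (simp add: q_def Cc_def)
    then show ?thesis using B(2) by simp
  qed
  have lim1: "(\<lambda>n. fourier_unnorm (q n) \<xi>) \<longlonglongrightarrow> fourier_unnorm \<psi>' \<xi>"
    unfolding fourier_unnorm_def
  proof (rule integral_dominated_convergence[where w="\<lambda>x. B * indicator (cball 0 (R + 1)) x"])
    show "AE x in lborel. (\<lambda>n. iexp (- (x \<bullet> \<xi>)) * q n x) \<longlonglongrightarrow> iexp (- (x \<bullet> \<xi>)) * \<psi>' x"
    proof (intro AE_I2 tendsto_intros)
      fix x
      have "(\<lambda>n. (\<psi> (x + k n *\<^sub>R b) - \<psi> (x + 0 *\<^sub>R b)) /\<^sub>R k n) \<longlonglongrightarrow> \<psi>' (x + 0 *\<^sub>R b)"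
        by (rule line_difference_quotient(2)[OF der k(1,2)])
      then show "(\<lambda>n. q n x) \<longlonglongrightarrow> \<psi>' x" by (simp add: q_def)
    qed
    show "AE x in lborel. norm (iexp (- (x \<bullet> \<xi>)) * q n x) \<le> B * indicator (cball 0 (R + 1)) x" for n
      using q_bd by (intro AE_I2) (simp only: norm_mult norm_iexp mult_1)
  qed (use int in auto)
  have \<psi>i: "integrable lborel \<psi>" by (rule Cc_integrable(1)[OF \<psi>])
  have shift: "fourier_unnorm (\<lambda>x. \<psi> (x + h *\<^sub>R b)) \<xi> = iexp (h * (b \<bullet> \<xi>)) * fourier_unnorm \<psi> \<xi>" for h
  proof -
    have m: "(\<lambda>x. iexp (- (x \<bullet> \<xi>)) * \<psi> x) \<in> borel_measurable borel" by measurable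
    have "fourier_unnorm \<psi> \<xi> = (LINT x|lborel. iexp (- ((h *\<^sub>R b + 1 *\<^sub>R x) \<bullet> \<xi>)) * \<psi> (h *\<^sub>R b + 1 *\<^sub>R x))"
      unfolding fourier_unnorm_def using lborel_integral_affine[OF m, of 1 "h *\<^sub>R b"] by simp
    also have "iexp (h * (b \<bullet> \<xi>)) * \<dots> = (LINT x|lborel. iexp (- (x \<bullet> \<xi>)) * \<psi> (x + h *\<^sub>R b))"
      unfolding integral_mult_right_zero[symmetric]
    proof (rule Bochner_Integration.integral_cong[OF refl])
      fix x
      have "iexp (h * (b \<bullet> \<xi>)) * iexp (- ((h *\<^sub>R b + 1 *\<^sub>R x) \<bullet> \<xi>)) = iexp (- (x \<bullet> \<xi>))"
      proof -
        have "\<i> * complex_of_real (h * (b \<bullet> \<xi>)) + \<i> * complex_of_real (- ((h *\<^sub>R b + 1 *\<^sub>R x) \<bullet> \<xi>)) = \<i> * complex_of_real (- (x \<bullet> \<xi>))"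
          by (simp add: inner_add_left algebra_simps)
        then show ?thesis by (simp only: exp_add[symmetric])
      qed
      then show "iexp (h * (b \<bullet> \<xi>)) * (iexp (- ((h *\<^sub>R b + 1 *\<^sub>R x) \<bullet> \<xi>)) * \<psi> (h *\<^sub>R b + 1 *\<^sub>R x))
          = iexp (- (x \<bullet> \<xi>)) * \<psi> (x + h *\<^sub>R b)"
        by (simp only: mult.assoc[symmetric]) (simp add: add.commute)
    qed
    finally show ?thesis by (simp add: fourier_unnorm_def)
  qed
  have "fourier_unnorm (q n) \<xi> = ((iexp (k n * (b \<bullet> \<xi>)) - iexp (0 * (b \<bullet> \<xi>))) /\<^sub>R k n) * fourier_unnorm \<psi> \<xi>" for n
  proof -
    have i1: "integrable lborel (\<lambda>x. iexp (- (x \<bullet> \<xi>)) * \<psi> x)" by (rule integrable_iexp_mult[OF \<psi>i])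
    have "integrable lborel (\<lambda>x. \<psi> (k n *\<^sub>R b + 1 *\<^sub>R x))" by (rule lborel_integrable_affine[OF \<psi>i]) simp
    then have "integrable lborel (\<lambda>x. \<psi> (x + k n *\<^sub>R b))" by (simp add: add.commute)
    then have i2: "integrable lborel (\<lambda>x. iexp (- (x \<bullet> \<xi>)) * \<psi> (x + k n *\<^sub>R b))" by (rule integrable_iexp_mult)
    have "fourier_unnorm (q n) \<xi> = (LINT x|lborel. (iexp (- (x \<bullet> \<xi>)) * \<psi> (x + k n *\<^sub>R b) - iexp (- (x \<bullet> \<xi>)) * \<psi> x) /\<^sub>R k n)"
      unfolding fourier_unnorm_def q_def by (simp add: right_diff_distrib)
    also have "\<dots> = (fourier_unnorm (\<lambda>x. \<psi> (x + k n *\<^sub>R b)) \<xi> - fourier_unnorm \<psi> \<xi>) /\<^sub>R k n"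
      unfolding fourier_unnorm_def using i1 i2 by simp
    finally show ?thesis unfolding shift by (simp add: left_diff_distrib)
  qed
  moreover have "(\<lambda>n. ((iexp (k n * (b \<bullet> \<xi>)) - iexp (0 * (b \<bullet> \<xi>))) /\<^sub>R k n) * fourier_unnorm \<psi> \<xi>)
      \<longlonglongrightarrow> \<i> * of_real (b \<bullet> \<xi>) * fourier_unnorm \<psi> \<xi>"
  proof (rule tendsto_mult_right)
    have "((\<lambda>h. iexp (h * (b \<bullet> \<xi>))) has_vector_derivative (b \<bullet> \<xi>) *\<^sub>R (\<i> * iexp (h * (b \<bullet> \<xi>)))) (at h)" for h
    proof -
      have "(((\<lambda>r. iexp r) \<circ> (\<lambda>h. h * (b \<bullet> \<xi>))) has_vector_derivative (b \<bullet> \<xi>) *\<^sub>R (\<i> * iexp (h * (b \<bullet> \<xi>)))) (at h)"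
        by (rule vector_diff_chain_at) (auto intro!: derivative_eq_intros has_vector_derivative_iexp
            simp: has_real_derivative_iff_has_vector_derivative[symmetric])
      then show ?thesis by (simp add: o_def)
    qed
    from line_difference_quotient(2)[OF this k(1,2)]
    show "(\<lambda>n. (iexp (k n * (b \<bullet> \<xi>)) - iexp (0 * (b \<bullet> \<xi>))) /\<^sub>R k n) \<longlonglongrightarrow> \<i> * of_real (b \<bullet> \<xi>)"
      by (simp add: scaleR_conv_of_real mult.commute)
  qed
  ultimately have "fourier_unnorm \<psi>' \<xi> = \<i> * of_real (b \<bullet> \<xi>) * fourier_unnorm \<psi> \<xi>"
    using lim1 LIMSEQ_unique by simp
  then show ?thesis
    by (simp add: fourier_L1_unnorm[OF Cc_measurable[OF \<psi>]] fourier_L1_unnorm[OF Cc_measurable[OF \<psi>']] inner_commute)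
qed

lemma test_fun_dir_deriv_funpow: "test_fun T \<phi> \<Longrightarrow> test_fun T ((dir_deriv v ^^ m) \<phi>)"
  by (induction m) (auto intro: test_fun_dir_deriv)

lemma Cc_cnj: "Cc R f \<Longrightarrow> Cc R (\<lambda>x. cnj (f x))"
  by (auto simp: Cc_def intro: continuous_intros)

text \<open>
  The conjugate of the test function is transformed since the conjugate of the inverse transform of \<open>\<phi>\<close>,
  which occurs in the pairing with the fractional Laplacian, is the transform of the conjugate.
\<close>

lemma fourier_cnj_dir_deriv:
  fixes \<phi> :: "real \<times> 'a::euclidean_space \<Rightarrow> complex"
  assumes \<phi>: "test_fun T \<phi>" and b: "b \<in> Basis"
  shows "fourier_L1 (\<lambda>x. cnj (slice (dir_deriv (0, b) \<phi>) t x)) \<xi> = \<i> * of_real (\<xi> \<bullet> b) * fourier_L1 (\<lambda>x. cnj (slice \<phi> t x)) \<xi>"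
proof -
  obtain R1 where R1: "\<And>t x. R1 < norm x \<Longrightarrow> \<phi> (t, x) = 0" by (rule test_fun_support[OF \<phi>]) blast
  obtain R2 where R2: "\<And>t x. R2 < norm x \<Longrightarrow> dir_deriv (0, b) \<phi> (t, x) = 0"
    by (rule test_fun_support[OF test_fun_dir_deriv[OF \<phi>]]) blast
  show ?thesis
  proof (rule fourier_derivative)
    show "Cc (max R1 R2) (\<lambda>x. cnj (slice \<phi> t x))"
      by (intro Cc_cnj slice_Cc[OF \<phi>]) (simp add: R1)
    show "Cc (max R1 R2) (\<lambda>x. cnj (slice (dir_deriv (0, b) \<phi>) t x))"
      by (intro Cc_cnj slice_Cc[OF test_fun_dir_deriv[OF \<phi>]]) (simp add: R2)
    show "norm b = 1" using b by simp
    fix x h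
    have "((\<lambda>h. \<phi> ((t, x) + h *\<^sub>R (0, b))) has_vector_derivative dir_deriv (0, b) \<phi> ((t, x) + h *\<^sub>R (0, b))) (at h)"
      by (rule test_fun_line_derivative[OF \<phi>])
    from bounded_linear.has_vector_derivative[OF bounded_linear_cnj this]
    show "((\<lambda>h. cnj (slice \<phi> t (x + h *\<^sub>R b))) has_vector_derivative cnj (slice (dir_deriv (0, b) \<phi>) t (x + h *\<^sub>R b))) (at h)"
      by (simp add: slice_def)
  qed
qed

lemma fourier_cnj_dir_deriv_funpow:
  fixes \<phi> :: "real \<times> 'a::euclidean_space \<Rightarrow> complex"
  assumes \<phi>: "test_fun T \<phi>" and b: "b \<in> Basis"
  shows "fourier_L1 (\<lambda>x. cnj (slice ((dir_deriv (0, b) ^^ m) \<phi>) t x)) \<xi>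
    = (\<i> * of_real (\<xi> \<bullet> b)) ^ m * fourier_L1 (\<lambda>x. cnj (slice \<phi> t x)) \<xi>"
  by (induction m) (auto simp: fourier_cnj_dir_deriv[OF test_fun_dir_deriv_funpow[OF \<phi>] b] mult.assoc)

lemma fourier_cnj_slice_L2:
  assumes \<phi>: "test_fun T \<phi>"
  shows "L2 (fourier_L1 (\<lambda>x. cnj (slice \<phi> t x)))"
    and "L2_norm (fourier_L1 (\<lambda>x. cnj (slice \<phi> t x))) = L2_norm (slice \<phi> t)"
    and "FT (cconj (test_l2 \<phi> t)) = abs_l2 (fourier_L1 (\<lambda>x. cnj (slice \<phi> t x)))"
proof -
  obtain R where R: "\<And>t x. R < norm x \<Longrightarrow> \<phi> (t, x) = 0" by (rule test_fun_support[OF \<phi>]) blast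
  have c: "Cc R (\<lambda>x. cnj (slice \<phi> t x))" by (intro Cc_cnj slice_Cc[OF \<phi>] R)
  show "L2 (fourier_L1 (\<lambda>x. cnj (slice \<phi> t x)))" by (rule Plancherel_Cc_L2[OF c])
  show "L2_norm (fourier_L1 (\<lambda>x. cnj (slice \<phi> t x))) = L2_norm (slice \<phi> t)"
    using Plancherel_Cc_L2(2)[OF c] by (simp add: L2_norm_def)
  have "cconj (test_l2 \<phi> t) = abs_l2 (\<lambda>x. cnj (slice \<phi> t x))"
    by (simp add: test_l2_def cconj.abs_eq slice_L2[OF \<phi>])
  also have "FT \<dots> = abs_l2 (fourier_L1 (\<lambda>x. cnj (slice \<phi> t x)))"
    by (rule FT_bounded_support[OF Cc_L2[OF c], of R]) (simp add: slice_def R)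
  finally show "FT (cconj (test_l2 \<phi> t)) = abs_l2 (fourier_L1 (\<lambda>x. cnj (slice \<phi> t x)))" .
qed

lemma slice_norm_bound:
  fixes \<phi> :: "real \<times> 'a::euclidean_space \<Rightarrow> complex"
  assumes \<phi>: "test_fun T \<phi>"
  shows "\<exists>C. \<forall>t. (L2_norm (slice \<phi> t))\<^sup>2 \<le> C"
proof -
  obtain B where B: "B \<ge> 0" "\<And>z. norm (\<phi> z) \<le> B" by (rule test_fun_bounded[OF \<phi>]) blast
  obtain R where R: "\<And>t x. R < norm x \<Longrightarrow> \<phi> (t, x) = 0" by (rule test_fun_support[OF \<phi>]) blast
  let ?h = "\<lambda>x::'a. of_real B * indicator (cball 0 R) x :: complex"
  have "(L2_norm (slice \<phi> t))\<^sup>2 \<le> (LINT x|lebesgue. (norm (?h x))\<^sup>2)" for t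
  proof -
    have "(L2_norm (slice \<phi> t))\<^sup>2 = (LINT x|lebesgue. (norm (slice \<phi> t x))\<^sup>2)" by (simp add: L2_norm_def)
    also have "\<dots> \<le> (LINT x|lebesgue. (norm (?h x))\<^sup>2)"
      by (intro integral_mono L2_integrable slice_L2[OF \<phi>] L2_cmult L2_indicator_cball power_mono bounded_dominator)
        (auto simp: slice_def B R)
    finally show ?thesis .
  qed
  then show ?thesis by blast
qed

text \<open>
  A fractional power of the norm is dominated by integer powers of the coordinates, and these
  correspond to derivatives under the Fourier transform.
\<close>

lemma norm_powr_le_coordinates:
  fixes \<xi> :: "'a::euclidean_space"
  assumes "0 \<le> r" "r \<le> real k"
  shows "norm \<xi> powr r \<le> real DIM('a) powr r * (1 + (\<Sum>b\<in>Basis. \<bar>\<xi> \<bullet> b\<bar> ^ k))"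
proof -
  obtain c where c: "c \<in> Basis" "\<And>b. b \<in> Basis \<Longrightarrow> \<bar>\<xi> \<bullet> b\<bar> \<le> \<bar>\<xi> \<bullet> c\<bar>"
  proof -
    have "Max ((\<lambda>b. \<bar>\<xi> \<bullet> b\<bar>) ` Basis) \<in> (\<lambda>b. \<bar>\<xi> \<bullet> b\<bar>) ` Basis" by (rule Max_in) auto
    then obtain c where "c \<in> Basis" "Max ((\<lambda>b. \<bar>\<xi> \<bullet> b\<bar>) ` Basis) = \<bar>\<xi> \<bullet> c\<bar>" by blast
    then show ?thesis using that[of c] Max_ge[of "(\<lambda>b. \<bar>\<xi> \<bullet> b\<bar>) ` Basis"] by auto
  qed
  have "norm \<xi> \<le> (\<Sum>b\<in>Basis. \<bar>\<xi> \<bullet> b\<bar>)" by (rule norm_le_l1)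
  also have "\<dots> \<le> real DIM('a) * \<bar>\<xi> \<bullet> c\<bar>" using c(2) by (rule sum_bounded_above)
  finally have "norm \<xi> powr r \<le> (real DIM('a) * \<bar>\<xi> \<bullet> c\<bar>) powr r" using assms by (intro powr_mono2) auto
  also have "\<dots> = real DIM('a) powr r * \<bar>\<xi> \<bullet> c\<bar> powr r" by (simp add: powr_mult)
  also have "\<bar>\<xi> \<bullet> c\<bar> powr r \<le> 1 + \<bar>\<xi> \<bullet> c\<bar> ^ k"
  proof (cases "\<bar>\<xi> \<bullet> c\<bar> \<le> 1")
    case True
    then have "\<bar>\<xi> \<bullet> c\<bar> powr r \<le> 1" using assms powr_mono2[of r "\<bar>\<xi> \<bullet> c\<bar>" 1] by simp
    then show ?thesis by (simp add: add_increasing2)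
  next
    case False
    then have "\<bar>\<xi> \<bullet> c\<bar> powr r \<le> \<bar>\<xi> \<bullet> c\<bar> powr real k" using assms by (intro powr_mono) auto
    then show ?thesis using False by (simp add: powr_realpow)
  qed
  also have "\<bar>\<xi> \<bullet> c\<bar> ^ k \<le> (\<Sum>b\<in>Basis. \<bar>\<xi> \<bullet> b\<bar> ^ k)"
    using c(1) by (intro member_le_sum) auto
  finally show ?thesis by (simp add: mult_left_mono)
qed

text \<open>
  Test functions are in the domain of \<open>(-\<Delta>)\<^sup>s\<close>, uniformly in time. By \<open>norm_powr_le_coordinates\<close> the
  squared symbol \<open>|\<xi>|\<^sup>4\<^sup>s\<close> is dominated by \<open>1 + \<Sum> |\<xi>\<^sub>b|\<^sup>2\<^sup>m\<close>, and \<open>\<xi>\<^sub>b\<^sup>m\<close> times the transform is, up to a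
  factor of modulus one, the transform of the \<open>m\<close>-th derivative in direction \<open>b\<close>, whose \<open>L\<^sup>2\<close> norm is
  bounded by Plancherel's identity.
\<close>

lemma weighted_fourier_test_bound:
  fixes \<phi> :: "real \<times> 'a::euclidean_space \<Rightarrow> complex"
  assumes \<phi>: "test_fun T \<phi>" and s: "s > 0"
  shows "\<exists>C. \<forall>t. L2 (\<lambda>\<xi>. of_real (norm \<xi> powr (2 * s)) * fourier_L1 (\<lambda>x. cnj (slice \<phi> t x)) \<xi>) \<and>
     L2_norm (\<lambda>\<xi>. of_real (norm \<xi> powr (2 * s)) * fourier_L1 (\<lambda>x. cnj (slice \<phi> t x)) \<xi>) \<le> C"
proof -
  define m where "m = nat \<lceil>2 * s\<rceil>"
  have m: "4 * s \<le> real (2 * m)" using s unfolding m_def by linarith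
  define K where "K = real DIM('a) powr (4 * s)"
  define \<phi>b where "\<phi>b b = (dir_deriv (0, b) ^^ m) \<phi>" for b :: 'a
  have \<phi>b: "test_fun T (\<phi>b b)" for b unfolding \<phi>b_def by (rule test_fun_dir_deriv_funpow[OF \<phi>])
  define G where "G t \<xi> = fourier_L1 (\<lambda>x. cnj (slice \<phi> t x)) \<xi>" for t \<xi>
  define Gb where "Gb b t \<xi> = fourier_L1 (\<lambda>x. cnj (slice (\<phi>b b) t x)) \<xi>" for b t \<xi>
  have GL: "L2 (G t)" "(LINT \<xi>|lebesgue. (norm (G t \<xi>))\<^sup>2) = (L2_norm (slice \<phi> t))\<^sup>2" for t
    using fourier_cnj_slice_L2(1,2)[OF \<phi>, of t] unfolding G_def[abs_def] L2_norm_def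
    by (auto simp: real_sqrt_eq_iff)
  have GbL: "L2 (Gb b t)" "(LINT \<xi>|lebesgue. (norm (Gb b t \<xi>))\<^sup>2) = (L2_norm (slice (\<phi>b b) t))\<^sup>2" for b t
    using fourier_cnj_slice_L2(1,2)[OF \<phi>b, of b t] unfolding Gb_def[abs_def] L2_norm_def
    by (auto simp: real_sqrt_eq_iff)
  have Gb_eq: "(norm (Gb b t \<xi>))\<^sup>2 = \<bar>\<xi> \<bullet> b\<bar> ^ (2 * m) * (norm (G t \<xi>))\<^sup>2" if "b \<in> Basis" for b t \<xi>
    using fourier_cnj_dir_deriv_funpow[OF \<phi> that, of m t \<xi>]
    by (simp add: Gb_def \<phi>b_def G_def norm_mult norm_power power_mult_distrib power_mult power_even_abs
        flip: power_mult)
      (simp add: power_mult_distrib power_mult[symmetric] mult.commute)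
  let ?u = "\<lambda>t \<xi>. of_real (norm \<xi> powr (2 * s)) * G t \<xi>"
  define D where "D t \<xi> = K * ((norm (G t \<xi>))\<^sup>2 + (\<Sum>b\<in>Basis. (norm (Gb b t \<xi>))\<^sup>2))" for t \<xi>
  have D_int: "integrable lebesgue (D t)" for t
    unfolding D_def by (intro integrable_mult_right Bochner_Integration.integrable_add Bochner_Integration.integrable_sum L2_integrable GL GbL)
  have u_le: "(norm (?u t \<xi>))\<^sup>2 \<le> D t \<xi>" for t \<xi>
  proof -
    have "(norm (?u t \<xi>))\<^sup>2 = norm \<xi> powr (4 * s) * (norm (G t \<xi>))\<^sup>2"
      by (simp add: norm_mult power_mult_distrib power2_eq_square[of "norm \<xi> powr (2 * s)"] powr_add[symmetric])
    also have "\<dots> \<le> (K * (1 + (\<Sum>b\<in>Basis. \<bar>\<xi> \<bullet> b\<bar> ^ (2 * m)))) * (norm (G t \<xi>))\<^sup>2"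
      unfolding K_def using s m by (intro mult_right_mono norm_powr_le_coordinates) auto
    also have "\<dots> = D t \<xi>"
      by (simp add: D_def Gb_eq distrib_right sum_distrib_right mult.assoc cong: sum.cong)
    finally show ?thesis .
  qed
  have um: "?u t \<in> borel_measurable lebesgue" for t
  proof -
    have "(\<lambda>\<xi>::'a. complex_of_real (norm \<xi> powr (2 * s))) \<in> borel_measurable borel" by measurable
    then show ?thesis by (intro borel_measurable_times L2_measurable GL measurable_completion) simp
  qed
  have uL: "L2 (?u t)" for t by (rule L2_bound[OF um D_int[of t]]) (simp add: u_le)
  obtain C0 where C0: "\<And>t. (L2_norm (slice \<phi> t))\<^sup>2 \<le> C0" using slice_norm_bound[OF \<phi>] by blast
  have "\<exists>C. \<forall>b t. (L2_norm (slice (\<phi>b b) t))\<^sup>2 \<le> C b" using slice_norm_bound[OF \<phi>b] by metis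
  then obtain C1 where C1: "\<And>b t. (L2_norm (slice (\<phi>b b) t))\<^sup>2 \<le> C1 b" by blast
  have "L2_norm (?u t) \<le> sqrt (K * (C0 + (\<Sum>b\<in>Basis. C1 b)))" for t
  proof -
    have "(LINT \<xi>|lebesgue. (norm (?u t \<xi>))\<^sup>2) \<le> (LINT \<xi>|lebesgue. D t \<xi>)"
      by (intro integral_mono u_le L2_integrable uL D_int)
    also have "\<dots> = K * ((L2_norm (slice \<phi> t))\<^sup>2 + (\<Sum>b\<in>Basis. (L2_norm (slice (\<phi>b b) t))\<^sup>2))"
      unfolding D_def using L2_integrable[OF GL(1)] L2_integrable[OF GbL(1)]
      by (simp add: GL GbL Bochner_Integration.integral_sum Bochner_Integration.integrable_sum)
    also have "\<dots> \<le> K * (C0 + (\<Sum>b\<in>Basis. C1 b))"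
      by (intro mult_left_mono add_mono sum_mono C0 C1) (simp add: K_def)
    finally show ?thesis unfolding L2_norm_def by (rule real_sqrt_le_mono)
  qed
  with uL show ?thesis unfolding G_def by blast
qed

section \<open>Multiplication operators\<close>

text \<open>
  The bound is required only almost everywhere, since the coefficient \<open>p\<close> is bounded only in the sense of
  the essential supremum.
\<close>

definition bdd_multiplier :: "real \<Rightarrow> ('a::euclidean_space \<Rightarrow> real) \<Rightarrow> bool" where
  "bdd_multiplier B m \<longleftrightarrow> m \<in> borel_measurable lebesgue \<and> (AE x in lebesgue. \<bar>m x\<bar> \<le> B)"

definition mult_op :: "('a::euclidean_space \<Rightarrow> real) \<Rightarrow> 'a l2 \<Rightarrow> 'a l2" where
  "mult_op m x = abs_l2 (\<lambda>z. of_real (m z) * rep_l2 x z)"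

lemma L2_mult_op: "bdd_multiplier B m \<Longrightarrow> L2 f \<Longrightarrow> L2 (\<lambda>z. of_real (m z) * f z)"
  unfolding bdd_multiplier_def by (rule L2_bounded_mult[where B=B]) auto

lemma mult_op_abs:
  assumes m: "bdd_multiplier B m" and f: "L2 f"
  shows "mult_op m (abs_l2 f) = abs_l2 (\<lambda>z. of_real (m z) * f z)"
  unfolding mult_op_def
  by (subst abs_l2_eq_iff) (use rep_abs_l2[OF f] in \<open>auto intro: L2_mult_op[OF m] f elim: eventually_mono\<close>)

lemma inner_mult_op:
  assumes "bdd_multiplier B m"
  shows "inner (mult_op m x) y = (LINT z|lebesgue. m z * inner (rep_l2 x z) (rep_l2 y z))"
    and "integrable lebesgue (\<lambda>z. m z * inner (rep_l2 x z) (rep_l2 y z))"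
proof -
  have eq: "inner (of_real (m z) * rep_l2 x z) (rep_l2 y z) = m z * inner (rep_l2 x z) (rep_l2 y z)" for z
    by (simp flip: scaleR_conv_of_real)
  have L: "L2 (\<lambda>z. of_real (m z) * rep_l2 x z)" by (rule L2_mult_op[OF assms L2_rep])
  show "inner (mult_op m x) y = (LINT z|lebesgue. m z * inner (rep_l2 x z) (rep_l2 y z))"
    using inner_l2.abs_eq[of "\<lambda>z. of_real (m z) * rep_l2 x z" "rep_l2 y"] L by (simp add: mult_op_def eq)
  show "integrable lebesgue (\<lambda>z. m z * inner (rep_l2 x z) (rep_l2 y z))"
    using L2_integrable_inner[OF L L2_rep, of y] by (simp add: eq)
qed

lemma mult_op_sym: "bdd_multiplier B m \<Longrightarrow> inner (mult_op m x) y = inner x (mult_op m y)"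
  using inner_mult_op(1)[of B m x y] inner_mult_op(1)[of B m y x] by (simp add: inner_commute)

lemma mult_op_mono:
  assumes m: "bdd_multiplier B m" "bdd_multiplier B' m'" and le: "AE z in lebesgue. m z \<le> m' z"
  shows "inner (mult_op m x) x \<le> inner (mult_op m' x) x"
  unfolding inner_mult_op(1)[OF m(1)] inner_mult_op(1)[OF m(2)]
  by (rule integral_mono_AE[OF inner_mult_op(2)[OF m(1)] inner_mult_op(2)[OF m(2)]])
    (use le in \<open>auto elim!: eventually_mono intro!: mult_right_mono\<close>)

lemma mult_op_nonneg:
  assumes m: "bdd_multiplier B m" and le: "AE z in lebesgue. 0 \<le> m z"
  shows "0 \<le> inner (mult_op m x) x"
  unfolding inner_mult_op(1)[OF m]
  by (rule integral_nonneg_AE) (use le in \<open>auto elim!: eventually_mono intro!: mult_nonneg_nonneg\<close>)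

lemma bdd_multiplier_times:
  assumes "bdd_multiplier B m" "bdd_multiplier B' m'"
  shows "bdd_multiplier (B * B') (\<lambda>z. m z * m' z)"
proof -
  have "AE z in lebesgue. \<bar>m z * m' z\<bar> \<le> B * B'"
    using assms[unfolded bdd_multiplier_def, THEN conjunct2]
    by eventually_elim (auto simp: abs_mult intro!: mult_mono)
  with assms show ?thesis by (auto simp: bdd_multiplier_def intro: borel_measurable_times)
qed

lemma bdd_multiplier_diff:
  assumes "bdd_multiplier B m" "bdd_multiplier B' m'"
  shows "bdd_multiplier (B + B') (\<lambda>z. m z - m' z)"
proof -
  have "AE z in lebesgue. \<bar>m z - m' z\<bar> \<le> B + B'"
    using assms[unfolded bdd_multiplier_def, THEN conjunct2] by eventually_elim linarith
  with assms show ?thesis by (auto simp: bdd_multiplier_def intro: borel_measurable_diff)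
qed

lemma mult_op_mult_op:
  assumes m: "bdd_multiplier B m" and m': "bdd_multiplier B' m'"
  shows "mult_op m (mult_op m' x) = mult_op (\<lambda>z. m z * m' z) x"
  unfolding mult_op_def[of m'] mult_op_def[of "\<lambda>z. m z * m' z"]
  by (subst mult_op_abs[OF m]) (auto intro: L2_mult_op[OF m'] simp: mult.assoc)

lemma mult_op_diff_multiplier:
  assumes m: "bdd_multiplier B m" and m': "bdd_multiplier B' m'"
  shows "mult_op m x - mult_op m' x = mult_op (\<lambda>z. m z - m' z) x"
  unfolding mult_op_def
  by (simp add: minus_l2.abs_eq L2_mult_op[OF m] L2_mult_op[OF m'] left_diff_distrib)

lemma mult_op_norm_le:
  assumes m: "bdd_multiplier B m" and B: "B \<ge> 0"
  shows "norm (mult_op m x) \<le> B * norm x"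
proof (rule power2_le_imp_le)
  have L: "L2 (\<lambda>z. of_real (m z) * rep_l2 x z)" by (rule L2_mult_op[OF m L2_rep])
  have "(norm (mult_op m x))\<^sup>2 = (LINT z|lebesgue. (norm (of_real (m z) * rep_l2 x z))\<^sup>2)"
    unfolding mult_op_def norm_abs_l2[OF L] L2_norm_def by simp
  also have "\<dots> \<le> (LINT z|lebesgue. B\<^sup>2 * (norm (rep_l2 x z))\<^sup>2)"
  proof (rule integral_mono_AE[OF L2_integrable[OF L]])
    show "integrable lebesgue (\<lambda>z. B\<^sup>2 * (norm (rep_l2 x z))\<^sup>2)" by (intro integrable_mult_right L2_integrable L2_rep)
    have "AE z in lebesgue. \<bar>m z\<bar> \<le> B" using m by (simp add: bdd_multiplier_def)
    then show "AE z in lebesgue. (norm (of_real (m z) * rep_l2 x z))\<^sup>2 \<le> B\<^sup>2 * (norm (rep_l2 x z))\<^sup>2"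
    proof eventually_elim
      case (elim z)
      have "(norm (of_real (m z) * rep_l2 x z))\<^sup>2 \<le> (B * norm (rep_l2 x z))\<^sup>2"
        unfolding norm_mult norm_of_real by (intro power_mono mult_right_mono elim) auto
      then show ?case by (simp add: power_mult_distrib)
    qed
  qed
  also have "\<dots> = B\<^sup>2 * (L2_norm (rep_l2 x))\<^sup>2" by (simp add: L2_norm_def)
  finally show "(norm (mult_op m x))\<^sup>2 \<le> (B * norm x)\<^sup>2" by (simp add: L2_norm_rep power_mult_distrib)
qed (use B in simp)

lemma mult_op_cscale:
  assumes m: "bdd_multiplier B m"
  shows "mult_op m (cscale c x) = cscale c (mult_op m x)"
proof -
  have "cscale c x = abs_l2 (\<lambda>z. c * rep_l2 x z)"
    using cscale.abs_eq[of "rep_l2 x" c] by simp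
  then show ?thesis
    unfolding mult_op_def[of m x]
    by (simp add: mult_op_abs[OF m] cscale.abs_eq L2_mult_op[OF m] mult.left_commute)
qed

lemma mult_op_linear:
  assumes m: "bdd_multiplier B m" "B \<ge> 0"
  shows "bounded_linear (mult_op m)"
proof (rule bounded_linear_intro)
  show "mult_op m (x + y) = mult_op m x + mult_op m y" for x y
  proof -
    have "x + y = abs_l2 (\<lambda>z. rep_l2 x z + rep_l2 y z)"
      using plus_l2.abs_eq[of "rep_l2 x" "rep_l2 y"] by simp
    then show ?thesis unfolding mult_op_def[of m x] mult_op_def[of m y]
      by (simp add: mult_op_abs[OF m(1)] plus_l2.abs_eq L2_mult_op[OF m(1)] distrib_left)
  qed
  show "mult_op m (r *\<^sub>R x) = r *\<^sub>R mult_op m x" for r x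
    by (simp add: scaleR_eq_cscale mult_op_cscale[OF m(1)])
  show "norm (mult_op m x) \<le> norm x * B" for x
    using mult_op_norm_le[OF m] by (simp add: mult.commute)
qed

section \<open>The Galerkin setting on the Fourier side\<close>

text \<open>
  The radius \<open>k + 1\<close> instead of \<open>k\<close> keeps the cutoff frequency positive, so that negative powers of it
  bound the tails for every \<open>k\<close>.
\<close>

definition cutoff :: "nat \<Rightarrow> 'a::euclidean_space \<Rightarrow> real" where
  "cutoff k = indicator (cball 0 (real (Suc k)))"

definition cut_symbol :: "real \<Rightarrow> nat \<Rightarrow> 'a::euclidean_space \<Rightarrow> real" where
  "cut_symbol s k \<xi> = norm \<xi> powr (2 * s) * cutoff k \<xi>"

lemma cutoff_measurable [measurable]: "cutoff k \<in> borel_measurable borel"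
  unfolding cutoff_def by (intro borel_measurable_indicator) simp

lemma cutoff_multiplier: "bdd_multiplier 1 (cutoff k :: 'a::euclidean_space \<Rightarrow> real)"
proof -
  have "cutoff k \<in> borel_measurable (lebesgue :: 'a measure)"
    by (intro measurable_completion) simp
  then show ?thesis by (simp add: bdd_multiplier_def) (simp add: cutoff_def indicator_def)
qed

lemma cut_symbol_nonneg: "0 \<le> cut_symbol s k \<xi>"
  by (simp add: cut_symbol_def cutoff_def)

lemma cut_symbol_multiplier:
  assumes "s > 0"
  shows "bdd_multiplier (real (Suc k) powr (2 * s)) (cut_symbol s k :: 'a::euclidean_space \<Rightarrow> real)"
proof -
  have "cut_symbol s k \<in> borel_measurable (borel :: 'a measure)" unfolding cut_symbol_def by measurable
  then have "cut_symbol s k \<in> borel_measurable (lebesgue :: 'a measure)" by (intro measurable_completion) simp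
  moreover have "\<bar>cut_symbol s k \<xi>\<bar> \<le> real (Suc k) powr (2 * s)" for \<xi> :: 'a
    using assms powr_mono2[of "2 * s" "norm \<xi>" "real (Suc k)"]
    by (auto simp: cut_symbol_def cutoff_def indicator_def)
  ultimately show ?thesis by (simp add: bdd_multiplier_def)
qed

lemma inner_cscale_i: "inner (cscale \<i> x) y = - inner x (cscale \<i> y)"
proof (transfer, unfold l2_rel_refl)
  fix f g :: "'a \<Rightarrow> complex"
  show "(LINT x|lebesgue. inner (\<i> * f x) (g x)) = - (LINT x|lebesgue. inner (f x) (\<i> * g x))"
    by (simp add: inner_complex_def algebra_simps flip: Bochner_Integration.integral_minus)
qed

lemma inner_mult_op_abs:
  assumes m: "bdd_multiplier B m" and f: "L2 f"
  shows "inner (mult_op m (abs_l2 f)) (abs_l2 f) = (LINT z|lebesgue. m z * (norm (f z))\<^sup>2)"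
    and "integrable lebesgue (\<lambda>z. m z * (norm (f z))\<^sup>2)"
proof -
  have eq: "inner (of_real (m z) * f z) (f z) = m z * (norm (f z))\<^sup>2" for z
    by (simp add: power2_norm_eq_inner flip: scaleR_conv_of_real)
  have L: "L2 (\<lambda>z. of_real (m z) * f z)" by (rule L2_mult_op[OF m f])
  show "inner (mult_op m (abs_l2 f)) (abs_l2 f) = (LINT z|lebesgue. m z * (norm (f z))\<^sup>2)"
    using L f by (simp add: mult_op_abs[OF m] inner_l2.abs_eq eq)
  show "integrable lebesgue (\<lambda>z. m z * (norm (f z))\<^sup>2)"
    using L2_integrable_inner[OF L f] by (simp add: eq)
qed

text \<open>
  The state is the Fourier transform of the wave function. There \<open>(-\<Delta>)\<^sup>s\<close> and its cutoffs are
  multiplication operators, and the potential is multiplication by \<open>p\<close> conjugated with the unitary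
  Fourier transform. Beyond the radius \<open>k + 1\<close> the symbol is at least \<open>(k + 1)\<^sup>2\<^sup>s\<close>, which gives the rate of
  decay of the tails.
\<close>

lemma galerkin_fourier:
  fixes p :: "'a::euclidean_space \<Rightarrow> real"
  assumes s: "s > 0" and p: "bdd_multiplier M p" "M \<ge> 0" and p0: "AE x in lebesgue. 0 \<le> p x"
  shows "galerkin (cscale \<i>) (\<lambda>x. FT (mult_op p (FTi x))) (\<lambda>n. mult_op (cutoff n))
    (\<lambda>n. mult_op (cut_symbol s n)) M (\<lambda>k. real (Suc k) powr (- (2 * s)))"
proof (rule galerkin.intro)
  note c = cutoff_multiplier and w = cut_symbol_multiplier[OF s]
  show "bounded_linear (cscale \<i> :: 'a l2 \<Rightarrow> 'a l2)" by (rule cscale_linear)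
  show "bounded_linear (\<lambda>x. FT (mult_op p (FTi x)))"
    by (intro bounded_linear_compose[OF FT_linear] bounded_linear_compose[OF mult_op_linear[OF p]] FTi_linear)
  show "bounded_linear (mult_op (cutoff n) :: 'a l2 \<Rightarrow> 'a l2)" for n by (rule mult_op_linear[OF c]) simp
  show "bounded_linear (mult_op (cut_symbol s n) :: 'a l2 \<Rightarrow> 'a l2)" for n by (rule mult_op_linear[OF w]) simp
  show "inner (cscale \<i> x) y = - inner x (cscale \<i> y)" for x y :: "'a l2" by (rule inner_cscale_i)
  show "norm (cscale \<i> x) = norm x" for x :: "'a l2" by (simp add: norm_cscale)
  show "inner (FT (mult_op p (FTi x))) y = inner x (FT (mult_op p (FTi y)))" for x y
  proof -
    have "inner (FT (mult_op p (FTi x))) y = inner (FTi x) (mult_op p (FTi y))"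
      unfolding inner_FT_left by (rule mult_op_sym[OF p(1)])
    also have "\<dots> = inner (FT (mult_op p (FTi y))) x"
      unfolding inner_FT_left by (rule inner_commute)
    also have "\<dots> = inner x (FT (mult_op p (FTi y)))" by (rule inner_commute)
    finally show ?thesis .
  qed
  show "0 \<le> inner (FT (mult_op p (FTi x))) x" for x
    unfolding inner_FT_left by (rule mult_op_nonneg[OF p(1) p0])
  show "norm (FT (mult_op p (FTi x))) \<le> M * norm x" for x
    using mult_op_norm_le[OF p, of "FTi x"] by simp
  show "FT (mult_op p (FTi (cscale \<i> x))) = cscale \<i> (FT (mult_op p (FTi x)))" for x
    by (simp add: FTi_cscale mult_op_cscale[OF p(1)] FT_cscale)
  show "0 \<le> M" by (rule p(2))
  show "inner (mult_op (cutoff n) x) y = inner x (mult_op (cutoff n) y)" for n and x y :: "'a l2"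
    by (rule mult_op_sym[OF c])
  show "mult_op (cutoff k) (mult_op (cutoff n) x) = mult_op (cutoff (min k n)) x" for k n and x :: "'a l2"
  proof -
    have "(\<lambda>z::'a. cutoff k z * cutoff n z) = cutoff (min k n)" by (auto simp: fun_eq_iff cutoff_def indicator_def)
    then show ?thesis by (simp add: mult_op_mult_op[OF c c])
  qed
  show "mult_op (cutoff n) (cscale \<i> x) = cscale \<i> (mult_op (cutoff n) x)" for n and x :: "'a l2"
    by (rule mult_op_cscale[OF c])
  show "inner (mult_op (cut_symbol s n) x) y = inner x (mult_op (cut_symbol s n) y)" for n and x y :: "'a l2"
    by (rule mult_op_sym[OF w])
  show "0 \<le> inner (mult_op (cut_symbol s n) x) x" for n and x :: "'a l2"
    by (rule mult_op_nonneg[OF w]) (simp add: cut_symbol_nonneg)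
  show "mult_op (cut_symbol s n) (cscale \<i> x) = cscale \<i> (mult_op (cut_symbol s n) x)" for n and x :: "'a l2"
    by (rule mult_op_cscale[OF w])
  have wc: "(\<lambda>z::'a. cut_symbol s k z * cutoff n z) = cut_symbol s (min k n)"
    "(\<lambda>z::'a. cutoff k z * cut_symbol s n z) = cut_symbol s (min k n)" for k n
    by (auto simp: fun_eq_iff cut_symbol_def cutoff_def indicator_def min_def)
  show "mult_op (cut_symbol s k) (mult_op (cutoff n) x) = mult_op (cut_symbol s (min k n)) x" for k n and x :: "'a l2"
    by (simp add: mult_op_mult_op[OF w c] wc)
  show "mult_op (cutoff k) (mult_op (cut_symbol s n) x) = mult_op (cut_symbol s (min k n)) x" for k n and x :: "'a l2"
    by (simp add: mult_op_mult_op[OF c w] wc)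
  show "(norm (mult_op (cutoff n) x - mult_op (cutoff k) x))\<^sup>2
      \<le> real (Suc k) powr (- (2 * s)) * inner (mult_op (cut_symbol s n) x) x" if kn: "k \<le> n" for k n and x :: "'a l2"
  proof -
    let ?d = "\<lambda>z::'a. cutoff n z - cutoff k z"
    let ?r = "real (Suc k) powr (- (2 * s))"
    note d = bdd_multiplier_diff[OF c c, of n k]
    have r: "bdd_multiplier ?r (\<lambda>z::'a. ?r)" by (simp add: bdd_multiplier_def)
    note rw = bdd_multiplier_times[OF r w, of n]
    have le: "?d z * ?d z \<le> ?r * cut_symbol s n z" for z
    proof (cases "real (Suc k) < norm z \<and> norm z \<le> real (Suc n)")
      case True
      then have "real (Suc k) powr (2 * s) \<le> norm z powr (2 * s)" using s by (intro powr_mono2) auto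
      then have "1 \<le> ?r * norm z powr (2 * s)" by (simp add: powr_minus field_simps)
      then show ?thesis using True by (simp add: cut_symbol_def cutoff_def)
    next
      case False
      then have "?d z = 0" using kn by (auto simp: cutoff_def indicator_def)
      then show ?thesis using cut_symbol_nonneg[of s n z] by simp
    qed
    have "(norm (mult_op (cutoff n) x - mult_op (cutoff k) x))\<^sup>2 = inner (mult_op ?d (mult_op ?d x)) x"
      unfolding mult_op_diff_multiplier[OF c c] power2_norm_eq_inner mult_op_sym[OF d] ..
    also have "\<dots> \<le> inner (mult_op (\<lambda>z. ?r * cut_symbol s n z) x) x"
      unfolding mult_op_mult_op[OF d d]
      by (rule mult_op_mono[OF bdd_multiplier_times[OF d d] rw]) (rule AE_I2, rule le)
    also have "\<dots> = ?r * inner (mult_op (cut_symbol s n) x) x"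
      unfolding inner_mult_op(1)[OF rw] inner_mult_op(1)[OF w] by (simp add: mult.assoc)
    finally show ?thesis .
  qed
  show "(\<lambda>k. real (Suc k) powr (- (2 * s))) \<longlonglongrightarrow> 0"
    using s by (intro LIMSEQ_Suc[of "\<lambda>k. real k powr (- (2 * s))"] tendsto_neg_powr filterlim_real_sequentially) simp
  show "0 \<le> real (Suc k) powr (- (2 * s))" for k by simp
  show "(\<lambda>n. mult_op (cutoff n) x) \<longlonglongrightarrow> x" for x :: "'a l2"
  proof -
    have "(\<lambda>n. abs_l2 (\<lambda>z. of_real (cutoff n z) * rep_l2 x z)) \<longlonglongrightarrow> abs_l2 (rep_l2 x)"
    proof (rule l2_dominated_convergence(3)[OF _ _ L2_rep[of x]])
      show "(\<lambda>z. of_real (cutoff n z) * rep_l2 x z) \<in> borel_measurable lebesgue" for n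
        by (intro L2_measurable L2_mult_op[OF c] L2_rep)
      show "rep_l2 x \<in> borel_measurable lebesgue" by (intro L2_measurable L2_rep)
      show "AE z in lebesgue. norm (of_real (cutoff n z) * rep_l2 x z) \<le> norm (rep_l2 x z)" for n
        by (auto simp: cutoff_def norm_mult indicator_def)
      show "AE z in lebesgue. (\<lambda>n. of_real (cutoff n z) * rep_l2 x z) \<longlonglongrightarrow> rep_l2 x z"
      proof (intro AE_I2 tendsto_eventually)
        fix z
        show "\<forall>\<^sub>F n in sequentially. of_real (cutoff n z) * rep_l2 x z = rep_l2 x z"
          using eventually_ge_at_top[of "nat \<lceil>norm z\<rceil>"]
        proof eventually_elim
          case (elim n)
          then have "norm z \<le> real (Suc n)" by linarith
          then show ?case by (simp add: cutoff_def)
        qed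
      qed
    qed
    then show ?thesis by (simp add: mult_op_def)
  qed
qed

section \<open>Sobolev norms\<close>

text \<open>
  Monotone convergence as the cutoff is removed: bounded kinetic energies mean that \<open>|\<xi>|\<^sup>s f\<close> is in \<open>L\<^sup>2\<close>.
\<close>

lemma kinetic_bounded_L2:
  assumes s: "s > 0" and f: "L2 f"
    and q: "\<And>n. inner (mult_op (cut_symbol s n) (abs_l2 f)) (abs_l2 f) \<le> q"
  shows "L2 (\<lambda>\<xi>. of_real (norm \<xi> powr s) * f \<xi>)"
    and "(L2_norm (\<lambda>\<xi>. of_real (norm \<xi> powr s) * f \<xi>))\<^sup>2 \<le> q"
proof -
  note w = cut_symbol_multiplier[OF s]
  note int = inner_mult_op_abs(2)[OF w f]
  have q': "(LINT z|lebesgue. cut_symbol s n z * (norm (f z))\<^sup>2) \<le> q" for n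
    using q[of n] unfolding inner_mult_op_abs(1)[OF w f] .
  have mono: "mono (\<lambda>n. cut_symbol s n z * (norm (f z))\<^sup>2)" for z
    by (intro monoI mult_right_mono) (auto simp: cut_symbol_def cutoff_def indicator_def)
  have "incseq (\<lambda>n. LINT z|lebesgue. cut_symbol s n z * (norm (f z))\<^sup>2)"
    by (intro incseq_SucI integral_mono int) (rule monoD[OF mono], simp)
  then obtain L where L: "(\<lambda>n. LINT z|lebesgue. cut_symbol s n z * (norm (f z))\<^sup>2) \<longlonglongrightarrow> L"
    using incseq_convergent[of _ q] q' by metis
  have "L \<le> q" using LIMSEQ_le_const2[OF L] q' by blast
  have fm: "(\<lambda>\<xi>. of_real (norm \<xi> powr s) * f \<xi>) \<in> borel_measurable lebesgue"
  proof -
    have "(\<lambda>\<xi>::'a. complex_of_real (norm \<xi> powr s)) \<in> borel_measurable borel" by measurable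
    then show ?thesis by (intro borel_measurable_times L2_measurable[OF f] measurable_completion) simp
  qed
  have eq: "(norm (of_real (norm z powr s) * f z))\<^sup>2 = norm z powr (2 * s) * (norm (f z))\<^sup>2" for z
    by (simp add: norm_mult power_mult_distrib power2_eq_square[of "norm z powr s"] powr_add[symmetric])
  have lim: "(\<lambda>n. cut_symbol s n z * (norm (f z))\<^sup>2) \<longlonglongrightarrow> (norm (of_real (norm z powr s) * f z))\<^sup>2" for z
  proof (rule tendsto_eventually)
    show "\<forall>\<^sub>F n in sequentially. cut_symbol s n z * (norm (f z))\<^sup>2 = (norm (of_real (norm z powr s) * f z))\<^sup>2"
      using eventually_ge_at_top[of "nat \<lceil>norm z\<rceil>"]
    proof eventually_elim
      case (elim n)
      then have "norm z \<le> real (Suc n)" by linarith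
      then show ?case unfolding eq by (simp add: cutoff_def cut_symbol_def)
    qed
  qed
  have m: "(\<lambda>z. (norm (of_real (norm z powr s) * f z))\<^sup>2) \<in> borel_measurable lebesgue"
    by (intro borel_measurable_power measurable_compose[OF fm borel_measurable_norm])
  note mc = int AE_I2[OF mono] AE_I2[OF lim] L m
  show "L2 (\<lambda>\<xi>. of_real (norm \<xi> powr s) * f \<xi>)"
    unfolding L2_def using fm integrable_monotone_convergence[OF mc] by blast
  show "(L2_norm (\<lambda>\<xi>. of_real (norm \<xi> powr s) * f \<xi>))\<^sup>2 \<le> q"
  proof -
    have "(L2_norm (\<lambda>\<xi>. of_real (norm \<xi> powr s) * f \<xi>))\<^sup>2 = (LINT z|lebesgue. (norm (of_real (norm z powr s) * f z))\<^sup>2)"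
      by (simp add: L2_norm_def)
    then show ?thesis using integral_monotone_convergence[OF mc] \<open>L \<le> q\<close> by simp
  qed
qed

lemma kinetic_le_L2:
  assumes s: "s > 0" and f: "L2 f" and w: "L2 (\<lambda>\<xi>. of_real (norm \<xi> powr s) * f \<xi>)"
  shows "inner (mult_op (cut_symbol s n) (abs_l2 f)) (abs_l2 f) \<le> (L2_norm (\<lambda>\<xi>. of_real (norm \<xi> powr s) * f \<xi>))\<^sup>2"
proof -
  have "(LINT z|lebesgue. cut_symbol s n z * (norm (f z))\<^sup>2) \<le> (LINT z|lebesgue. (norm (of_real (norm z powr s) * f z))\<^sup>2)"
  proof (intro integral_mono L2_integrable w inner_mult_op_abs(2)[OF cut_symbol_multiplier[OF s] f])
    fix z
    have "(norm (of_real (norm z powr s) * f z))\<^sup>2 = norm z powr (2 * s) * (norm (f z))\<^sup>2"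
      by (simp add: norm_mult power_mult_distrib power2_eq_square[of "norm z powr s"] powr_add[symmetric])
    then show "cut_symbol s n z * (norm (f z))\<^sup>2 \<le> (norm (of_real (norm z powr s) * f z))\<^sup>2"
      by (auto simp: cut_symbol_def cutoff_def indicator_def)
  qed
  then show ?thesis
    unfolding inner_mult_op_abs(1)[OF cut_symbol_multiplier[OF s] f] by (simp add: L2_norm_def)
qed

lemma frac_laplacian_norm:
  assumes "is_frac_laplacian (s / 2) u g"
  shows "L2 (\<lambda>\<xi>. of_real (norm \<xi> powr s) * fourier_L2 u \<xi>)"
    and "L2_norm g = L2_norm (\<lambda>\<xi>. of_real (norm \<xi> powr s) * fourier_L2 u \<xi>)"
proof -
  have L: "L2 u" "L2 g" and ae: "AE \<xi> in lebesgue. fourier_L2 g \<xi> = of_real (norm \<xi> powr s) * fourier_L2 u \<xi>"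
    using assms by (auto simp: is_frac_laplacian_def)
  show w: "L2 (\<lambda>\<xi>. of_real (norm \<xi> powr s) * fourier_L2 u \<xi>)"
    by (rule L2_cong_AE[OF fourier_L2_L2[OF L(2)] ae])
  have "L2_norm g = norm (FT (abs_l2 g))" by (simp add: norm_abs_l2 L)
  also have "\<dots> = norm (abs_l2 (\<lambda>\<xi>. of_real (norm \<xi> powr s) * fourier_L2 u \<xi>))"
    unfolding FT_abs[OF L(2)] using abs_l2_eq_iff[OF fourier_L2_L2[OF L(2)] w] ae by simp
  finally show "L2_norm g = L2_norm (\<lambda>\<xi>. of_real (norm \<xi> powr s) * fourier_L2 u \<xi>)" by (simp add: norm_abs_l2 w)
qed

text \<open>
  A function of finite kinetic energy is in \<open>H\<^sup>s\<close>: since the Fourier transform is onto, \<open>|\<xi>|\<^sup>s \<F>u\<close> is the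
  transform of some \<open>g\<close>, and \<open>g\<close> is then \<open>(-\<Delta>)\<^sup>s\<^sup>/\<^sup>2 u\<close>.
\<close>

lemma Hs_kinetic_le:
  assumes s: "s > 0" and u: "L2 u"
    and q: "\<And>n. inner (mult_op (cut_symbol s n) (FT (abs_l2 u))) (FT (abs_l2 u)) \<le> q"
  shows "Hs s u" and "Hs_norm s u \<le> norm (abs_l2 u) + sqrt q"
proof -
  let ?w = "\<lambda>\<xi>. of_real (norm \<xi> powr s) * fourier_L2 u \<xi>"
  have w: "L2 ?w" "(L2_norm ?w)\<^sup>2 \<le> q"
    using kinetic_bounded_L2[OF s fourier_L2_L2[OF u], of q] q unfolding FT_abs[OF u] by blast+
  define g where "g = rep_l2 (FTi (abs_l2 ?w))"
  have "abs_l2 (fourier_L2 g) = abs_l2 ?w"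
    using FT_abs[OF L2_rep, of "FTi (abs_l2 ?w)"] by (simp add: g_def)
  then have "AE \<xi> in lebesgue. fourier_L2 g \<xi> = ?w \<xi>"
    by (subst (asm) abs_l2_eq_iff) (auto intro: w fourier_L2_L2 simp: g_def)
  then have g: "is_frac_laplacian (s / 2) u g"
    using u by (simp add: is_frac_laplacian_def g_def)
  then show "Hs s u" using u by (auto simp: Hs_def)
  have "is_frac_laplacian (s / 2) u (frac_laplacian (s / 2) u)"
    unfolding frac_laplacian_def using g by (rule someI[where P="is_frac_laplacian (s / 2) u"])
  from frac_laplacian_norm(2)[OF this] have "L2_norm (frac_laplacian (s / 2) u) = L2_norm ?w" .
  moreover have "L2_norm ?w \<le> sqrt q" using w(2) by (rule real_le_rsqrt)
  ultimately show "Hs_norm s u \<le> norm (abs_l2 u) + sqrt q"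
    by (simp add: Hs_norm_def norm_abs_l2 u)
qed

lemma Hs_kinetic:
  assumes s: "s > 0" and u: "Hs s u"
  shows "L2 u" and "norm (abs_l2 u) \<le> Hs_norm s u" and "0 \<le> Hs_norm s u"
    and "inner (mult_op (cut_symbol s n) (FT (abs_l2 u))) (FT (abs_l2 u)) \<le> (Hs_norm s u)\<^sup>2"
proof -
  show L: "L2 u" using u by (simp add: Hs_def)
  obtain g where g: "is_frac_laplacian (s / 2) u g" using u by (auto simp: Hs_def)
  have g': "is_frac_laplacian (s / 2) u (frac_laplacian (s / 2) u)"
    unfolding frac_laplacian_def using g by (rule someI[where P="is_frac_laplacian (s / 2) u"])
  have nn: "0 \<le> L2_norm f" for f :: "'a \<Rightarrow> complex" by (simp add: L2_norm_def)
  show "norm (abs_l2 u) \<le> Hs_norm s u" "0 \<le> Hs_norm s u"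
    using nn[of u] nn[of "frac_laplacian (s / 2) u"] by (simp_all add: Hs_norm_def norm_abs_l2 L)
  have "inner (mult_op (cut_symbol s n) (FT (abs_l2 u))) (FT (abs_l2 u)) \<le> (L2_norm (frac_laplacian (s / 2) u))\<^sup>2"
    unfolding FT_abs[OF L] frac_laplacian_norm(2)[OF g']
    by (rule kinetic_le_L2[OF s fourier_L2_L2[OF L] frac_laplacian_norm(1)[OF g']])
  also have "\<dots> \<le> (Hs_norm s u)\<^sup>2"
    using nn[of u] nn[of "frac_laplacian (s / 2) u"] by (intro power_mono) (simp_all add: Hs_norm_def)
  finally show "inner (mult_op (cut_symbol s n) (FT (abs_l2 u))) (FT (abs_l2 u)) \<le> (Hs_norm s u)\<^sup>2" .
qed

section \<open>Pairings with test functions\<close>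

text \<open>
  The bilinear pairing of the distributional formulation in terms of the real inner product: the
  imaginary part is the real part of the pairing with the second factor rotated by \<open>i\<close>.
\<close>

lemma pairing_eq:
  assumes f: "L2 f" and g: "L2 g"
  shows "(LINT x|lebesgue. f x * g x)
    = Complex (inner (abs_l2 f) (cconj (abs_l2 g))) (inner (abs_l2 f) (cscale \<i> (cconj (abs_l2 g))))"
proof -
  note i = L2_integrable_mult[OF f g]
  have "inner (abs_l2 f) (cconj (abs_l2 g)) = Re (LINT x|lebesgue. f x * g x)"
    using f g integral_Re[OF i] by (simp add: cconj.abs_eq inner_l2.abs_eq inner_complex_def)
  moreover have "inner (abs_l2 f) (cscale \<i> (cconj (abs_l2 g))) = Im (LINT x|lebesgue. f x * g x)"
    using f g integral_Im[OF i] by (simp add: cconj.abs_eq cscale.abs_eq inner_l2.abs_eq inner_complex_def algebra_simps)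
  ultimately show ?thesis by (simp add: complex_eq_iff)
qed

lemma time_integral_eq:
  fixes f g :: "real \<Rightarrow> real"
  assumes f: "set_integrable lborel {0..T} f" and g: "set_integrable lborel {0..T} g"
  shows "(LINT t:{0<..<T}|lebesgue. Complex (f t) (g t))
    = Complex (LINT t:{0..T}|lborel. f t) (LINT t:{0..T}|lborel. g t)"
proof -
  let ?I = "indicat_real {0..T}"
  define F where "F t = complex_of_real (?I t *\<^sub>R f t) + \<i> * complex_of_real (?I t *\<^sub>R g t)" for t
  have Fi: "integrable lborel F"
    unfolding F_def using f g unfolding set_integrable_def
    by (intro Bochner_Integration.integrable_add integrable_mult_right integrable_of_real)
  then have Fm: "F \<in> borel_measurable lborel" by (rule borel_measurable_integrable)
  have eq: "indicat_real {0<..<T} t *\<^sub>R Complex (f t) (g t) = indicat_real {0<..<T} t *\<^sub>R F t" for t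
  proof (cases "t \<in> {0<..<T}")
    case True
    then have "t \<in> {0..T}" by auto
    then show ?thesis by (simp add: F_def complex_eq_iff)
  qed simp
  have m: "(\<lambda>t. indicat_real {0<..<T} t *\<^sub>R F t) \<in> borel_measurable lborel"
    by (intro borel_measurable_scaleR Fm borel_measurable_indicator) simp
  have "(LINT t:{0<..<T}|lebesgue. Complex (f t) (g t)) = (LINT t|lborel. indicat_real {0<..<T} t *\<^sub>R F t)"
    unfolding set_lebesgue_integral_def eq by (rule integral_completion[OF m])
  also have "\<dots> = (LINT t|lborel. F t)"
  proof (rule integral_cong_AE[OF m Fm])
    have "AE t in lborel. t \<noteq> 0" "AE t in lborel. t \<noteq> T" by (rule AE_lborel_singleton)+
    then show "AE t in lborel. indicat_real {0<..<T} t *\<^sub>R F t = F t"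
      by eventually_elim (auto simp: F_def indicator_def)
  qed
  also have "\<dots> = Complex (LINT t:{0..T}|lborel. f t) (LINT t:{0..T}|lborel. g t)"
    using f g unfolding F_def set_integrable_def set_lebesgue_integral_def
    by (simp add: integrable_of_real complex_eq_iff del: of_real_mult)
  finally show ?thesis .
qed

section \<open>Solving the regularised problems\<close>

lemma vector_derivative_time:
  assumes "test_fun T \<phi>"
  shows "vector_derivative (\<lambda>\<tau>. \<phi> (\<tau>, x)) (at t) = dir_deriv (1, 0) \<phi> (t, x)"
  using test_fun_line_derivative[OF assms, of "(0, x)" "(1, 0)" t] by (simp add: vector_derivative_at)

lemma inner_FTi: "inner (FTi x) y = inner x (FT y)"
  using inner_FT[of "FTi x" y] by simp

lemma cnj_inv_fourier: "cnj (inv_fourier_L1 f \<xi>) = fourier_L1 (\<lambda>x. cnj (f x)) \<xi>"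
proof -
  have "cnj (exp (\<i> * complex_of_real r)) = exp (- \<i> * complex_of_real r)" for r
    by (simp add: exp_cnj)
  then show ?thesis
    unfolding inv_fourier_L1_def fourier_L1_def
    by (simp add: inner_commute flip: Bochner_Integration.integral_cnj)
qed

text \<open>
  The limit flow, transported back by the inverse Fourier transform. The kinetic energy is bounded by
  \<open>(1 + M) h\<^sup>2\<close>, where \<open>h\<close> is the \<open>H\<^sup>s\<close> norm of the initial value, and \<open>sqrt (1 + M) \<le> 1 + M\<close> gives the
  stated constant. The complex weak equation is the pair of real equations obtained from \<open>U_weak\<close> for
  the test function \<open>\<Phi>\<close> and for \<open>i \<Phi>\<close>.
\<close>

lemma cauchy_problem_solution:
  fixes p :: "'a::euclidean_space \<Rightarrow> real" and u0 :: "'a \<Rightarrow> complex"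
  assumes T: "T > 0" and s: "s > 0" and p: "bdd_multiplier M p" "M \<ge> 0" and p0: "AE x in lebesgue. 0 \<le> p x"
    and u0: "Hs s u0"
  shows "\<exists>u. solves_cauchy T s p u0 u \<and> (\<forall>t. Hs_norm s (u t) \<le> (2 + M) * Hs_norm s u0)"
proof -
  interpret galerkin "cscale \<i> :: 'a l2 \<Rightarrow> 'a l2" "\<lambda>x. FT (mult_op p (FTi x))" "\<lambda>n. mult_op (cutoff n)"
    "\<lambda>n. mult_op (cut_symbol s n)" M "\<lambda>k. real (Suc k) powr (- (2 * s))"
    by (rule galerkin_fourier[OF s p p0])
  let ?J = "cscale \<i> :: 'a l2 \<Rightarrow> 'a l2" and ?W = "\<lambda>x. FT (mult_op p (FTi x))"
  define x0 where "x0 = FT (abs_l2 u0)"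
  define v where "v t = U t x0" for t
  define u where "u t = rep_l2 (FTi (v t))" for t
  let ?h = "Hs_norm s u0"
  have kin0: "kin n x0 \<le> ?h\<^sup>2" for n unfolding x0_def by (rule Hs_kinetic(4)[OF s u0])
  have fin: "finite_kin x0" by (rule finite_kinI[OF kin0])
  have nx0: "norm x0 \<le> ?h" using Hs_kinetic(2)[OF s u0] by (simp add: x0_def)
  have h0: "0 \<le> ?h" by (rule Hs_kinetic(3)[OF s u0])
  have uL: "L2 (u t)" and FTu: "FT (abs_l2 (u t)) = v t" and absu: "abs_l2 (u t) = FTi (v t)" for t
    by (simp_all add: u_def)
  have finv: "finite_kin (v t)" for t unfolding v_def by (rule finite_kin_U[OF fin])
  have kinv: "kin n (v t) \<le> (1 + M) * ?h\<^sup>2" for n t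
  proof -
    have "kin n (v t) \<le> kinetic (v t)" by (rule kin_le_kinetic[OF finv])
    also have "\<dots> \<le> kinetic x0 + M * (norm x0)\<^sup>2" unfolding v_def by (rule kinetic_bound[OF fin])
    also have "\<dots> \<le> ?h\<^sup>2 + M * ?h\<^sup>2"
      by (intro add_mono kinetic_le kin0 mult_left_mono power_mono nx0 p) auto
    finally show ?thesis by (simp add: distrib_right)
  qed
  have Hsu: "Hs s (u t)" and norm_u: "Hs_norm s (u t) \<le> (2 + M) * ?h" for t
  proof -
    have q: "kin n (FT (abs_l2 (u t))) \<le> (1 + M) * ?h\<^sup>2" for n using kinv FTu by simp
    show "Hs s (u t)" by (rule Hs_kinetic_le(1)[OF s uL q])
    have "Hs_norm s (u t) \<le> norm (abs_l2 (u t)) + sqrt ((1 + M) * ?h\<^sup>2)" by (rule Hs_kinetic_le(2)[OF s uL q])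
    also have "norm (abs_l2 (u t)) \<le> ?h"
      using norm_U_le[OF fin, of t] nx0 by (simp add: absu v_def)
    also have "sqrt ((1 + M) * ?h\<^sup>2) \<le> (1 + M) * ?h"
    proof (rule real_le_lsqrt)
      show "(1 + M) * ?h\<^sup>2 \<le> ((1 + M) * ?h)\<^sup>2"
        unfolding power_mult_distrib using p(2) by (intro mult_right_mono) (auto simp: power2_eq_square)
    qed (use p(2) h0 in auto)
    finally show "Hs_norm s (u t) \<le> (2 + M) * ?h" by (simp add: algebra_simps)
  qed
  have absd: "abs_l2 (\<lambda>x. u \<tau> x - u t x) = FTi (v \<tau> - v t)" for \<tau> t
    using linear_diff[OF bounded_linear.linear[OF FTi_linear], of "v \<tau>" "v t"]
    by (simp add: minus_l2.abs_eq[symmetric] uL absu)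
  have cont: "C_Hs T s u"
    unfolding C_Hs_def
  proof (intro conjI ballI Hsu)
    fix t
    have at: "at t within {0..T} \<le> at t" by (rule at_le) simp
    have "((\<lambda>\<tau>. Hs_norm s (\<lambda>x. u \<tau> x - u t x)) \<longlongrightarrow> 0) (at t)"
    proof (rule tendstoI)
      fix e :: real assume e: "e > 0"
      have "((\<lambda>\<tau>. norm (v \<tau> - v t)) \<longlongrightarrow> norm (v t - v t)) (at t)"
        unfolding v_def using U_continuous[OF fin]
        by (intro tendsto_intros) (simp add: continuous_on_def)
      then have ev1: "\<forall>\<^sub>F \<tau> in at t. norm (v \<tau> - v t) < e / 2"
        using e by (intro order_tendstoD(2)[of _ 0]) auto
      have ev2: "\<forall>\<^sub>F \<tau> in at t. \<forall>n. kin n (v \<tau> - v t) \<le> (e / 3)\<^sup>2"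
        unfolding v_def using e by (intro U_continuous_kin[OF fin]) simp
      show "\<forall>\<^sub>F \<tau> in at t. dist (Hs_norm s (\<lambda>x. u \<tau> x - u t x)) 0 < e"
        using ev1 ev2
      proof eventually_elim
        case (elim \<tau>)
        have L: "L2 (\<lambda>x. u \<tau> x - u t x)" by (intro L2_diff uL)
        have q: "kin n (FT (abs_l2 (\<lambda>x. u \<tau> x - u t x))) \<le> (e / 3)\<^sup>2" for n
          using elim(2) by (simp add: absd)
        have "Hs_norm s (\<lambda>x. u \<tau> x - u t x) \<le> norm (v \<tau> - v t) + e / 3"
          using Hs_kinetic_le(2)[OF s L q] e by (simp add: absd)
        then show ?case
          using elim(1) e Hs_kinetic(3)[OF s Hs_kinetic_le(1)[OF s L q]] by simp
      qed
    qed
    then show "((\<lambda>\<tau>. Hs_norm s (\<lambda>x. u \<tau> x - u t x)) \<longlongrightarrow> 0) (at t within {0..T})"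
      by (rule filterlim_mono[OF _ order_refl at])
  qed
  have init: "AE x in lebesgue. u 0 x = u0 x"
  proof -
    have "u 0 = rep_l2 (abs_l2 u0)"
      unfolding u_def v_def U_0[OF fin] by (simp add: x0_def)
    then show ?thesis using rep_abs_l2[OF Hs_kinetic(1)[OF s u0]] by simp
  qed
  have eq: "\<i> * dist_dt (dist_of T u) \<phi> + dist_frac_laplacian T s u \<phi>
          + dist_of T (\<lambda>t x. complex_of_real (p x) * u t x) \<phi> = 0" if \<phi>: "test_fun T \<phi>" for \<phi>
  proof -
    let ?\<phi>' = "dir_deriv (1, 0) \<phi>"
    note \<phi>' = test_fun_dir_deriv[OF \<phi>, of "(1, 0)"]
    define \<Phi> where "\<Phi> t = FT (cconj (test_l2 \<phi> t))" for t
    define \<Phi>' where "\<Phi>' t = FT (cconj (test_l2 ?\<phi>' t))" for t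
    define w where "w t \<xi> = of_real (norm \<xi> powr (2 * s)) * fourier_L1 (\<lambda>x. cnj (slice \<phi> t x)) \<xi>" for t \<xi>
    define \<Psi> where "\<Psi> t = abs_l2 (w t)" for t
    obtain C where C: "\<And>t. L2 (w t)" "\<And>t. L2_norm (w t) \<le> C"
      using weighted_fourier_test_bound[OF \<phi> s] unfolding w_def[abs_def] by blast
    note FC = bounded_linear_compose[OF FT_linear cconj_linear]
    have d\<Phi>: "(\<Phi> has_vector_derivative \<Phi>' t) (at t)" for t
      unfolding \<Phi>_def[abs_def] \<Phi>'_def by (rule bounded_linear.has_vector_derivative[OF FC test_l2_derivative[OF \<phi>]])
    have c\<Phi>': "continuous_on UNIV \<Phi>'"
      unfolding \<Phi>'_def[abs_def] by (rule bounded_linear.continuous_on[OF FC test_l2_continuous[OF \<phi>']])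
    have zero: "\<Phi> t = 0" if "t \<le> 0 \<or> T \<le> t" for t
    proof -
      have "slice \<phi> t = (\<lambda>x. 0)" using test_fun_time[OF \<phi> that] by (auto simp: slice_def)
      then have "test_l2 \<phi> t = 0" by (simp add: test_l2_def zero_l2.abs_eq)
      then show ?thesis unfolding \<Phi>_def using linear_0[OF bounded_linear.linear[OF FC]] by simp
    qed
    have A\<Phi>: "mult_op (cut_symbol s n) (\<Phi> t) = mult_op (cutoff n) (\<Psi> t)" for n t
      unfolding \<Phi>_def \<Psi>_def fourier_cnj_slice_L2(3)[OF \<phi>]
        mult_op_abs[OF cut_symbol_multiplier[OF s] fourier_cnj_slice_L2(1)[OF \<phi>]] mult_op_abs[OF cutoff_multiplier C(1)]
      by (simp add: w_def cut_symbol_def mult_ac)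
    have n\<Psi>: "norm (\<Psi> t) \<le> C" for t by (simp add: \<Psi>_def norm_abs_l2 C)
    have z: "\<Phi> 0 = 0" "\<Phi> T = 0" using zero[of 0] zero[of T] by simp_all
    note weak1 = U_weak[OF fin T d\<Phi> c\<Phi>' z A\<Phi> n\<Psi>, folded v_def]
    have dJ: "((\<lambda>t. ?J (\<Phi> t)) has_vector_derivative ?J (\<Phi>' t)) (at t)" for t
      by (rule J.has_vector_derivative[OF d\<Phi>])
    have cJ: "continuous_on UNIV (\<lambda>t. ?J (\<Phi>' t))" by (rule J.continuous_on[OF c\<Phi>'])
    have zJ: "?J (\<Phi> 0) = 0" "?J (\<Phi> T) = 0" using z by (simp_all add: J.zero)
    have AJ: "mult_op (cut_symbol s n) (?J (\<Phi> t)) = mult_op (cutoff n) (?J (\<Psi> t))" for n t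
      by (simp add: A_J P_J A\<Phi>)
    have nJ: "norm (?J (\<Psi> t)) \<le> C" for t by (simp add: norm_J n\<Psi>)
    note weak2 = U_weak[OF fin T dJ cJ zJ AJ nJ, folded v_def]
    have JJ: "?J (?J y) = - y" for y
      by transfer (simp add: l2_rel_def)
    define a b c where "a t = Complex (inner (v t) (\<Phi>' t)) (inner (v t) (?J (\<Phi>' t)))"
      and "b t = Complex (inner (?W (v t)) (\<Phi> t)) (inner (?W (v t)) (?J (\<Phi> t)))"
      and "c t = Complex (inner (v t) (\<Psi> t)) (inner (v t) (?J (\<Psi> t)))" for t
    have a_eq: "(LINT x|lebesgue. u t x * ?\<phi>' (t, x)) = a t" for t
    proof -
      have "(LINT x|lebesgue. u t x * ?\<phi>' (t, x)) = (LINT x|lebesgue. u t x * slice ?\<phi>' t x)"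
        by (simp add: slice_def)
      then show ?thesis
        unfolding pairing_eq[OF uL slice_L2[OF \<phi>']] absu inner_FTi FT_cscale
        by (simp add: a_def \<Phi>'_def test_l2_def)
    qed
    have b_eq: "(LINT x|lebesgue. complex_of_real (p x) * u t x * \<phi> (t, x)) = b t" for t
    proof -
      have L: "L2 (\<lambda>x. complex_of_real (p x) * u t x)" by (rule L2_mult_op[OF p(1) uL])
      have abs: "abs_l2 (\<lambda>x. complex_of_real (p x) * u t x) = mult_op p (FTi (v t))"
        by (simp add: mult_op_def u_def)
      have "(LINT x|lebesgue. complex_of_real (p x) * u t x * \<phi> (t, x)) = (LINT x|lebesgue. complex_of_real (p x) * u t x * slice \<phi> t x)"
        by (simp add: slice_def)
      then show ?thesis
        unfolding pairing_eq[OF L slice_L2[OF \<phi>]] abs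
        by (simp add: b_def \<Phi>_def test_l2_def inner_FT flip: FT_cscale)
    qed
    have c_eq: "(LINT \<xi>|lebesgue. complex_of_real (norm \<xi> powr (2 * s)) * fourier_L2 (u t) \<xi> * inv_fourier_L1 (\<lambda>x. \<phi> (t, x)) \<xi>) = c t" for t
    proof -
      define g where "g \<xi> = cnj (w t \<xi>)" for \<xi>
      have g: "L2 g" unfolding g_def by (intro L2_cnj C)
      have "g \<xi> = complex_of_real (norm \<xi> powr (2 * s)) * inv_fourier_L1 (\<lambda>x. \<phi> (t, x)) \<xi>" for \<xi>
        using cnj_inv_fourier[of "\<lambda>x. \<phi> (t, x)" \<xi>, symmetric] by (simp add: g_def w_def slice_def[abs_def])
      then have "(LINT \<xi>|lebesgue. complex_of_real (norm \<xi> powr (2 * s)) * fourier_L2 (u t) \<xi> * inv_fourier_L1 (\<lambda>x. \<phi> (t, x)) \<xi>)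
          = (LINT \<xi>|lebesgue. fourier_L2 (u t) \<xi> * g \<xi>)"
        by (simp add: mult_ac)
      moreover have "abs_l2 (fourier_L2 (u t)) = v t" using FT_abs[OF uL] FTu by simp
      moreover have "cconj (abs_l2 g) = \<Psi> t" by (simp add: cconj.abs_eq g) (simp add: g_def \<Psi>_def)
      ultimately show ?thesis
        unfolding pairing_eq[OF fourier_L2_L2[OF uL] g] by (simp add: c_def)
    qed
    have minus: "set_integrable lborel {0..T} (\<lambda>t. - f t) \<Longrightarrow> set_integrable lborel {0..T} f" for f :: "real \<Rightarrow> real"
      unfolding set_integrable_def by simp
    have intc: "set_integrable lborel {0..T} (\<lambda>t. inner (v t) (\<Psi> t))"
      and intb: "set_integrable lborel {0..T} (\<lambda>t. inner (?W (v t)) (\<Phi> t))"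
      using weak2(1,3) unfolding JJ inner_minus_right by (blast intro: minus)+
    have A: "dist_of T u (\<lambda>(t, x). ?\<phi>' (t, x)) = Complex (LINT t:{0..T}|lborel. inner (v t) (\<Phi>' t)) (LINT t:{0..T}|lborel. inner (v t) (?J (\<Phi>' t)))"
      unfolding dist_of_def split_conv a_eq unfolding a_def by (rule time_integral_eq[OF weak1(2) weak2(2)])
    have B: "dist_of T (\<lambda>t x. complex_of_real (p x) * u t x) \<phi>
        = Complex (LINT t:{0..T}|lborel. inner (?W (v t)) (\<Phi> t)) (LINT t:{0..T}|lborel. inner (?W (v t)) (?J (\<Phi> t)))"
      unfolding dist_of_def b_eq unfolding b_def by (rule time_integral_eq[OF intb weak1(3)])
    have Cc: "dist_frac_laplacian T s u \<phi>
        = Complex (LINT t:{0..T}|lborel. inner (v t) (\<Psi> t)) (LINT t:{0..T}|lborel. inner (v t) (?J (\<Psi> t)))"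
      unfolding dist_frac_laplacian_def c_eq unfolding c_def by (rule time_integral_eq[OF intc weak1(1)])
    have dt: "dist_dt (dist_of T u) \<phi> = - dist_of T u (\<lambda>(t, x). ?\<phi>' (t, x))"
      unfolding dist_dt_def vector_derivative_time[OF \<phi>] ..
    have "- (LINT t:{0..T}|lborel. inner (v t) (\<Psi> t))
       = (LINT t:{0..T}|lborel. inner (v t) (?J (\<Phi>' t))) + (LINT t:{0..T}|lborel. inner (?W (v t)) (\<Phi> t))"
      using weak2(4) unfolding JJ inner_minus_right by (simp add: set_lebesgue_integral_def)
    with weak1(4) show ?thesis
      unfolding dt A B Cc by (simp add: complex_eq_iff)
  qed
  have "solves_cauchy T s p u0 u"
    unfolding solves_cauchy_def using cont init eq by blast
  then show ?thesis using norm_u by blast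
qed

lemma Linf_bdd_multiplier:
  assumes "Linf p" "Linf_norm p \<le> ereal M"
  shows "bdd_multiplier M p"
proof -
  have "AE x in lebesgue. ereal \<bar>p x\<bar> \<le> Linf_norm p"
    unfolding Linf_norm_def by (rule esssup_AE)
  then have "AE x in lebesgue. \<bar>p x\<bar> \<le> M"
    by eventually_elim (use assms(2) order_trans ereal_less_eq(3) in blast)
  then show ?thesis using assms(1) by (simp add: bdd_multiplier_def Linf_def)
qed

theorem theorem2p2:
  fixes T s :: real
    and p :: 'p and u0 :: 'q
    and reg_p :: "'p \<Rightarrow> (real \<Rightarrow> real ^ 'd \<Rightarrow> real) \<Rightarrow> bool"
    and reg_u0 :: "'q \<Rightarrow> (real \<Rightarrow> real ^ 'd \<Rightarrow> complex) \<Rightarrow> bool"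
    and pe :: "real \<Rightarrow> real ^ 'd \<Rightarrow> real"
    and u0e :: "real \<Rightarrow> real ^ 'd \<Rightarrow> complex"
  assumes "T > 0" and "s > 0"
    and "reg_p p pe" and "reg_u0 u0 u0e"
    and "\<forall>\<epsilon>\<in>{0<..1}. AE x in lebesgue. pe \<epsilon> x \<ge> 0"
    and "\<exists>(N::nat) (N0::nat) C C0. C > 0 \<and> C0 > 0 \<and>
           (\<forall>\<epsilon>\<in>{0<..1}.
              Linf (pe \<epsilon>) \<and> Linf_norm (pe \<epsilon>) \<le> ereal (C / \<epsilon> ^ N) \<and>
              Hs s (u0e \<epsilon>) \<and> Hs_norm s (u0e \<epsilon>) \<le> C0 / \<epsilon> ^ N0)"
  shows "\<exists>u. very_weak_solution reg_p reg_u0 T s p u0 u"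
proof -
  obtain N N0 :: nat and C C0 :: real where C: "C > 0" "C0 > 0"
    and pe: "\<And>\<epsilon>. \<epsilon> \<in> {0<..1} \<Longrightarrow> Linf (pe \<epsilon>)" "\<And>\<epsilon>. \<epsilon> \<in> {0<..1} \<Longrightarrow> Linf_norm (pe \<epsilon>) \<le> ereal (C / \<epsilon> ^ N)"
    and u0e: "\<And>\<epsilon>. \<epsilon> \<in> {0<..1} \<Longrightarrow> Hs s (u0e \<epsilon>)" "\<And>\<epsilon>. \<epsilon> \<in> {0<..1} \<Longrightarrow> Hs_norm s (u0e \<epsilon>) \<le> C0 / \<epsilon> ^ N0"
    using assms(6) by blast
  have "\<exists>u. solves_cauchy T s (pe \<epsilon>) (u0e \<epsilon>) u \<and> (\<forall>t. Hs_norm s (u t) \<le> (2 + C / \<epsilon> ^ N) * Hs_norm s (u0e \<epsilon>))"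
    if "\<epsilon> \<in> {0<..1}" for \<epsilon>
    using that C assms(5)
    by (intro cauchy_problem_solution[OF assms(1,2) Linf_bdd_multiplier[OF pe[OF that]]] u0e) auto
  then obtain u where u: "\<And>\<epsilon>. \<epsilon> \<in> {0<..1} \<Longrightarrow> solves_cauchy T s (pe \<epsilon>) (u0e \<epsilon>) (u \<epsilon>)"
    "\<And>\<epsilon> t. \<epsilon> \<in> {0<..1} \<Longrightarrow> Hs_norm s (u \<epsilon> t) \<le> (2 + C / \<epsilon> ^ N) * Hs_norm s (u0e \<epsilon>)"
    by metis
  have bound: "Hs_norm s (u \<epsilon> t) \<le> (2 + C) * C0 / \<epsilon> ^ (N + N0)" if e: "\<epsilon> \<in> {0<..1}" for \<epsilon> t
  proof -
    have pos: "\<epsilon> ^ N > 0" "\<epsilon> ^ N \<le> 1" using e by (auto intro: power_le_one)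
    have "Hs_norm s (u \<epsilon> t) \<le> (2 + C / \<epsilon> ^ N) * Hs_norm s (u0e \<epsilon>)" by (rule u(2)[OF e])
    also have "\<dots> \<le> ((2 + C) / \<epsilon> ^ N) * (C0 / \<epsilon> ^ N0)"
    proof (intro mult_mono u0e(2)[OF e])
      show "2 + C / \<epsilon> ^ N \<le> (2 + C) / \<epsilon> ^ N"
        using pos by (simp add: add_divide_distrib pos_le_divide_eq)
      show "0 \<le> (2 + C) / \<epsilon> ^ N" using C pos by simp
      show "0 \<le> Hs_norm s (u0e \<epsilon>)" by (rule Hs_kinetic(3)[OF assms(2) u0e(1)[OF e]])
    qed
    finally show ?thesis by (simp add: power_add)
  qed
  have "Linf_moderate pe" unfolding Linf_moderate_def using pe C by blast
  moreover have "Hs_moderate s u0e" unfolding Hs_moderate_def using u0e C by blast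
  moreover have "C_Hs_moderate T s u"
    unfolding C_Hs_moderate_def
  proof (intro conjI ballI)
    show "C_Hs T s (u \<epsilon>)" if "\<epsilon> \<in> {0<..1}" for \<epsilon> using u(1)[OF that] by (simp add: solves_cauchy_def)
    show "\<exists>N c. c > 0 \<and> (\<forall>t\<in>{0..T}. \<forall>\<epsilon>\<in>{0<..1}. Hs_norm s (u \<epsilon> t) \<le> c / \<epsilon> ^ N)"
      using bound C by (intro exI[of _ "N + N0"] exI[of _ "(2 + C) * C0"]) auto
  qed
  ultimately have "very_weak_solution reg_p reg_u0 T s p u0 u"
    unfolding very_weak_solution_def using assms(3,4) u(1) by blast
  then show ?thesis by blast
qed

end
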